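(* For every $n\in\mathbb N$, $\mathrm{I}\Sigma_n+\exp+\mathrm{C}\Sigma_{n+1}\nvdash\Sigma_{n+1}\text{-}\mathrm{WPHP}$.
   Context: Language of first-order arithmetic. $\exp$ is a $\Pi_2$ sentence asserting totality of $x\mapsto2^x$; $\mathrm{I}\Sigma_n$ is induction for $\Sigma_n$ formulas with parameters. $\mathrm{C}\Sigma_{n+1}$ (cardinality scheme) asserts that every total injection (defined on the whole universe) whose graph is defined by a $\Sigma_{n+1}$ formula with parameters has unbounded range. Numbers $x$ are identified with $\{v:v<x\}$. $\Sigma_{n+1}\text{-}\mathrm{WPHP}$: for no $x\ge1$ is there an injection from $2x$ into $x$ whose graph is $\Sigma_{n+1}$-definable with parameters. *)

theory Defs
  imports Main
begin

datatype tm = Var nat | Zero | One | Plus tm tm | Times tm tm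

datatype fm = Eq tm tm | Lt tm tm | Neg fm | Imp fm fm | Conj fm fm | Disj fm fm
  | All fm | Ex fm

primrec tsubst :: "(nat \<Rightarrow> tm) \<Rightarrow> tm \<Rightarrow> tm" where
  "tsubst \<sigma> (Var i) = \<sigma> i"
| "tsubst \<sigma> Zero = Zero"
| "tsubst \<sigma> One = One"
| "tsubst \<sigma> (Plus s t) = Plus (tsubst \<sigma> s) (tsubst \<sigma> t)"
| "tsubst \<sigma> (Times s t) = Times (tsubst \<sigma> s) (tsubst \<sigma> t)"

definition lift_tm :: "tm \<Rightarrow> tm" where
  "lift_tm t = tsubst (\<lambda>k. Var (Suc k)) t"

definition up :: "(nat \<Rightarrow> tm) \<Rightarrow> nat \<Rightarrow> tm" where
  "up \<sigma> i = (case i of 0 \<Rightarrow> Var 0 | Suc j \<Rightarrow> lift_tm (\<sigma> j))"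

primrec fsubst :: "(nat \<Rightarrow> tm) \<Rightarrow> fm \<Rightarrow> fm" where
  "fsubst \<sigma> (Eq s t) = Eq (tsubst \<sigma> s) (tsubst \<sigma> t)"
| "fsubst \<sigma> (Lt s t) = Lt (tsubst \<sigma> s) (tsubst \<sigma> t)"
| "fsubst \<sigma> (Neg p) = Neg (fsubst \<sigma> p)"
| "fsubst \<sigma> (Imp p q) = Imp (fsubst \<sigma> p) (fsubst \<sigma> q)"
| "fsubst \<sigma> (Conj p q) = Conj (fsubst \<sigma> p) (fsubst \<sigma> q)"
| "fsubst \<sigma> (Disj p q) = Disj (fsubst \<sigma> p) (fsubst \<sigma> q)"
| "fsubst \<sigma> (All p) = All (fsubst (up \<sigma>) p)"
| "fsubst \<sigma> (Ex p) = Ex (fsubst (up \<sigma>) p)"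

definition lift_fm :: "fm \<Rightarrow> fm" where
  "lift_fm p = fsubst (\<lambda>k. Var (Suc k)) p"

definition inst :: "tm \<Rightarrow> nat \<Rightarrow> tm" where
  "inst t i = (case i of 0 \<Rightarrow> t | Suc j \<Rightarrow> Var j)"

primrec tfv :: "tm \<Rightarrow> nat set" where
  "tfv (Var i) = {i}"
| "tfv Zero = {}"
| "tfv One = {}"
| "tfv (Plus s t) = tfv s \<union> tfv t"
| "tfv (Times s t) = tfv s \<union> tfv t"

primrec ffv :: "fm \<Rightarrow> nat set" where
  "ffv (Eq s t) = tfv s \<union> tfv t"
| "ffv (Lt s t) = tfv s \<union> tfv t"
| "ffv (Neg p) = ffv p"
| "ffv (Imp p q) = ffv p \<union> ffv q"
| "ffv (Conj p q) = ffv p \<union> ffv q"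
| "ffv (Disj p q) = ffv p \<union> ffv q"
| "ffv (All p) = (\<lambda>i. i - 1) ` (ffv p - {0})"
| "ffv (Ex p) = (\<lambda>i. i - 1) ` (ffv p - {0})"

definition nfv :: "fm \<Rightarrow> nat" where
  "nfv p = (if ffv p = {} then 0 else Suc (Max (ffv p)))"

definition ucl :: "fm \<Rightarrow> fm" where
  "ucl p = (All ^^ nfv p) p"

inductive Delta0 :: "fm \<Rightarrow> bool" where
  "Delta0 (Eq s t)"
| "Delta0 (Lt s t)"
| "Delta0 p \<Longrightarrow> Delta0 (Neg p)"
| "Delta0 p \<Longrightarrow> Delta0 q \<Longrightarrow> Delta0 (Imp p q)"
| "Delta0 p \<Longrightarrow> Delta0 q \<Longrightarrow> Delta0 (Conj p q)"
| "Delta0 p \<Longrightarrow> Delta0 q \<Longrightarrow> Delta0 (Disj p q)"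
| "Delta0 p \<Longrightarrow> Delta0 (All (Imp (Lt (Var 0) (lift_tm t)) p))"
| "Delta0 p \<Longrightarrow> Delta0 (Ex (Conj (Lt (Var 0) (lift_tm t)) p))"

inductive Sig :: "nat \<Rightarrow> fm \<Rightarrow> bool" and Pi :: "nat \<Rightarrow> fm \<Rightarrow> bool" where
  "Delta0 p \<Longrightarrow> Sig 0 p"
| "Delta0 p \<Longrightarrow> Pi 0 p"
| "Pi n p \<Longrightarrow> Sig (Suc n) p"
| "Sig (Suc n) p \<Longrightarrow> Sig (Suc n) (Ex p)"
| "Sig n p \<Longrightarrow> Pi (Suc n) p"
| "Pi (Suc n) p \<Longrightarrow> Pi (Suc n) (All p)"

inductive_set logax :: "fm set" where
  "Imp p (Imp q p) \<in> logax"
| "Imp (Imp p (Imp q r)) (Imp (Imp p q) (Imp p r)) \<in> logax"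
| "Imp (Imp (Neg p) (Neg q)) (Imp q p) \<in> logax"
| "Imp (Conj p q) (Neg (Imp p (Neg q))) \<in> logax"
| "Imp (Neg (Imp p (Neg q))) (Conj p q) \<in> logax"
| "Imp (Disj p q) (Imp (Neg p) q) \<in> logax"
| "Imp (Imp (Neg p) q) (Disj p q) \<in> logax"
| "Imp (Ex p) (Neg (All (Neg p))) \<in> logax"
| "Imp (Neg (All (Neg p))) (Ex p) \<in> logax"
| "Imp (All p) (fsubst (inst t) p) \<in> logax"
| "Imp (All (Imp p q)) (Imp (All p) (All q)) \<in> logax"
| "Imp p (All (lift_fm p)) \<in> logax"
| "Eq (Var 0) (Var 0) \<in> logax"
| "Imp (Eq (Var 0) (Var 1)) (Imp (Eq (Var 0) (Var 2)) (Eq (Var 1) (Var 2))) \<in> logax"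
| "Imp (Eq (Var 0) (Var 1)) (Eq (Plus (Var 0) (Var 2)) (Plus (Var 1) (Var 2))) \<in> logax"
| "Imp (Eq (Var 0) (Var 1)) (Eq (Plus (Var 2) (Var 0)) (Plus (Var 2) (Var 1))) \<in> logax"
| "Imp (Eq (Var 0) (Var 1)) (Eq (Times (Var 0) (Var 2)) (Times (Var 1) (Var 2))) \<in> logax"
| "Imp (Eq (Var 0) (Var 1)) (Eq (Times (Var 2) (Var 0)) (Times (Var 2) (Var 1))) \<in> logax"
| "Imp (Eq (Var 0) (Var 1)) (Imp (Lt (Var 0) (Var 2)) (Lt (Var 1) (Var 2))) \<in> logax"
| "Imp (Eq (Var 0) (Var 1)) (Imp (Lt (Var 2) (Var 0)) (Lt (Var 2) (Var 1))) \<in> logax"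

inductive prv :: "fm set \<Rightarrow> fm \<Rightarrow> bool" where
  ax: "p \<in> logax \<Longrightarrow> prv T p"
| thy: "p \<in> T \<Longrightarrow> prv T p"
| mp: "prv T (Imp p q) \<Longrightarrow> prv T p \<Longrightarrow> prv T q"
| gen: "prv T p \<Longrightarrow> prv T (All p)"

abbreviation "x0 \<equiv> Var 0"
abbreviation "x1 \<equiv> Var 1"
abbreviation "x2 \<equiv> Var 2"

text \<open>PA-minus (nonnegative parts of discretely ordered commutative semirings), Kaye.\<close>
definition PAminus :: "fm set" where
  "PAminus = ucl ` {
     Eq (Plus (Plus x0 x1) x2) (Plus x0 (Plus x1 x2)),
     Eq (Plus x0 x1) (Plus x1 x0),
     Eq (Times (Times x0 x1) x2) (Times x0 (Times x1 x2)),
     Eq (Times x0 x1) (Times x1 x0),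
     Eq (Times x0 (Plus x1 x2)) (Plus (Times x0 x1) (Times x0 x2)),
     Conj (Eq (Plus x0 Zero) x0) (Eq (Times x0 Zero) Zero),
     Eq (Times x0 One) x0,
     Imp (Conj (Lt x0 x1) (Lt x1 x2)) (Lt x0 x2),
     Neg (Lt x0 x0),
     Disj (Lt x0 x1) (Disj (Eq x0 x1) (Lt x1 x0)),
     Imp (Lt x0 x1) (Lt (Plus x0 x2) (Plus x1 x2)),
     Imp (Conj (Lt Zero x2) (Lt x0 x1)) (Lt (Times x0 x2) (Times x1 x2)),
     Imp (Lt x0 x1) (Ex (Eq (Plus (Var 1) (Var 0)) (Var 2))),
     Conj (Lt Zero One) (Imp (Lt Zero x0) (Disj (Lt One x0) (Eq One x0))),
     Disj (Eq x0 Zero) (Lt Zero x0) }"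

text \<open>inst1 d s p: put the distinguished variable (index 0) of p to s, and move
  the parameters (indices \<ge> 1) below d freshly introduced binders.\<close>
definition inst1 :: "nat \<Rightarrow> tm \<Rightarrow> fm \<Rightarrow> fm" where
  "inst1 d s p = fsubst (\<lambda>i. if i = 0 then s else Var (i - 1 + d)) p"

text \<open>inst2 d s t p: variables 0 and 1 of p become s and t, parameters (\<ge> 2)
  are moved below d binders.\<close>
definition inst2 :: "nat \<Rightarrow> tm \<Rightarrow> tm \<Rightarrow> fm \<Rightarrow> fm" where
  "inst2 d s t p = fsubst (\<lambda>i. if i = 0 then s else if i = 1 then t else Var (i - 2 + d)) p"

definition ind :: "fm \<Rightarrow> fm" where
  "ind p = ucl (Imp
      (Conj (inst1 0 Zero p)
            (All (Imp (inst1 1 (Var 0) p) (inst1 1 (Plus (Var 0) One) p))))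
      (All (inst1 1 (Var 0) p)))"

definition ISig :: "nat \<Rightarrow> fm set" where
  "ISig n = PAminus \<union> {ind p | p. Sig n p}"

definition card_ax :: "fm \<Rightarrow> fm" where
  "card_ax p = ucl (Imp
     (Conj (All (Ex (inst2 2 (Var 1) (Var 0) p)))
     (Conj (All (All (All (Imp (Conj (inst2 3 (Var 2) (Var 1) p) (inst2 3 (Var 2) (Var 0) p))
                               (Eq (Var 1) (Var 0))))))
           (All (All (All (Imp (Conj (inst2 3 (Var 2) (Var 0) p) (inst2 3 (Var 1) (Var 0) p))
                               (Eq (Var 2) (Var 1))))))))
     (All (Ex (Ex (Conj (inst2 3 (Var 1) (Var 0) p) (Lt (Var 2) (Var 0)))))))"

definition CSig :: "nat \<Rightarrow> fm set" where
  "CSig m = {card_ax p | p. Sig m p}"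

definition wphp :: "fm \<Rightarrow> fm" where
  "wphp p = ucl (Neg (Ex (Conj (Lt Zero (Var 0))
     (Conj
       (All (Imp (Lt (Var 0) (Plus (Var 1) (Var 1)))
                 (Ex (Conj (Lt (Var 0) (Var 2)) (inst2 3 (Var 1) (Var 0) p)))))
     (Conj
       (All (All (All (Imp
          (Conj (Lt (Var 2) (Plus (Var 3) (Var 3))) (Conj (Lt (Var 1) (Var 3))
          (Conj (Lt (Var 0) (Var 3))
          (Conj (inst2 4 (Var 2) (Var 1) p) (inst2 4 (Var 2) (Var 0) p)))))
          (Eq (Var 1) (Var 0))))))
       (All (All (All (Imp
          (Conj (Lt (Var 2) (Plus (Var 3) (Var 3))) (Conj (Lt (Var 1) (Plus (Var 3) (Var 3)))
          (Conj (Lt (Var 0) (Var 3))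
          (Conj (inst2 4 (Var 2) (Var 0) p) (inst2 4 (Var 1) (Var 0) p)))))
          (Eq (Var 2) (Var 1)))))))))))"

text \<open>exp: E(x,y) (x = variable 0, y = variable 1) is a Delta_0 formula defining
  the graph of y = 2^x, in the sense that I-Delta_0 proves the recursion
  equations for it; these conditions determine E up to I-Delta_0-provable
  equivalence.\<close>
definition exp_graph :: "fm \<Rightarrow> bool" where
  "exp_graph E \<longleftrightarrow> Delta0 E \<and> ffv E \<subseteq> {0, 1} \<and>
     prv (ISig 0) (inst2 0 Zero One E) \<and>
     prv (ISig 0) (All (All (Imp (inst2 2 (Var 1) (Var 0) E)
                                 (inst2 2 (Plus (Var 1) One) (Plus (Var 0) (Var 0)) E)))) \<and>
     prv (ISig 0) (All (All (Imp (inst2 2 (Plus (Var 1) One) (Var 0) E)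
                                 (Ex (Conj (Lt (Var 0) (Plus (Var 1) One)) (inst2 3 (Var 2) (Var 0) E)))))) \<and>
     prv (ISig 0) (All (All (All (Imp (Conj (inst2 3 (Var 2) (Var 1) E) (inst2 3 (Var 2) (Var 0) E))
                                      (Eq (Var 1) (Var 0)))))) \<and>
     prv (ISig 0) (All (Imp (inst2 1 Zero (Var 0) E) (Eq (Var 0) One)))"

definition exp_ax :: "fm \<Rightarrow> fm" where
  "exp_ax E = All (Ex (inst2 2 (Var 1) (Var 0) E))"

end

(*
A structure K is built inside an ultrapower of the natural numbers.  At index j there is a fast
growing sequence of "states" h_0 < h_1 < ... whose successor function has a Pi_n graph, and a tuple
of "digits" y_i < 2^(h_i (h_i + 5)).  K consists of everything that total programs with the n-th
jump as an oracle compute from j and finitely many states and digits.  The states are cofinal in K,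
and bounded search makes K a Sigma_n-elementary substructure closed under the Sigma_n Skolem
functions; hence I Sigma_n and exp hold.

The i-th state also guesses the i-th program value below 2j, namely the most popular one among the
digit tuples that agree with all previous guesses; so at least a fraction 1/(2j+1) of the tuples
survives each stage, and the digits can be chosen consistently with all guesses.  Therefore the
elements of K below 2a (a the identity sequence) are the guesses of standard index i, and x |-> i is
a Sigma_(n+1) injection from 2a into a.

Since the range of y_i is huge compared with the losses at each stage, y_i can moreover be chosen
outside the small set of values that programs compute from numbers below h_i and a later state.  An
injection f of K into a bounded set would let y_i be computed in this way from f(y_i) and a bound
for the witness of the Sigma_(n+1) graph; hence C Sigma_(n+1) holds.
*)

theory Submission
  imports Defs "HOL-Library.Function_Algebras" "HOL-Library.Nat_Bijection" "HOL-Number_Theory.Cong"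
begin

section \<open>Tarskian semantics\<close>

text \<open>The two schemes pull in opposite directions. If every element of \<open>K\<close> were
  named by standard data, sending an element to its name would be the kind of definable injection
  into a bounded set that the cardinality scheme forbids. So elements not computable from smaller
  data have to be adjoined. Yet below 2a every element must keep a standard name, and an adjoined
  digit threatens that. The two demands are reconciled by counting at each index j. Making the value
  of one program predictable costs a factor of at most 2j+1 in the number of tuples, whereas the
  digits to be avoided form a far smaller share of the range. Only j stages and j digits are treated
  at index j; in the ultrapower this covers all standard ones. Only values below 2j are guessed, so
  larger elements remain unpredictable. The successor of a state must have a Pi_n graph because
  exact transfer between \<open>K\<close> and the coordinates stops at level n: a sequence of states
  is then a certificate with Pi_n matrix. The injection sends x to the least stage that guesses x;
  this stage is standard, hence below the nonstandard a.\<close>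

definition push :: "'a \<Rightarrow> (nat \<Rightarrow> 'a) \<Rightarrow> nat \<Rightarrow> 'a" (infixr "##" 65) where
  "u ## e = case_nat u e"

lemma push_simps [simp]:
  "(u ## e) 0 = u" "(u ## e) (Suc i) = e i" "(u ## e) 1 = e 0"
  "(u ## e) (numeral k) = e (pred_numeral k)"
  by (simp_all add: push_def numeral_eq_Suc)

lemma push_if: "(u ## e) i = (if i = 0 then u else e (i - 1))"
  by (cases i) simp_all

primrec tval :: "(nat \<Rightarrow> 'a::{zero,one,plus,times}) \<Rightarrow> tm \<Rightarrow> 'a" where
  "tval e (Var i) = e i"
| "tval e Zero = 0"
| "tval e One = 1"
| "tval e (Plus s t) = tval e s + tval e t"
| "tval e (Times s t) = tval e s * tval e t"

primrec sat :: "'a::{zero,one,plus,times} set \<Rightarrow> ('a \<Rightarrow> 'a \<Rightarrow> bool) \<Rightarrow> ('a \<Rightarrow> 'a \<Rightarrow> bool)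
    \<Rightarrow> (nat \<Rightarrow> 'a) \<Rightarrow> fm \<Rightarrow> bool" where
  "sat D eq lt e (Eq s t) = eq (tval e s) (tval e t)"
| "sat D eq lt e (Lt s t) = lt (tval e s) (tval e t)"
| "sat D eq lt e (Neg p) = (\<not> sat D eq lt e p)"
| "sat D eq lt e (Imp p q) = (sat D eq lt e p \<longrightarrow> sat D eq lt e q)"
| "sat D eq lt e (Conj p q) = (sat D eq lt e p \<and> sat D eq lt e q)"
| "sat D eq lt e (Disj p q) = (sat D eq lt e p \<or> sat D eq lt e q)"
| "sat D eq lt e (All p) = (\<forall>u\<in>D. sat D eq lt (u ## e) p)"
| "sat D eq lt e (Ex p) = (\<exists>u\<in>D. sat D eq lt (u ## e) p)"

abbreviation natsat :: "(nat \<Rightarrow> nat) \<Rightarrow> fm \<Rightarrow> bool" where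
  "natsat \<equiv> sat UNIV (=) (<)"

lemma tval_tsubst: "tval e (tsubst \<sigma> t) = tval (\<lambda>i. tval e (\<sigma> i)) t"
  by (induction t) auto

lemma push_eta: "e 0 ## (\<lambda>i. e (Suc i)) = e"
  by (auto simp: push_if)

lemma tval_lift [simp]: "tval (u ## e) (lift_tm t) = tval e t"
  by (simp add: lift_tm_def tval_tsubst)

lemma tval_up: "(\<lambda>i. tval (u ## e) (up \<sigma> i)) = u ## (\<lambda>i. tval e (\<sigma> i))"
  by (auto simp: up_def push_if split: nat.split)

lemma sat_fsubst: "sat D eq lt e (fsubst \<sigma> p) = sat D eq lt (\<lambda>i. tval e (\<sigma> i)) p"
  by (induction p arbitrary: e \<sigma>) (simp_all add: tval_tsubst tval_up)

lemma sat_lift [simp]: "sat D eq lt (u ## e) (lift_fm p) = sat D eq lt e p"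
  by (simp add: lift_fm_def sat_fsubst)

lemma sat_inst: "sat D eq lt e (fsubst (inst t) p) = sat D eq lt (tval e t ## e) p"
proof -
  have "(\<lambda>i. tval e (inst t i)) = tval e t ## e"
    by (auto simp: inst_def push_if split: nat.split)
  then show ?thesis by (simp add: sat_fsubst)
qed

lemma sat_inst1: "sat D eq lt e (inst1 d s p) = sat D eq lt (tval e s ## (\<lambda>i. e (i + d))) p"
proof -
  have "(\<lambda>i. tval e (if i = 0 then s else Var (i - 1 + d))) = tval e s ## (\<lambda>i. e (i + d))"
    by (auto simp: push_if)
  then show ?thesis by (simp add: inst1_def sat_fsubst)
qed

lemma sat_inst2:
  "sat D eq lt e (inst2 d s t p) = sat D eq lt (tval e s ## tval e t ## (\<lambda>i. e (i + d))) p"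
proof -
  have "(\<lambda>i. tval e (if i = 0 then s else if i = 1 then t else Var (i - 2 + d)))
      = tval e s ## tval e t ## (\<lambda>i. e (i + d))"
    by (auto simp: push_if numeral_2_eq_2)
  then show ?thesis by (simp add: inst2_def sat_fsubst)
qed

text \<open>\<^term>\<open>eq\<close> is only required to be a congruence, and \<^term>\<open>E\<close> is the set of admissible
  assignments: this allows an ultrapower to be used without forming the quotient, and with
  finitely coded assignments only.\<close>

locale fo_structure =
  fixes D :: "'a::{zero,one,plus,times} set"
    and eq lt :: "'a \<Rightarrow> 'a \<Rightarrow> bool"
    and E :: "(nat \<Rightarrow> 'a) set"
  assumes eq_refl: "eq x x"
    and eq_euclid: "eq x y \<Longrightarrow> eq x z \<Longrightarrow> eq y z"
    and eq_plus: "eq x y \<Longrightarrow> eq x' y' \<Longrightarrow> eq (x + x') (y + y')"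
    and eq_times: "eq x y \<Longrightarrow> eq x' y' \<Longrightarrow> eq (x * x') (y * y')"
    and eq_lt: "eq x y \<Longrightarrow> eq x' y' \<Longrightarrow> lt x x' \<Longrightarrow> lt y y'"
    and tval_D: "e \<in> E \<Longrightarrow> tval e t \<in> D"
    and push_E: "e \<in> E \<Longrightarrow> u \<in> D \<Longrightarrow> u ## e \<in> E"
    and tail_E: "e \<in> E \<Longrightarrow> (\<lambda>i. e (Suc i)) \<in> E"
begin

definition valid :: "fm \<Rightarrow> bool" where
  "valid p \<longleftrightarrow> (\<forall>e\<in>E. sat D eq lt e p)"

lemma valid_All: "valid (All p) \<longleftrightarrow> valid p"
proof
  assume *: "valid (All p)"
  show "valid p"
    unfolding valid_def
  proof
    fix e assume e: "e \<in> E"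
    have "e 0 \<in> D"
      using tval_D[OF e, of "Var 0"] by simp
    with * tail_E[OF e] have "sat D eq lt (e 0 ## (\<lambda>i. e (Suc i))) p"
      by (auto simp: valid_def)
    then show "sat D eq lt e p"
      by (simp only: push_eta)
  qed
qed (auto simp: valid_def push_E)

lemma valid_ucl: "valid (ucl p) \<longleftrightarrow> valid p"
proof -
  have "valid ((All ^^ k) p) \<longleftrightarrow> valid p" for k
    by (induction k) (simp_all add: valid_All)
  then show ?thesis by (simp add: ucl_def)
qed

lemma valid_logax: "p \<in> logax \<Longrightarrow> valid p"
  unfolding valid_def
  by (induction rule: logax.induct)
    (auto simp: sat_inst tval_D eq_refl intro: eq_euclid eq_plus eq_times eq_lt[OF _ eq_refl] eq_lt[OF eq_refl])

lemma soundness: "prv T p \<Longrightarrow> (\<And>q. q \<in> T \<Longrightarrow> valid q) \<Longrightarrow> valid p"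
proof (induction rule: prv.induct)
  case (ax p T)
  then show ?case by (simp add: valid_logax)
next
  case (gen T p)
  then show ?case by (simp add: valid_All)
qed (auto simp: valid_def)

end

interpretation N: fo_structure "UNIV :: nat set" "(=)" "(<)" UNIV
  by unfold_locales auto

lemma nat_PAminus: "p \<in> PAminus \<Longrightarrow> N.valid p"
  unfolding PAminus_def
  by (elim imageE insertE emptyE; simp add: N.valid_ucl; simp add: N.valid_def)
    (auto simp: algebra_simps, metis add.commute less_imp_add_positive)

text \<open>The clauses of \<open>exp_graph\<close> speak of provability in \<open>ISig 0\<close>;
  soundness over the natural numbers turns them into facts about actual powers of two.\<close>

lemma nat_ISig: "p \<in> ISig n \<Longrightarrow> N.valid p"
proof -
  have "N.valid (ind p)" for p
    unfolding ind_def N.valid_ucl unfolding N.valid_def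
  proof (intro ballI, simp only: sat.simps sat_inst1 tval.simps, intro impI ballI, elim conjE)
    fix e :: "nat \<Rightarrow> nat" and b
    assume zero: "natsat (0 ## (\<lambda>i. e (i + 0))) p"
      and step: "\<forall>u\<in>UNIV. natsat ((u ## e) 0 ## (\<lambda>i. (u ## e) (i + 1))) p \<longrightarrow>
        natsat (((u ## e) 0 + 1) ## (\<lambda>i. (u ## e) (i + 1))) p"
    have "natsat (b ## e) p"
    proof (induction b)
      case 0
      show ?case using zero by simp
    next
      case (Suc b)
      then show ?case using step[rule_format, of b] by simp
    qed
    then show "natsat ((b ## e) 0 ## (\<lambda>i. (b ## e) (i + 1))) p"
      by simp
  qed
  then show "p \<in> ISig n \<Longrightarrow> N.valid p"
    by (auto simp: ISig_def nat_PAminus)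
qed

lemma exp_graph_nat:
  assumes "exp_graph E"
  shows "natsat (x ## (2 ^ x) ## e) E"
proof -
  have val: "N.valid p" if "prv (ISig 0) p" for p
    using that nat_ISig N.soundness by blast
  have A: "N.valid (inst2 0 Zero One E)"
    and B: "N.valid (All (All (Imp (inst2 2 (Var 1) (Var 0) E)
                                 (inst2 2 (Plus (Var 1) One) (Plus (Var 0) (Var 0)) E))))"
    using assms by (auto simp: exp_graph_def intro!: val)
  show ?thesis
  proof (induction x)
    case 0
    show ?case using A by (simp add: N.valid_def sat_inst2)
  next
    case (Suc x)
    have "natsat (y ## x ## e) (inst2 2 (Var 1) (Var 0) E) \<Longrightarrow>
        natsat (y ## x ## e) (inst2 2 (Plus (Var 1) One) (Plus (Var 0) (Var 0)) E)" for x y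
      using B by (simp only: N.valid_All) (simp add: N.valid_def)
    from this[of "2 ^ x" x] Suc show ?case
      by (simp add: sat_inst2 mult_2)
  qed
qed

section \<open>Definability over the natural numbers\<close>

lemma tsubst_up_lift: "tsubst (up \<sigma>) (lift_tm t) = lift_tm (tsubst \<sigma> t)"
  by (induction t) (auto simp: lift_tm_def up_def)

lemma Delta0_fsubst: "Delta0 p \<Longrightarrow> Delta0 (fsubst \<sigma> p)"
  by (induction arbitrary: \<sigma> rule: Delta0.induct)
    (auto simp: tsubst_up_lift up_def intro: Delta0.intros)

lemma Sig_Pi_fsubst:
  "(Sig n p \<longrightarrow> (\<forall>\<sigma>. Sig n (fsubst \<sigma> p))) \<and> (Pi n q \<longrightarrow> (\<forall>\<sigma>. Pi n (fsubst \<sigma> q)))"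
  by (induction rule: Sig_Pi.induct) (auto intro: Sig_Pi.intros Delta0_fsubst)

text \<open>Definability is a property of predicates on assignments here, so closure is proved by
  applying rules and formulas are hardly ever written out.\<close>

definition tf :: "((nat \<Rightarrow> nat) \<Rightarrow> nat) \<Rightarrow> bool" where
  "tf f \<longleftrightarrow> (\<exists>t. \<forall>e. tval e t = f e)"

definition D0 :: "((nat \<Rightarrow> nat) \<Rightarrow> bool) \<Rightarrow> bool" where
  "D0 P \<longleftrightarrow> (\<exists>p. Delta0 p \<and> (\<forall>e. natsat e p = P e))"

definition SG :: "nat \<Rightarrow> ((nat \<Rightarrow> nat) \<Rightarrow> bool) \<Rightarrow> bool" where
  "SG n P \<longleftrightarrow> (\<exists>p. Sig n p \<and> (\<forall>e. natsat e p = P e))"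

definition PI :: "nat \<Rightarrow> ((nat \<Rightarrow> nat) \<Rightarrow> bool) \<Rightarrow> bool" where
  "PI n P \<longleftrightarrow> (\<exists>p. Pi n p \<and> (\<forall>e. natsat e p = P e))"

lemma tf_var: "tf (\<lambda>e. e k)"
  unfolding tf_def by (rule exI[of _ "Var k"]) simp

lemma tf_add: "tf f \<Longrightarrow> tf g \<Longrightarrow> tf (\<lambda>e. f e + g e)"
  unfolding tf_def by (elim exE, rule_tac x = "Plus t ta" in exI) simp

lemma tf_mult: "tf f \<Longrightarrow> tf g \<Longrightarrow> tf (\<lambda>e. f e * g e)"
  unfolding tf_def by (elim exE, rule_tac x = "Times t ta" in exI) simp

lemma tf_Suc: "tf f \<Longrightarrow> tf (\<lambda>e. Suc (f e))"
  unfolding tf_def by (elim exE, rule_tac x = "Plus t One" in exI) simp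

lemma tf_const: "tf (\<lambda>e. c)"
proof (induction c)
  case 0
  show ?case unfolding tf_def by (rule exI[of _ Zero]) simp
qed (rule tf_Suc)

lemmas tf_rules = tf_var tf_add tf_mult tf_Suc tf_const

lemma D0_subst: "D0 P \<Longrightarrow> D0 (\<lambda>e. P (\<lambda>i. tval e (\<sigma> i)))"
  unfolding D0_def by (metis Delta0_fsubst sat_fsubst)

lemma D0_ren: "D0 P \<Longrightarrow> D0 (\<lambda>e. P (\<lambda>i. e (\<rho> i)))"
  using D0_subst[of P "\<lambda>i. Var (\<rho> i)"] by simp

lemma SG_ren: "SG n P \<Longrightarrow> SG n (\<lambda>e. P (\<lambda>i. e (\<rho> i)))"
  unfolding SG_def
  by (elim exE conjE, rule_tac x = "fsubst (\<lambda>i. Var (\<rho> i)) p" in exI)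
    (simp add: sat_fsubst Sig_Pi_fsubst)

lemma PI_ren: "PI n P \<Longrightarrow> PI n (\<lambda>e. P (\<lambda>i. e (\<rho> i)))"
  unfolding PI_def
  by (elim exE conjE, rule_tac x = "fsubst (\<lambda>i. Var (\<rho> i)) p" in exI)
    (simp add: sat_fsubst Sig_Pi_fsubst)

lemma tf_eq: "tf f \<Longrightarrow> tf g \<Longrightarrow> D0 (\<lambda>e. f e = g e)"
  unfolding tf_def D0_def by (elim exE, rule_tac x = "Eq t ta" in exI) (simp add: Delta0.intros)

lemma tf_less: "tf f \<Longrightarrow> tf g \<Longrightarrow> D0 (\<lambda>e. f e < g e)"
  unfolding tf_def D0_def by (elim exE, rule_tac x = "Lt t ta" in exI) (simp add: Delta0.intros)

lemma D0_not: "D0 P \<Longrightarrow> D0 (\<lambda>e. \<not> P e)"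
  unfolding D0_def by (elim exE, rule_tac x = "Neg p" in exI) (simp add: Delta0.intros)

lemma D0_conj: "D0 P \<Longrightarrow> D0 Q \<Longrightarrow> D0 (\<lambda>e. P e \<and> Q e)"
  unfolding D0_def by (elim exE, rule_tac x = "Conj p pa" in exI) (simp add: Delta0.intros)

lemma D0_disj: "D0 P \<Longrightarrow> D0 Q \<Longrightarrow> D0 (\<lambda>e. P e \<or> Q e)"
  unfolding D0_def by (elim exE, rule_tac x = "Disj p pa" in exI) (simp add: Delta0.intros)

lemma tf_bex:
  assumes "tf b" "D0 (\<lambda>e. Q (e 0) (\<lambda>i. e (Suc i)))"
  shows "D0 (\<lambda>e. \<exists>u<b e. Q u e)"
proof -
  obtain t p where "\<forall>e. tval e t = b e" "Delta0 p" "\<forall>e. natsat e p = Q (e 0) (\<lambda>i. e (Suc i))"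
    using assms by (auto simp: tf_def D0_def)
  then show ?thesis unfolding D0_def
    by (intro exI[of _ "Ex (Conj (Lt (Var 0) (lift_tm t)) p)"]) (auto intro: Delta0.intros)
qed

text \<open>The term bound allows such a function to be substituted into a Delta_0 predicate by
  means of a bounded quantifier; a Delta_0 graph alone would not permit this.\<close>

definition df :: "((nat \<Rightarrow> nat) \<Rightarrow> nat) \<Rightarrow> bool" where
  "df f \<longleftrightarrow> (\<exists>b. tf b \<and> (\<forall>e. f e \<le> b e)) \<and> D0 (\<lambda>e. e 0 = f (\<lambda>i. e (Suc i)))"

lemma tf_shift: "tf f \<Longrightarrow> tf (\<lambda>e. f (\<lambda>i. e (Suc i)))"
  unfolding tf_def by (elim exE, rule_tac x = "lift_tm t" in exI) (simp add: lift_tm_def tval_tsubst)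

lemma tf_df: "tf f \<Longrightarrow> df f"
  unfolding df_def by (auto intro: tf_eq tf_var tf_shift)

lemma df_subst:
  assumes "D0 (\<lambda>e. Q (e 0) (\<lambda>i. e (Suc i)))" "df f"
  shows "D0 (\<lambda>e. Q (f e) e)"
proof -
  obtain b where b: "tf b" "\<forall>e. f e \<le> b e" and g: "D0 (\<lambda>e. e 0 = f (\<lambda>i. e (Suc i)))"
    using assms(2) by (auto simp: df_def)
  have "D0 (\<lambda>e. \<exists>u<Suc (b e). u = f e \<and> Q u e)"
    by (intro tf_bex tf_Suc b D0_conj g assms(1))
  moreover have "(\<exists>u<Suc (b e). u = f e \<and> Q u e) = Q (f e) e" for e
    using b(2) by (auto simp: le_imp_less_Suc)
  ultimately show ?thesis by simp
qed

lemma df_shift: "df f \<Longrightarrow> df (\<lambda>e. f (\<lambda>i. e (Suc i)))"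
proof -
  assume f: "df f"
  then obtain b where b: "tf b" "\<forall>e. f e \<le> b e" and g: "D0 (\<lambda>e. e 0 = f (\<lambda>i. e (Suc i)))"
    by (auto simp: df_def)
  have "D0 (\<lambda>e. e 0 = f (\<lambda>i. e (Suc (Suc i))))"
    using D0_ren[OF g, of "\<lambda>i. if i = 0 then 0 else Suc i"] by simp
  then show ?thesis
    unfolding df_def using tf_shift[OF b(1)] b(2) by blast
qed

lemma D0_eq: assumes "df f" "df g" shows "D0 (\<lambda>e. f e = g e)"
  by (rule df_subst[OF df_subst[OF _ df_shift]]) (rule tf_eq tf_rules assms)+

lemma D0_less: assumes "df f" "df g" shows "D0 (\<lambda>e. f e < g e)"
  by (rule df_subst[OF df_subst[OF _ df_shift]]) (rule tf_less tf_rules assms)+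

lemma D0_le: assumes "df f" "df g" shows "D0 (\<lambda>e. f e \<le> g e)"
  using D0_not[OF D0_less[OF assms(2,1)]] by (simp add: not_less)

lemma D0_bex:
  assumes "df b" "D0 (\<lambda>e. Q (e 0) (\<lambda>i. e (Suc i)))"
  shows "D0 (\<lambda>e. \<exists>u<b e. Q u e)"
proof -
  have "D0 (\<lambda>e. \<exists>u<e 0. Q u (\<lambda>i. e (Suc i)))"
    using D0_ren[OF assms(2), of "\<lambda>i. if i = 0 then 0 else Suc i"]
    by (intro tf_bex tf_rules) simp
  then show ?thesis
    by (rule df_subst[where Q = "\<lambda>u e. \<exists>v<u. Q v e", OF _ assms(1)])
qed

lemma D0_ball:
  assumes "df b" "D0 (\<lambda>e. Q (e 0) (\<lambda>i. e (Suc i)))"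
  shows "D0 (\<lambda>e. \<forall>u<b e. Q u e)"
  using D0_not[OF D0_bex[OF assms(1) D0_not[OF assms(2)]]] by simp

lemma D0_const: "D0 (\<lambda>e. c)"
  by (cases c) (use D0_eq[OF tf_df[OF tf_const[of 0]] tf_df[OF tf_const[of 0]]]
      D0_eq[OF tf_df[OF tf_const[of 0]] tf_df[OF tf_const[of 1]]] in simp_all)

lemma df_var: "df (\<lambda>e. e k)" and df_const: "df (\<lambda>e. c)"
  by (simp_all add: tf_df tf_rules)

lemma dfI:
  assumes "tf b" "\<And>e. f e \<le> b e" "D0 (\<lambda>e. e 0 = f (\<lambda>i. e (Suc i)))"
  shows "df f"
  using assms by (auto simp: df_def)

lemma df_add:
  assumes "df f" "df g" shows "df (\<lambda>e. f e + g e)"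
proof -
  obtain b c where "tf b" "\<forall>e. f e \<le> b e" "tf c" "\<forall>e. g e \<le> c e"
    using assms by (auto simp: df_def)
  moreover have "D0 (\<lambda>e. e 0 = f (\<lambda>i. e (Suc i)) + g (\<lambda>i. e (Suc i)))"
    by (rule df_subst[OF df_subst[OF _ df_shift[OF df_shift]] df_shift])
      (rule tf_eq tf_rules assms)+
  ultimately show ?thesis
    by (intro dfI[of "\<lambda>e. b e + c e"] tf_rules) (auto intro: add_mono)
qed

lemma df_mult:
  assumes "df f" "df g" shows "df (\<lambda>e. f e * g e)"
proof -
  obtain b c where "tf b" "\<forall>e. f e \<le> b e" "tf c" "\<forall>e. g e \<le> c e"
    using assms by (auto simp: df_def)
  moreover have "D0 (\<lambda>e. e 0 = f (\<lambda>i. e (Suc i)) * g (\<lambda>i. e (Suc i)))"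
    by (rule df_subst[OF df_subst[OF _ df_shift[OF df_shift]] df_shift])
      (rule tf_eq tf_rules assms)+
  ultimately show ?thesis
    by (intro dfI[of "\<lambda>e. b e * c e"] tf_rules) (auto intro: mult_mono)
qed

lemma df_Suc: "df f \<Longrightarrow> df (\<lambda>e. Suc (f e))"
  using df_add[OF _ df_const[of 1]] by simp

section \<open>Cantor pairing and Goedel's beta function\<close>

definition pp :: "nat \<Rightarrow> nat \<Rightarrow> nat" where
  "pp x y = prod_encode (x, y)"

definition pf :: "nat \<Rightarrow> nat" where
  "pf z = fst (prod_decode z)"

definition ps :: "nat \<Rightarrow> nat" where
  "ps z = snd (prod_decode z)"

lemma pair_simps [simp]: "pf (pp x y) = x" "ps (pp x y) = y" "pp (pf z) (ps z) = z"
  "pp x y = pp x' y' \<longleftrightarrow> x = x' \<and> y = y'"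
  by (simp_all add: pp_def pf_def ps_def)

lemma le_pp: "x \<le> pp x y" "y \<le> pp x y"
  by (simp_all add: pp_def le_prod_encode_1 le_prod_encode_2)

lemma pf_le: "pf z \<le> z" and ps_le: "ps z \<le> z"
  using le_pp(1)[of "pf z" "ps z"] le_pp(2)[of "ps z" "pf z"] by simp_all

text \<open>Doubling removes the division in the triangular number and leaves a polynomial equation,
  hence a Delta_0 graph.\<close>

lemma pp_eq: "z = pp x y \<longleftrightarrow> 2 * z = (x + y) * Suc (x + y) + 2 * x"
proof -
  have "2 * triangle n = n * Suc n" for n
    by (induction n) simp_all
  then have "2 * pp x y = (x + y) * Suc (x + y) + 2 * x"
    by (simp add: pp_def prod_encode_def)
  then show ?thesis by (metis mult_left_cancel zero_neq_numeral)
qed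

lemma pp_less: "x + y < n \<Longrightarrow> pp x y < 2 * n * n"
proof -
  assume "x + y < n"
  then have "(x + y) * Suc (x + y) \<le> n * n" "x < n"
    using mult_le_mono[of "x + y" n "Suc (x + y)" n] by auto
  moreover have "2 * n \<le> 2 * (n * n)" by (cases n) auto
  ultimately have "(x + y) * Suc (x + y) + 2 * x < n * n + 2 * (n * n)"
    by linarith
  moreover have "2 * pp x y = (x + y) * Suc (x + y) + 2 * x"
    using pp_eq by blast
  ultimately show ?thesis by (simp add: mult.assoc)
qed

lemma df_pp:
  assumes "df f" "df g" shows "df (\<lambda>e. pp (f e) (g e))"
proof -
  obtain b c where bc: "tf b" "\<forall>e. f e \<le> b e" "tf c" "\<forall>e. g e \<le> c e"
    using assms by (auto simp: df_def)
  have "pp (f e) (g e) \<le> 2 * Suc (b e + c e) * Suc (b e + c e)" for e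
    using bc by (intro less_imp_le pp_less) (auto simp: less_Suc_eq_le intro: add_mono)
  moreover have "D0 (\<lambda>e. e 0 = pp (f (\<lambda>i. e (Suc i))) (g (\<lambda>i. e (Suc i))))"
    unfolding pp_eq by (intro D0_eq df_add df_mult df_Suc df_var df_const assms[THEN df_shift] assms[THEN df_shift, THEN df_shift])
  ultimately show ?thesis
    by (intro dfI[of "\<lambda>e. 2 * Suc (b e + c e) * Suc (b e + c e)"] tf_rules bc) auto
qed

lemma df_pf:
  assumes "df f" shows "df (\<lambda>e. pf (f e))"
proof -
  obtain b where b: "tf b" "\<forall>e. f e \<le> b e"
    using assms by (auto simp: df_def)
  have eq: "x = pf z \<longleftrightarrow> (\<exists>y<Suc z. z = pp x y)" for x z
    using ps_le[of z] by (metis less_Suc_eq_le pair_simps(1,3))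
  have "D0 (\<lambda>e. e 0 = pf (f (\<lambda>i. e (Suc i))))"
    unfolding eq by (intro D0_bex D0_eq df_Suc df_pp df_var assms[THEN df_shift] assms[THEN df_shift, THEN df_shift])
  moreover have "pf (f e) \<le> b e" for e
    using b(2) pf_le le_trans by blast
  ultimately show ?thesis by (rule dfI[OF b(1), rotated])
qed

lemma df_ps:
  assumes "df f" shows "df (\<lambda>e. ps (f e))"
proof -
  obtain b where b: "tf b" "\<forall>e. f e \<le> b e"
    using assms by (auto simp: df_def)
  have eq: "y = ps z \<longleftrightarrow> (\<exists>x<Suc z. z = pp x y)" for y z
    using pf_le[of z] by (metis less_Suc_eq_le pair_simps(2,3))
  have "D0 (\<lambda>e. e 0 = ps (f (\<lambda>i. e (Suc i))))"
    unfolding eq by (intro D0_bex D0_eq df_Suc df_pp df_var assms[THEN df_shift] assms[THEN df_shift, THEN df_shift])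
  moreover have "ps (f e) \<le> b e" for e
    using b(2) ps_le le_trans by blast
  ultimately show ?thesis by (rule dfI[OF b(1), rotated])
qed

definition beta :: "nat \<Rightarrow> nat \<Rightarrow> nat" where
  "beta s i = pf s mod Suc (Suc i * ps s)"

lemma beta_le: "beta s i \<le> s"
  unfolding beta_def using pf_le mod_less_eq_dividend le_trans by blast

lemma df_beta:
  assumes "df f" "df g" shows "df (\<lambda>e. beta (f e) (g e))"
proof -
  obtain b where b: "tf b" "\<forall>e. f e \<le> b e"
    using assms by (auto simp: df_def)
  have mod: "v = a mod Suc c \<longleftrightarrow> (\<exists>q<Suc a. a = q * Suc c + v) \<and> v < Suc c" for v a c :: nat
  proof
    assume "v = a mod Suc c"
    moreover have "a = a div Suc c * Suc c + a mod Suc c"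
      by (simp only: div_mult_mod_eq)
    moreover have "a div Suc c < Suc a"
      by (simp only: div_le_dividend less_Suc_eq_le)
    ultimately show "(\<exists>q<Suc a. a = q * Suc c + v) \<and> v < Suc c"
      by (metis mod_less_divisor zero_less_Suc)
  next
    assume "(\<exists>q<Suc a. a = q * Suc c + v) \<and> v < Suc c"
    then show "v = a mod Suc c"
      by (metis mod_less mod_mult_self3)
  qed
  have "D0 (\<lambda>e. e 0 = beta (f (\<lambda>i. e (Suc i))) (g (\<lambda>i. e (Suc i))))"
    unfolding beta_def mod
    by (intro D0_bex D0_conj D0_less D0_eq df_Suc df_add df_mult df_pf df_ps df_var assms[THEN df_shift] assms[THEN df_shift, THEN df_shift])
  moreover have "beta (f e) (g e) \<le> b e" for e
    using b(2) beta_le le_trans by blast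
  ultimately show ?thesis by (rule dfI[OF b(1), rotated])
qed

lemmas df_rules = df_var df_const df_add df_mult df_Suc df_pp df_pf df_ps df_beta

text \<open>Goedel's argument: a common divisor of two moduli divides j - i, hence the factorial
  \<open>c\<close>, hence 1. The Chinese remainder theorem applies, and \<open>c\<close> also
  exceeds or equals every \<open>f i\<close>, so the residues are the values themselves.\<close>

lemma beta_exists: "\<exists>s. \<forall>i<n. beta s i = f i"
proof -
  define c :: nat where "c = fact (Suc n + Max (f ` {..n}))"
  have f_le: "f i \<le> c" if "i < n" for i
  proof -
    have "f i \<le> Max (f ` {..n})" using that by auto
    also have "\<dots> \<le> Suc n + Max (f ` {..n})" by (rule le_add2)
    also have "\<dots> \<le> c" unfolding c_def by (rule fact_ge_self)
    finally show ?thesis .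
  qed
  have dvd: "k dvd c" if "0 < k" "k \<le> n" for k
    unfolding c_def using that by (intro dvd_fact) auto
  have "\<exists>x. \<forall>i\<in>{..<n}. [x = f i] (mod Suc (Suc i * c))"
  proof (rule chinese_remainder_nat)
    have *: "coprime (Suc (Suc i * c)) (Suc (Suc j * c))" if "i < j" "j < n" for i j
    proof (rule coprimeI)
      fix p assume p: "p dvd Suc (Suc i * c)" "p dvd Suc (Suc j * c)"
      have "p dvd Suc j * Suc (Suc i * c) - Suc i * Suc (Suc j * c)"
        by (intro dvd_diff_nat dvd_mult p)
      also have "Suc j * Suc (Suc i * c) - Suc i * Suc (Suc j * c) = j - i"
        using that by (simp add: algebra_simps)
      finally have "p dvd j - i" .
      moreover have "j - i dvd c" using that by (intro dvd) auto
      ultimately have "p dvd Suc i * c" by (meson dvd_mult dvd_trans)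
      with p(1) show "is_unit p"
        by (metis Suc_eq_plus1 dvd_add_right_iff)
    qed
    then show "\<forall>i\<in>{..<n}. \<forall>j\<in>{..<n}. i \<noteq> j \<longrightarrow>
        coprime (Suc (Suc i * c)) (Suc (Suc j * c))"
      by (metis coprime_commute lessThan_iff nat_neq_iff)
  qed simp
  then obtain x where x: "[x = f i] (mod Suc (Suc i * c))" if "i < n" for i
    by auto
  have "beta (pp x c) i = f i" if "i < n" for i
    using x[OF that] f_le[OF that] by (simp add: beta_def cong_def)
  then show ?thesis by blast
qed

subsection \<open>The arithmetical hierarchy\<close>

lemma SG_0: "SG 0 P \<longleftrightarrow> D0 P" and PI_0: "PI 0 P \<longleftrightarrow> D0 P"
  by (auto simp: SG_def PI_def D0_def intro: Sig_Pi.intros elim: Sig.cases Pi.cases)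

lemma PI_SG: "PI n P \<Longrightarrow> SG (Suc n) P" and SG_PI: "SG n P \<Longrightarrow> PI (Suc n) P"
  unfolding SG_def PI_def by (blast intro: Sig_Pi.intros)+

lemma SG_ex:
  "SG (Suc n) (\<lambda>e. Q (e 0) (\<lambda>i. e (Suc i))) \<Longrightarrow> SG (Suc n) (\<lambda>e. \<exists>u. Q u e)"
  unfolding SG_def
  by (elim exE conjE, rule_tac x = "Ex p" in exI) (auto intro: Sig_Pi.intros)

lemma PI_all:
  "PI (Suc n) (\<lambda>e. Q (e 0) (\<lambda>i. e (Suc i))) \<Longrightarrow> PI (Suc n) (\<lambda>e. \<forall>u. Q u e)"
  unfolding PI_def
  by (elim exE conjE, rule_tac x = "All p" in exI) (auto intro: Sig_Pi.intros)

lemma Sig_Suc_induct [consumes 1, case_names base ex]: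
  assumes "Sig (Suc n) p" "\<And>p. Pi n p \<Longrightarrow> Q p" "\<And>p. Sig (Suc n) p \<Longrightarrow> Q p \<Longrightarrow> Q (Ex p)"
  shows "Q p"
proof -
  have "(Sig m p \<longrightarrow> m = Suc n \<longrightarrow> Q p) \<and> (Pi k q \<longrightarrow> True)" for m k q
    by (induction rule: Sig_Pi.induct) (use assms(2,3) in auto)
  with assms(1) show ?thesis by blast
qed

lemma Pi_Suc_induct [consumes 1, case_names base all]:
  assumes "Pi (Suc n) p" "\<And>p. Sig n p \<Longrightarrow> Q p" "\<And>p. Pi (Suc n) p \<Longrightarrow> Q p \<Longrightarrow> Q (All p)"
  shows "Q p"
proof -
  have "(Sig k q \<longrightarrow> True) \<and> (Pi m p \<longrightarrow> m = Suc n \<longrightarrow> Q p)" for m k q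
    by (induction rule: Sig_Pi.induct) (use assms(2,3) in auto)
  with assms(1) show ?thesis by blast
qed

lemma SG_Suc_induct [consumes 1, case_names base ex]:
  assumes "SG (Suc n) P" "\<And>P. PI n P \<Longrightarrow> R P"
    "\<And>P. SG (Suc n) P \<Longrightarrow> R P \<Longrightarrow> R (\<lambda>e. \<exists>u. P (u ## e))"
  shows "R P"
proof -
  obtain p where p: "Sig (Suc n) p" and P: "P = (\<lambda>e. natsat e p)"
    using assms(1) by (auto simp: SG_def)
  from p have "R (\<lambda>e. natsat e p)"
  proof (induction rule: Sig_Suc_induct)
    case (base p)
    then show ?case by (intro assms(2)) (auto simp: PI_def)
  next
    case (ex p)
    then have "R (\<lambda>e. \<exists>u. natsat (u ## e) p)"
      by (intro assms(3)) (auto simp: SG_def)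
    then show ?case by simp
  qed
  with P show ?thesis by simp
qed

lemma PI_Suc_induct [consumes 1, case_names base all]:
  assumes "PI (Suc n) P" "\<And>P. SG n P \<Longrightarrow> R P"
    "\<And>P. PI (Suc n) P \<Longrightarrow> R P \<Longrightarrow> R (\<lambda>e. \<forall>u. P (u ## e))"
  shows "R P"
proof -
  obtain p where p: "Pi (Suc n) p" and P: "P = (\<lambda>e. natsat e p)"
    using assms(1) by (auto simp: PI_def)
  from p have "R (\<lambda>e. natsat e p)"
  proof (induction rule: Pi_Suc_induct)
    case (base p)
    then show ?case by (intro assms(2)) (auto simp: SG_def)
  next
    case (all p)
    then have "R (\<lambda>e. \<forall>u. natsat (u ## e) p)"
      by (intro assms(3)) (auto simp: PI_def)
    then show ?case by simp
  qed
  with P show ?thesis by simp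
qed

lemma SG_ex_push: "SG (Suc n) P \<Longrightarrow> SG (Suc n) (\<lambda>e. \<exists>u. P (u ## e))"
  by (rule SG_ex) (simp add: push_eta)

lemma PI_all_push: "PI (Suc n) P \<Longrightarrow> PI (Suc n) (\<lambda>e. \<forall>u. P (u ## e))"
  by (rule PI_all) (simp add: push_eta)

lemma SG_shift: "SG n P \<Longrightarrow> SG n (\<lambda>e. P (\<lambda>i. e (Suc i)))"
  and PI_shift: "PI n P \<Longrightarrow> PI n (\<lambda>e. P (\<lambda>i. e (Suc i)))"
  by (rule SG_ren PI_ren, assumption)+

text \<open>Leading quantifiers are pulled out of the left argument, then out of the right one,
  until two kernels of the dual class at the previous level remain. Both connectives commute with
  both quantifiers over a nonempty domain, hence the common treatment through
  \<open>op\<close>.\<close>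

lemma SG_PI_junction:
  assumes op: "op = (\<and>) \<or> op = (\<or>)"
  shows "(SG n P \<longrightarrow> SG n Q \<longrightarrow> SG n (\<lambda>e. op (P e) (Q e))) \<and>
    (PI n P \<longrightarrow> PI n Q \<longrightarrow> PI n (\<lambda>e. op (P e) (Q e)))"
proof (induction n arbitrary: P Q)
  case 0
  then show ?case using op by (auto simp: SG_0 PI_0 D0_conj D0_disj)
next
  case (Suc n)
  have pull: "op (\<exists>u. A u) b = (\<exists>u. op (A u) b)" "op b (\<exists>u. A u) = (\<exists>u. op b (A u))"
    "op (\<forall>u. A u) b = (\<forall>u. op (A u) b)" "op b (\<forall>u. A u) = (\<forall>u. op b (A u))"
    for A :: "nat \<Rightarrow> bool" and b
    using op by auto
  have "SG (Suc n) (\<lambda>e. op (P e) (Q e))" if "SG (Suc n) P" "SG (Suc n) Q"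
    using that
  proof (induction arbitrary: Q rule: SG_Suc_induct)
    case (base P)
    from base(2,1) show ?case
    proof (induction arbitrary: P rule: SG_Suc_induct)
      case (base Q)
      then show ?case using Suc.IH by (auto intro: PI_SG)
    next
      case (ex Q)
      from ex(2)[OF PI_shift[OF ex(3)]] show ?case
        unfolding pull by (auto dest: SG_ex_push)
    qed
  next
    case (ex P)
    from ex(2)[OF SG_shift[OF ex(3)]] show ?case
      unfolding pull by (auto dest: SG_ex_push)
  qed
  moreover have "PI (Suc n) (\<lambda>e. op (P e) (Q e))" if "PI (Suc n) P" "PI (Suc n) Q"
    using that
  proof (induction arbitrary: Q rule: PI_Suc_induct)
    case (base P)
    from base(2,1) show ?case
    proof (induction arbitrary: P rule: PI_Suc_induct)
      case (base Q)
      then show ?case using Suc.IH by (auto intro: SG_PI)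
    next
      case (all Q)
      from all(2)[OF SG_shift[OF all(3)]] show ?case
        unfolding pull by (auto dest: PI_all_push)
    qed
  next
    case (all P)
    from all(2)[OF PI_shift[OF all(3)]] show ?case
      unfolding pull by (auto dest: PI_all_push)
  qed
  ultimately show ?case by blast
qed

lemma SG_conj: "SG n P \<Longrightarrow> SG n Q \<Longrightarrow> SG n (\<lambda>e. P e \<and> Q e)"
  and PI_conj: "PI n P \<Longrightarrow> PI n Q \<Longrightarrow> PI n (\<lambda>e. P e \<and> Q e)"
  and SG_disj: "SG n P \<Longrightarrow> SG n Q \<Longrightarrow> SG n (\<lambda>e. P e \<or> Q e)"
  and PI_disj: "PI n P \<Longrightarrow> PI n Q \<Longrightarrow> PI n (\<lambda>e. P e \<or> Q e)"
  using SG_PI_junction[of "(\<and>)" n P Q] SG_PI_junction[of "(\<or>)" n P Q] by auto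

lemma SG_PI_not: "(SG n P \<longrightarrow> PI n (\<lambda>e. \<not> P e)) \<and> (PI n P \<longrightarrow> SG n (\<lambda>e. \<not> P e))"
proof (induction n arbitrary: P)
  case 0
  then show ?case by (auto simp: SG_0 PI_0 D0_not)
next
  case (Suc n)
  have "PI (Suc n) (\<lambda>e. \<not> P e)" if "SG (Suc n) P"
    using that by (induction rule: SG_Suc_induct) (use Suc.IH in \<open>auto intro: SG_PI dest: PI_all_push\<close>)
  moreover have "SG (Suc n) (\<lambda>e. \<not> P e)" if "PI (Suc n) P"
    using that by (induction rule: PI_Suc_induct) (use Suc.IH in \<open>auto intro: PI_SG dest: SG_ex_push\<close>)
  ultimately show ?case by blast
qed

lemma SG_not: "PI n P \<Longrightarrow> SG n (\<lambda>e. \<not> P e)" and PI_not: "SG n P \<Longrightarrow> PI n (\<lambda>e. \<not> P e)"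
  using SG_PI_not by auto

lemma SG_PI_Suc: "(SG n P \<longrightarrow> SG (Suc n) P) \<and> (PI n P \<longrightarrow> PI (Suc n) P)"
proof (induction n arbitrary: P)
  case 0
  then show ?case by (metis PI_0 PI_SG SG_0 SG_PI)
next
  case (Suc n)
  have "SG (Suc (Suc n)) P" if "SG (Suc n) P"
    using that by (induction rule: SG_Suc_induct) (use Suc.IH in \<open>auto intro: PI_SG SG_ex_push\<close>)
  moreover have "PI (Suc (Suc n)) P" if "PI (Suc n) P"
    using that by (induction rule: PI_Suc_induct) (use Suc.IH in \<open>auto intro: SG_PI PI_all_push\<close>)
  ultimately show ?case by blast
qed

lemma SG_mono: "SG m P \<Longrightarrow> m \<le> n \<Longrightarrow> SG n P" and PI_mono: "PI m P \<Longrightarrow> m \<le> n \<Longrightarrow> PI n P"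
proof -
  have "(SG m P \<longrightarrow> SG n P) \<and> (PI m P \<longrightarrow> PI n P)" if "m \<le> n"
    using that by (induction rule: dec_induct) (use SG_PI_Suc in blast)+
  then show "SG m P \<Longrightarrow> m \<le> n \<Longrightarrow> SG n P" "PI m P \<Longrightarrow> m \<le> n \<Longrightarrow> PI n P"
    by blast+
qed

lemma D0_SG: "D0 P \<Longrightarrow> SG n P" and D0_PI: "D0 P \<Longrightarrow> PI n P"
  using SG_mono[of 0 P n] PI_mono[of 0 P n] by (simp_all add: SG_0 PI_0)

text \<open>The bounded quantifier joins the leading universal block, or stays inside Delta_0 at
  level 0; no collection principle is involved.\<close>

lemma PI_ball:
  assumes "df b" "PI n (\<lambda>e. Q (e 0) (\<lambda>i. e (Suc i)))"
  shows "PI n (\<lambda>e. \<forall>u<b e. Q u e)"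
proof (cases n)
  case 0
  then show ?thesis using assms by (simp add: PI_0 D0_ball)
next
  case (Suc m)
  have "PI n (\<lambda>e. \<not> e 0 < b (\<lambda>i. e (Suc i)))"
    using D0_less[OF df_var[of 0] df_shift[OF assms(1)]] by (rule D0_PI[OF D0_not])
  then have "PI (Suc m) (\<lambda>e. \<not> e 0 < b (\<lambda>i. e (Suc i)) \<or> Q (e 0) (\<lambda>i. e (Suc i)))"
    using PI_disj[OF _ assms(2)] Suc by blast
  then have "PI n (\<lambda>e. \<forall>u. \<not> u < b e \<or> Q u e)"
    unfolding Suc by (rule PI_all)
  then show ?thesis by (simp only: imp_conv_disj)
qed

lemma SG1_normal_form:
  assumes "SG 1 P"
  obtains Q where "D0 Q" "\<And>e. P e \<longleftrightarrow> (\<exists>w. Q (w ## e))"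
proof -
  have "SG (Suc 0) P" using assms by simp
  then have "\<exists>Q. D0 Q \<and> (\<forall>e. P e \<longleftrightarrow> (\<exists>w. Q (w ## e)))"
  proof (induction rule: SG_Suc_induct)
    case (base P)
    then show ?case
      by (intro exI[of _ "\<lambda>e. P (\<lambda>i. e (Suc i))"]) (simp add: PI_0 D0_ren)
  next
    case (ex P)
    then obtain Q where Q: "D0 Q" "\<forall>e. P e \<longleftrightarrow> (\<exists>w. Q (w ## e))" by blast
    \<comment> \<open>The new witness is a common strict bound for the quantified variable and the
      old witness.\<close>
    define Q' where "Q' e = (\<exists>u<e 0. \<exists>w<e 0. Q (w ## u ## (\<lambda>i. e (Suc i))))" for e
    have *: "(\<lambda>i. e (if i < 2 then i else Suc i)) = e 0 ## e 1 ## (\<lambda>i. e (Suc (Suc (Suc i))))"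
      for e :: "nat \<Rightarrow> nat"
      by (rule ext, rename_tac i, case_tac i, simp, rename_tac k, case_tac k, simp_all)
    have "D0 Q'"
      unfolding Q'_def
      using D0_ren[OF Q(1), of "\<lambda>i. if i < 2 then i else Suc i"]
      by (intro D0_bex df_var) (simp add: *)
    moreover have "(\<exists>u. P (u ## e)) \<longleftrightarrow> (\<exists>w. Q' (w ## e))" for e
    proof
      assume "\<exists>u. P (u ## e)"
      then obtain u w where "Q (w ## u ## e)" using Q(2) by blast
      then have "Q' (Suc (u + w) ## e)"
        unfolding Q'_def by (intro exI[of _ u] conjI exI[of _ w]) simp_all
      then show "\<exists>w. Q' (w ## e)" ..
    qed (auto simp: Q'_def Q(2))
    ultimately show ?case by blast
  qed
  with that show ?thesis by blast
qed

text \<open>Collection in the natural numbers: the witnesses for the finitely many \<open>u\<close>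
  have a common bound \<open>W\<close>, which can be quantified in front.\<close>

lemma SG1_ball_tf:
  assumes "df b" "SG 1 (\<lambda>e. Q (e 0) (\<lambda>i. e (Suc i)))"
  shows "SG 1 (\<lambda>e. \<forall>u<b e. Q u e)"
proof -
  obtain R where R: "D0 R" "\<And>e. Q (e 0) (\<lambda>i. e (Suc i)) \<longleftrightarrow> (\<exists>w. R (w ## e))"
    using SG1_normal_form[OF assms(2)] by blast
  have *: "(\<lambda>i. e (if i < 2 then i else Suc i)) = e 0 ## e 1 ## (\<lambda>i. e (Suc (Suc (Suc i))))"
    for e :: "nat \<Rightarrow> nat"
    by (rule ext, rename_tac i, case_tac i, simp, rename_tac k, case_tac k, simp_all)
  have "D0 (\<lambda>e. \<forall>u<b (\<lambda>i. e (Suc i)). \<exists>w<e 0. R (w ## u ## (\<lambda>i. e (Suc i))))"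
    using D0_ren[OF R(1), of "\<lambda>i. if i < 2 then i else Suc i"]
    by (intro D0_ball D0_bex df_shift[OF assms(1)] df_var) (simp add: *)
  then have "SG (Suc 0) (\<lambda>e. \<exists>W. \<forall>u<b e. \<exists>w<W. R (w ## u ## e))"
    by (intro SG_ex D0_SG) simp
  moreover have "(\<exists>W. \<forall>u<k. \<exists>w<W. R (w ## u ## e)) \<longleftrightarrow> (\<forall>u<k. Q u e)" for e k
  proof
    assume "\<forall>u<k. Q u e"
    then have "\<forall>u<k. \<exists>w. R (w ## u ## e)"
      using R(2)[of "_ ## e"] by simp
    then obtain f where f: "\<forall>u<k. R (f u ## u ## e)" by metis
    have "f u < Suc (\<Sum>i<k. f i)" if "u < k" for u
      using that by (simp add: less_Suc_eq_le member_le_sum)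
    then show "\<exists>W. \<forall>u<k. \<exists>w<W. R (w ## u ## e)" using f by blast
  qed (use R(2)[of "_ ## e"] in auto)
  ultimately show ?thesis by simp
qed

subsection \<open>Computable functions and decidable relations\<close>

text \<open>These are total functions, so a Sigma_1 graph means recursive. The class serves to show
  that everything a state records beyond its oracle segment is computable.\<close>

definition cf :: "((nat \<Rightarrow> nat) \<Rightarrow> nat) \<Rightarrow> bool" where
  "cf f \<longleftrightarrow> SG 1 (\<lambda>e. e 0 = f (\<lambda>i. e (Suc i)))"

definition dec :: "((nat \<Rightarrow> nat) \<Rightarrow> bool) \<Rightarrow> bool" where
  "dec P \<longleftrightarrow> SG 1 P \<and> SG 1 (\<lambda>e. \<not> P e)"

lemma SG1_ex: "SG 1 (\<lambda>e. Q (e 0) (\<lambda>i. e (Suc i))) \<Longrightarrow> SG 1 (\<lambda>e. \<exists>u. Q u e)"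
  using SG_ex[of 0 Q] by simp

lemma SG1_subst:
  assumes "SG 1 (\<lambda>e. Q (e 0) (\<lambda>i. e (Suc i)))" "cf f"
  shows "SG 1 (\<lambda>e. Q (f e) e)"
proof -
  have "SG 1 (\<lambda>e. \<exists>u. u = f e \<and> Q u e)"
    by (rule SG1_ex, rule SG_conj[OF assms(2)[unfolded cf_def] assms(1)])
  then show ?thesis by simp
qed

lemma dec_subst: "dec (\<lambda>e. Q (e 0) (\<lambda>i. e (Suc i))) \<Longrightarrow> cf f \<Longrightarrow> dec (\<lambda>e. Q (f e) e)"
  unfolding dec_def
  using SG1_subst[of Q f] SG1_subst[of "\<lambda>u e. \<not> Q u e" f] by blast

lemma cf_shift: "cf f \<Longrightarrow> cf (\<lambda>e. f (\<lambda>i. e (Suc i)))"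
  unfolding cf_def
  by (drule SG_ren[where \<rho> = "\<lambda>i. if i = 0 then 0 else Suc i"]) simp

lemma dec_shift: "dec P \<Longrightarrow> dec (\<lambda>e. P (\<lambda>i. e (Suc i)))"
  unfolding dec_def using SG_shift[of 1 P] SG_shift[of 1 "\<lambda>e. \<not> P e"] by blast

lemma cf_subst:
  assumes "cf (\<lambda>e. g (e 0) (\<lambda>i. e (Suc i)))" "cf f"
  shows "cf (\<lambda>e. g (f e) e)"
proof -
  have "SG 1 (\<lambda>e. e 1 = g (e 0) (\<lambda>i. e (Suc (Suc i))))"
    using SG_ren[OF assms(1)[unfolded cf_def], of "\<lambda>i. if i = 0 then 1 else if i = 1 then 0 else i"]
    by simp
  then show ?thesis
    unfolding cf_def
    using SG1_subst[of "\<lambda>u e. e 0 = g u (\<lambda>i. e (Suc i))", OF _ cf_shift[OF assms(2)]] by simp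
qed

lemma df_cf: "df f \<Longrightarrow> cf f"
  by (simp add: df_def cf_def D0_SG)

lemma D0_dec: "D0 P \<Longrightarrow> dec P"
  by (simp add: dec_def D0_SG D0_not)

lemma cf_var: "cf (\<lambda>e. e k)" and cf_const: "cf (\<lambda>e. c)"
  by (simp_all add: df_cf df_rules)

lemma cf_comp1: "cf (\<lambda>e. g (e 0)) \<Longrightarrow> cf f \<Longrightarrow> cf (\<lambda>e. g (f e))"
  using cf_subst[of "\<lambda>u e. g u" f] by simp

lemma cf_comp2:
  assumes "cf (\<lambda>e. g (e 0) (e 1))" "cf f1" "cf f2"
  shows "cf (\<lambda>e. g (f1 e) (f2 e))"
proof -
  have "cf (\<lambda>e. g (f1 (\<lambda>i. e (Suc i))) (e 0))"
    using cf_subst[of "\<lambda>u e. g u (e 0)" "\<lambda>e. f1 (\<lambda>i. e (Suc i))"]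
      cf_shift[OF assms(2)] assms(1) by simp
  then show ?thesis
    using cf_subst[of "\<lambda>u e. g (f1 e) u" f2] assms(3) by simp
qed

lemma cf_add: "cf f \<Longrightarrow> cf g \<Longrightarrow> cf (\<lambda>e. f e + g e)"
  by (rule cf_comp2[where g = "(+)", OF df_cf[OF df_add[OF df_var df_var]]])

lemma cf_mult: "cf f \<Longrightarrow> cf g \<Longrightarrow> cf (\<lambda>e. f e * g e)"
  by (rule cf_comp2[where g = "times", OF df_cf[OF df_mult[OF df_var df_var]]])

lemma cf_pp: "cf f \<Longrightarrow> cf g \<Longrightarrow> cf (\<lambda>e. pp (f e) (g e))"
  by (rule cf_comp2[where g = "pp", OF df_cf[OF df_pp[OF df_var df_var]]])

lemma cf_beta: "cf f \<Longrightarrow> cf g \<Longrightarrow> cf (\<lambda>e. beta (f e) (g e))"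
  by (rule cf_comp2[where g = "beta", OF df_cf[OF df_beta[OF df_var df_var]]])

lemma cf_Suc: "cf f \<Longrightarrow> cf (\<lambda>e. Suc (f e))"
  by (rule cf_comp1[where g = "Suc", OF df_cf[OF df_Suc[OF df_var]]])

lemma cf_pf: "cf f \<Longrightarrow> cf (\<lambda>e. pf (f e))"
  by (rule cf_comp1[where g = "pf", OF df_cf[OF df_pf[OF df_var]]])

lemma cf_ps: "cf f \<Longrightarrow> cf (\<lambda>e. ps (f e))"
  by (rule cf_comp1[where g = "ps", OF df_cf[OF df_ps[OF df_var]]])

lemma dec_comp2:
  assumes "D0 (\<lambda>e. R (e 0) (e 1))" "cf f1" "cf f2"
  shows "dec (\<lambda>e. R (f1 e) (f2 e))"
proof -
  have "dec (\<lambda>e. R (f1 (\<lambda>i. e (Suc i))) (e 0))"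
    using dec_subst[of "\<lambda>u e. R u (e 0)" "\<lambda>e. f1 (\<lambda>i. e (Suc i))"]
      cf_shift[OF assms(2)] D0_dec[OF assms(1)] by simp
  then show ?thesis
    using dec_subst[of "\<lambda>u e. R (f1 e) u" f2] assms(3) by simp
qed

lemma dec_eq: "cf f \<Longrightarrow> cf g \<Longrightarrow> dec (\<lambda>e. f e = g e)"
  by (rule dec_comp2[where R = "(=)", OF D0_eq[OF df_var df_var]])

lemma dec_less: "cf f \<Longrightarrow> cf g \<Longrightarrow> dec (\<lambda>e. f e < g e)"
  by (rule dec_comp2[where R = "(<)", OF D0_less[OF df_var df_var]])

lemma dec_le: "cf f \<Longrightarrow> cf g \<Longrightarrow> dec (\<lambda>e. f e \<le> g e)"
  by (rule dec_comp2[where R = "(\<le>)", OF D0_le[OF df_var df_var]])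

lemma dec_not: "dec P \<Longrightarrow> dec (\<lambda>e. \<not> P e)"
  by (simp add: dec_def)

lemma dec_conj: "dec P \<Longrightarrow> dec Q \<Longrightarrow> dec (\<lambda>e. P e \<and> Q e)"
  unfolding dec_def de_Morgan_conj using SG_conj SG_disj by blast

lemma SG1_bex:
  assumes "cf b" "SG 1 (\<lambda>e. Q (e 0) (\<lambda>i. e (Suc i)))"
  shows "SG 1 (\<lambda>e. \<exists>u<b e. Q u e)"
  using dec_less[OF cf_var[of 0] cf_shift[OF assms(1)]] assms(2)
  by (intro SG1_ex SG_conj) (simp_all add: dec_def)

lemma SG1_ball:
  assumes "cf b" "SG 1 (\<lambda>e. Q (e 0) (\<lambda>i. e (Suc i)))"
  shows "SG 1 (\<lambda>e. \<forall>u<b e. Q u e)"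
proof -
  have "SG 1 (\<lambda>e. \<forall>u<e 0. Q u (\<lambda>i. e (Suc i)))"
    using SG_ren[OF assms(2), of "\<lambda>i. if i = 0 then 0 else Suc i"]
    by (intro SG1_ball_tf df_var) simp
  then show ?thesis
    by (rule SG1_subst[where Q = "\<lambda>u e. \<forall>v<u. Q v e", OF _ assms(1)])
qed

lemma dec_bex: "cf b \<Longrightarrow> dec (\<lambda>e. Q (e 0) (\<lambda>i. e (Suc i))) \<Longrightarrow> dec (\<lambda>e. \<exists>u<b e. Q u e)"
  unfolding dec_def using SG1_bex[of b Q] SG1_ball[of b "\<lambda>u e. \<not> Q u e"] by auto

lemma dec_ball: "cf b \<Longrightarrow> dec (\<lambda>e. Q (e 0) (\<lambda>i. e (Suc i))) \<Longrightarrow> dec (\<lambda>e. \<forall>u<b e. Q u e)"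
  unfolding dec_def using SG1_ball[of b Q] SG1_bex[of b "\<lambda>u e. \<not> Q u e"] by auto

lemma dec_const: "dec (\<lambda>e. c)"
  by (rule D0_dec) (rule D0_const)

lemma dec_SG1: "dec P \<Longrightarrow> SG 1 P"
  by (simp add: dec_def)

lemma cf_if: "dec P \<Longrightarrow> cf f \<Longrightarrow> cf g \<Longrightarrow> cf (\<lambda>e. if P e then f e else g e)"
proof -
  assume *: "dec P" "cf f" "cf g"
  have "SG 1 (\<lambda>e. P (\<lambda>i. e (Suc i)) \<and> e 0 = f (\<lambda>i. e (Suc i)) \<or>
      \<not> P (\<lambda>i. e (Suc i)) \<and> e 0 = g (\<lambda>i. e (Suc i)))"
    using * dec_shift[OF *(1)] by (intro SG_disj SG_conj) (simp_all add: cf_def dec_def)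
  moreover have "P e \<and> x = a \<or> \<not> P e \<and> x = b \<longleftrightarrow> x = (if P e then a else b)" for e x and a b :: nat
    by simp
  ultimately show ?thesis by (simp add: cf_def)
qed

lemma cf_Least:
  assumes "dec (\<lambda>e. Q (e 0) (\<lambda>i. e (Suc i)))" "\<And>e. \<exists>u. Q u e"
  shows "cf (\<lambda>e. LEAST u. Q u e)"
proof -
  have "dec (\<lambda>e. \<forall>u<e 0. \<not> Q u (\<lambda>i. e (Suc i)))"
    using assms(1) SG_ren[of 1 "\<lambda>e. Q (e 0) (\<lambda>i. e (Suc i))" "\<lambda>i. if i = 0 then 0 else Suc i"]
      SG_ren[of 1 "\<lambda>e. \<not> Q (e 0) (\<lambda>i. e (Suc i))" "\<lambda>i. if i = 0 then 0 else Suc i"]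
    by (intro dec_ball cf_var dec_not) (simp_all add: dec_def)
  from dec_conj[OF assms(1) this]
  have "SG 1 (\<lambda>e. Q (e 0) (\<lambda>i. e (Suc i)) \<and> (\<forall>u<e 0. \<not> Q u (\<lambda>i. e (Suc i))))"
    by (rule dec_SG1)
  moreover have "Q x e \<and> (\<forall>u<x. \<not> Q u e) \<longleftrightarrow> x = (LEAST u. Q u e)" for x e
    using assms(2)[of e] by (metis LeastI_ex not_less_Least linorder_neqE_nat)
  ultimately show ?thesis by (simp add: cf_def)
qed

text \<open>A beta-coded list of all intermediate values certifies the recursion, so primitive
  recursion preserves \<open>cf\<close>.\<close>

lemma rec_nat_seq:
  "r = rec_nat a s N \<longleftrightarrow> (\<exists>t. beta t 0 = a \<and> (\<forall>k<N. beta t (Suc k) = s k (beta t k)) \<and> beta t N = r)"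
proof
  assume r: "r = rec_nat a s N"
  obtain t where t: "\<forall>i<Suc N. beta t i = rec_nat a s i"
    using beta_exists by blast
  show "\<exists>t. beta t 0 = a \<and> (\<forall>k<N. beta t (Suc k) = s k (beta t k)) \<and> beta t N = r"
    by (rule exI[of _ t]) (use t r in simp)
next
  assume "\<exists>t. beta t 0 = a \<and> (\<forall>k<N. beta t (Suc k) = s k (beta t k)) \<and> beta t N = r"
  then obtain t where t: "beta t 0 = a" "\<forall>k<N. beta t (Suc k) = s k (beta t k)" "beta t N = r"
    by blast
  have "k \<le> N \<Longrightarrow> beta t k = rec_nat a s k" for k
    by (induction k) (use t in auto)
  with t(3) show "r = rec_nat a s N" by auto
qed

lemma cf_rec_nat:
  assumes "cf a" "cf N" "cf (\<lambda>e. s (e 0) (e 1) (\<lambda>i. e (Suc (Suc i))))"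
  shows "cf (\<lambda>e. rec_nat (a e) (\<lambda>k r. s k r e) (N e))"
proof -
  have s: "cf (\<lambda>e. s (e 0) (beta (e 1) (e 0)) (\<lambda>i. e (Suc (Suc (Suc i)))))"
  proof (rule cf_subst[where g = "\<lambda>u e. s (e 0) u (\<lambda>i. e (Suc (Suc (Suc i))))"])
    show "cf (\<lambda>e. s (e (Suc 0)) (e 0) (\<lambda>i. e (Suc (Suc (Suc (Suc i))))))"
      using assms(3) unfolding cf_def
      by (drule_tac SG_ren[where \<rho> = "\<lambda>i. if i = 0 then 0 else if i = 1 then 2 else if i = 2 then 1 else Suc (Suc i)"])
        (simp add: numeral_2_eq_2)
  qed (intro cf_beta cf_var)
  have "SG 1 (\<lambda>e. \<exists>t. beta t 0 = a (\<lambda>i. e (Suc i)) \<and>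
      (\<forall>k<N (\<lambda>i. e (Suc i)). beta t (Suc k) = s k (beta t k) (\<lambda>i. e (Suc i))) \<and>
      beta t (N (\<lambda>i. e (Suc i))) = e 0)"
    by (intro SG1_ex SG_conj SG1_ball dec_SG1[OF dec_eq] cf_beta cf_Suc cf_var cf_const
        cf_shift[OF cf_shift[OF assms(1)]] cf_shift[OF cf_shift[OF assms(2)]] s[simplified])
  then show ?thesis
    unfolding cf_def by (subst rec_nat_seq)
qed

lemma cf_sum:
  assumes "cf N" "cf (\<lambda>e. f (e 0) (\<lambda>i. e (Suc i)))"
  shows "cf (\<lambda>e. \<Sum>x<N e. f x e)"
proof -
  have eq: "(\<Sum>x<n. f x e) = rec_nat 0 (\<lambda>k r. r + f k e) n" for n e
    by (induction n) simp_all
  have "cf (\<lambda>e. f (e 0) (\<lambda>i. e (Suc (Suc i))))"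
    using assms(2) unfolding cf_def
    by (drule_tac SG_ren[where \<rho> = "\<lambda>i. if i \<le> 1 then i else Suc i"]) (simp add: numeral_2_eq_2)
  then show ?thesis
    unfolding eq by (intro cf_rec_nat assms(1) cf_const cf_add cf_var)
qed

lemma cf_pow2: "cf f \<Longrightarrow> cf (\<lambda>e. 2 ^ f e)"
proof -
  have eq: "(2::nat) ^ n = rec_nat 1 (\<lambda>k r. r + r) n" for n
    by (induction n) simp_all
  show "cf f \<Longrightarrow> cf (\<lambda>e. 2 ^ f e)"
    unfolding eq by (intro cf_rec_nat cf_const cf_add cf_var)
qed

lemma cf_pf_funpow: "cf k \<Longrightarrow> cf f \<Longrightarrow> cf (\<lambda>e. (pf ^^ k e) (f e))"
proof -
  have eq: "(pf ^^ n) x = rec_nat x (\<lambda>k r. pf r) n" for n x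
    by (induction n) simp_all
  show "cf k \<Longrightarrow> cf f \<Longrightarrow> cf (\<lambda>e. (pf ^^ k e) (f e))"
    unfolding eq by (intro cf_rec_nat cf_pf cf_var)
qed

lemma cf_diff: "cf f \<Longrightarrow> cf g \<Longrightarrow> cf (\<lambda>e. f e - g e)"
proof -
  have eq: "a - b = (LEAST u. a \<le> b + u)" for a b :: nat
    by (rule sym, rule Least_equality) auto
  have "cf (\<lambda>e. e 0 - e 1)"
    unfolding eq by (intro cf_Least dec_le cf_add cf_var) (auto intro: le_add2)
  from cf_comp2[where g = "(-)", OF this] show "cf f \<Longrightarrow> cf g \<Longrightarrow> cf (\<lambda>e. f e - g e)" .
qed

lemma cf_min: "cf f \<Longrightarrow> cf g \<Longrightarrow> cf (\<lambda>e. min (f e) (g e))"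
  unfolding min_def by (intro cf_if dec_le)

lemma set_decode_less: "x \<in> set_decode n \<Longrightarrow> x < n"
proof -
  assume "x \<in> set_decode n"
  then have "n div 2 ^ x \<noteq> 0" by (intro notI) (simp add: set_decode_def)
  then have "2 ^ x \<le> n" by (simp add: div_eq_0_iff)
  then show "x < n" using less_exp[of x] by linarith
qed

lemma dec_mem: "cf f \<Longrightarrow> cf g \<Longrightarrow> dec (\<lambda>e. f e \<in> set_decode (g e))"
proof -
  have eq: "x \<in> set_decode n \<longleftrightarrow> (\<exists>q<Suc n. \<exists>r<2 ^ x. n = (2 * q + 1) * 2 ^ x + r)" for x n
  proof
    assume "x \<in> set_decode n"
    then have "odd (n div 2 ^ x)" by (simp add: set_decode_def)
    then obtain q where q: "n div 2 ^ x = 2 * q + 1" by (rule oddE)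
    then have "n = (2 * q + 1) * 2 ^ x + n mod 2 ^ x"
      by (metis div_mult_mod_eq)
    moreover have "q \<le> n" using q div_le_dividend[of n "2 ^ x"] by linarith
    ultimately show "\<exists>q<Suc n. \<exists>r<2 ^ x. n = (2 * q + 1) * 2 ^ x + r"
      by (metis less_Suc_eq_le mod_less_divisor zero_less_numeral zero_less_power)
  next
    assume "\<exists>q<Suc n. \<exists>r<2 ^ x. n = (2 * q + 1) * 2 ^ x + r"
    then obtain q r where "r < 2 ^ x" "n = r + (2 * q + 1) * 2 ^ x" by auto
    then have "n div 2 ^ x = 2 * q + 1" by (simp only: div_mult_self1) simp
    then show "x \<in> set_decode n" by (simp add: set_decode_def)
  qed
  have "dec (\<lambda>e. e 0 \<in> set_decode (e 1))"
    unfolding eq by (intro dec_bex dec_eq cf_add cf_mult cf_pow2 cf_Suc cf_const cf_var)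
  then have "dec (\<lambda>e. f (\<lambda>i. e (Suc i)) \<in> set_decode (e 0))" if "cf f"
    using dec_subst[of "\<lambda>u e. u \<in> set_decode (e 0)" "\<lambda>e. f (\<lambda>i. e (Suc i))"]
      cf_shift[OF that] by simp
  then show "cf f \<Longrightarrow> cf g \<Longrightarrow> dec (\<lambda>e. f e \<in> set_decode (g e))"
    using dec_subst[of "\<lambda>u e. f e \<in> set_decode u" g] by simp
qed

lemma cf_card:
  assumes "cf a" "dec (\<lambda>e. Q (e 0) (\<lambda>i. e (Suc i)))"
  shows "cf (\<lambda>e. card {x \<in> set_decode (a e). Q x e})"
proof -
  have eq: "card {x \<in> set_decode n. Q x e} = (\<Sum>x<n. if x \<in> set_decode n \<and> Q x e then 1 else 0)"
    for n e
  proof -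
    have "{x \<in> set_decode n. Q x e} = {x \<in> {..<n}. x \<in> set_decode n \<and> Q x e}"
      using set_decode_less by auto
    then show ?thesis by (simp add: sum.If_cases Int_def)
  qed
  show ?thesis
    unfolding eq by (intro cf_sum cf_if dec_conj dec_mem cf_const cf_var assms cf_shift)
qed

lemma cf_set_encode:
  assumes "cf b" "dec (\<lambda>e. Q (e 0) (\<lambda>i. e (Suc i)))" "\<And>e x. Q x e \<Longrightarrow> x < b e"
  shows "cf (\<lambda>e. set_encode {x. Q x e})"
proof -
  have eq: "set_encode {x. Q x e} = (\<Sum>x<b e. if Q x e then 2 ^ x else 0)" for e
  proof -
    have "{x. Q x e} = {x \<in> {..<b e}. Q x e}"
      using assms(3) by auto
    then show ?thesis by (simp add: set_encode_def sum.If_cases Int_def)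
  qed
  show ?thesis
    unfolding eq by (intro cf_sum cf_if cf_pow2 cf_const cf_var assms(1,2))
qed

section \<open>Oracle programs\<close>

text \<open>Search is bounded only, so every program is total for every oracle. Unbounded search
  enters through the oracle alone; this lets a program be run on a truncated oracle without any risk
  of divergence.\<close>

datatype prog = PConst nat | PPair prog prog | PComp prog prog | PMin prog
  | PFst | PSnd | PAdd | PMul | PLess | POrc

text \<open>Bounded search; the value is \<open>N\<close> if the search fails.\<close>

definition bm :: "nat \<Rightarrow> (nat \<Rightarrow> bool) \<Rightarrow> nat" where
  "bm N Q = (LEAST u. u < N \<longrightarrow> Q u)"

lemma bm_iff: "r = bm N Q \<longleftrightarrow> r \<le> N \<and> (\<forall>u<r. \<not> Q u) \<and> (r = N \<or> Q r)"
proof -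
  have ex: "N < N \<longrightarrow> Q N" by simp
  show ?thesis
  proof
    assume r: "r = bm N Q"
    have "r < N \<longrightarrow> Q r" unfolding r bm_def by (rule LeastI[where P = "\<lambda>u. u < N \<longrightarrow> Q u", OF ex])
    moreover have "r \<le> N" unfolding r bm_def by (rule Least_le[where P = "\<lambda>u. u < N \<longrightarrow> Q u", OF ex])
    moreover have "\<not> Q u" if "u < r" for u
      using not_less_Least[OF that[unfolded r bm_def]] by simp
    ultimately show "r \<le> N \<and> (\<forall>u<r. \<not> Q u) \<and> (r = N \<or> Q r)" by auto
  next
    assume r: "r \<le> N \<and> (\<forall>u<r. \<not> Q u) \<and> (r = N \<or> Q r)"
    show "r = bm N Q"
      unfolding bm_def
      by (rule sym, rule Least_equality) (use r in \<open>auto simp: not_le[symmetric]\<close>)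
  qed
qed

lemma bm_le: "bm N Q \<le> N"
  using bm_iff by blast

lemma bm_less: "bm N Q < N \<longleftrightarrow> (\<exists>u<N. Q u)"
  using bm_iff[of "bm N Q" N Q] by (metis linorder_not_less order_le_imp_less_or_eq)

lemma bm_sat: "u < N \<Longrightarrow> Q u \<Longrightarrow> Q (bm N Q)"
  using bm_iff[of "bm N Q" N Q] bm_less[of N Q] by auto

lemma bm_cong: "(\<And>u. u < N \<Longrightarrow> Q u = Q' u) \<Longrightarrow> bm N Q = bm N Q'"
  unfolding bm_def by (rule arg_cong[where f = Least]) auto

primrec run :: "(nat \<Rightarrow> nat) \<Rightarrow> prog \<Rightarrow> nat \<Rightarrow> nat" where
  "run v (PConst k) x = k"
| "run v (PPair p q) x = pp (run v p x) (run v q x)"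
| "run v (PComp p q) x = run v p (run v q x)"
| "run v (PMin p) x = bm (pf x) (\<lambda>u. run v p (pp u (ps x)) = 0)"
| "run v PFst x = pf x"
| "run v PSnd x = ps x"
| "run v PAdd x = pf x + ps x"
| "run v PMul x = pf x * ps x"
| "run v PLess x = (if pf x < ps x then 0 else 1)"
| "run v POrc x = v x"

lemma add_le_pp: "x + y \<le> pp x y"
proof -
  have "n \<le> triangle n" for n by (induction n) auto
  then show ?thesis by (simp add: pp_def prod_encode_def trans_le_add1)
qed

lemma ps_less: "pf z \<noteq> 0 \<Longrightarrow> ps z < z"
  using add_le_pp[of "pf z" "ps z"] by simp

text \<open>All large tags denote the oracle call, so every number is a program code and no validity
  check is ever needed.\<close>

function pdec :: "nat \<Rightarrow> prog" where
  "pdec m =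
    (if pf m = 0 then PConst (ps m)
     else if pf m = 1 then PPair (pdec (pf (ps m))) (pdec (ps (ps m)))
     else if pf m = 2 then PComp (pdec (pf (ps m))) (pdec (ps (ps m)))
     else if pf m = 3 then PMin (pdec (ps m))
     else if pf m = 4 then PFst
     else if pf m = 5 then PSnd
     else if pf m = 6 then PAdd
     else if pf m = 7 then PMul
     else if pf m = 8 then PLess
     else POrc)"
  by auto
termination
  by (relation "measure id")
    (auto intro: ps_less le_less_trans[OF pf_le ps_less] le_less_trans[OF ps_le ps_less])

declare pdec.simps [simp del]

lemma pdec_surj: "\<exists>m. pdec m = p"
proof (induction p)
  case (PConst k)
  show ?case by (rule exI[of _ "pp 0 k"]) (simp add: pdec.simps)
next
  case (PPair p q)
  then obtain a b where "pdec a = p" "pdec b = q" by blast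
  then show ?case by (intro exI[of _ "pp 1 (pp a b)"]) (simp add: pdec.simps[of "pp _ _"])
next
  case (PComp p q)
  then obtain a b where "pdec a = p" "pdec b = q" by blast
  then show ?case by (intro exI[of _ "pp 2 (pp a b)"]) (simp add: pdec.simps[of "pp _ _"])
next
  case (PMin p)
  then obtain a where "pdec a = p" by blast
  then show ?case by (intro exI[of _ "pp 3 a"]) (simp add: pdec.simps[of "pp _ _"])
next
  case PFst
  show ?case by (rule exI[of _ "pp 4 0"]) (simp add: pdec.simps)
next
  case PSnd
  show ?case by (rule exI[of _ "pp 5 0"]) (simp add: pdec.simps)
next
  case PAdd
  show ?case by (rule exI[of _ "pp 6 0"]) (simp add: pdec.simps)
next
  case PMul
  show ?case by (rule exI[of _ "pp 7 0"]) (simp add: pdec.simps)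
next
  case PLess
  show ?case by (rule exI[of _ "pp 8 0"]) (simp add: pdec.simps)
next
  case POrc
  show ?case by (rule exI[of _ "pp 9 0"]) (simp add: pdec.simps)
qed

text \<open>A set of triples \<open>(m, x, r)\<close>, given by its membership relation \<open>T\<close>, is a computation
  if each triple is locally justified by others; \<open>OR\<close> is the set of permitted oracle answers.\<close>

definition step :: "(nat \<Rightarrow> nat \<Rightarrow> nat \<Rightarrow> bool) \<Rightarrow> (nat \<Rightarrow> nat \<Rightarrow> bool) \<Rightarrow> nat \<Rightarrow> nat \<Rightarrow> nat \<Rightarrow> bool" where
  "step T OR m x r \<longleftrightarrow>
     pf m = 0 \<and> r = ps m \<or>
     pf m = 1 \<and> T (pf (ps m)) x (pf r) \<and> T (ps (ps m)) x (ps r) \<or>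
     pf m = 2 \<and> (\<exists>y. T (ps (ps m)) x y \<and> T (pf (ps m)) y r) \<or>
     pf m = 3 \<and> r \<le> pf x \<and> (\<forall>u<r. \<exists>y. T (ps m) (pp u (ps x)) (Suc y)) \<and>
       (r = pf x \<or> T (ps m) (pp r (ps x)) 0) \<or>
     pf m = 4 \<and> r = pf x \<or>
     pf m = 5 \<and> r = ps x \<or>
     pf m = 6 \<and> r = pf x + ps x \<or>
     pf m = 7 \<and> r = pf x * ps x \<or>
     pf m = 8 \<and> (pf x < ps x \<and> r = 0 \<or> \<not> pf x < ps x \<and> r = 1) \<or>
     8 < pf m \<and> OR x r"

text \<open>\<open>T\<close> occurs only positively in \<open>step\<close>: that a value is nonzero
  is expressed by a recorded triple with a successor as value, not by the absence of a
  triple.\<close>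

lemma step_mono:
  assumes "step T OR m x r" "\<And>m x r. T m x r \<Longrightarrow> T' m x r"
  shows "step T' OR m x r"
  using assms unfolding step_def by (elim disjE) (simp_all, blast+)

text \<open>Subprograms have smaller codes, so induction on the code suffices and the computation
  needs no ordering of its triples.\<close>

lemma step_sound:
  assumes "\<And>m x r. T m x r \<Longrightarrow> step T OR m x r" "\<And>x r. OR x r \<Longrightarrow> r = v x" "T m x r"
  shows "r = run v (pdec m) x"
  using assms(3)
proof (induction m arbitrary: x r rule: less_induct)
  case (less m)
  note IH = less.IH[OF le_less_trans[OF pf_le ps_less]] less.IH[OF le_less_trans[OF ps_le ps_less]]
    less.IH[OF ps_less]
  have st: "step T OR m x r" by (rule assms(1)[OF less.prems])
  consider "pf m = 0" | (pr) "pf m = 1" | (co) "pf m = 2" | (mi) "pf m = 3" | "pf m = 4"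
    | "pf m = 5" | "pf m = 6" | "pf m = 7" | "pf m = 8" | "8 < pf m"
    by linarith
  then show ?case
  proof cases
    case pr
    then have "T (pf (ps m)) x (pf r)" "T (ps (ps m)) x (ps r)"
      using st by (simp_all add: step_def)
    then have "pf r = run v (pdec (pf (ps m))) x" "ps r = run v (pdec (ps (ps m))) x"
      using IH(1,2) pr by simp_all
    then have "r = pp (run v (pdec (pf (ps m))) x) (run v (pdec (ps (ps m))) x)"
      by (metis pair_simps(3))
    then show ?thesis using pr by (simp add: pdec.simps[of m])
  next
    case co
    then obtain y where "T (ps (ps m)) x y" "T (pf (ps m)) y r"
      using st by (auto simp: step_def)
    then have "y = run v (pdec (ps (ps m))) x" "r = run v (pdec (pf (ps m))) y"
      using IH(1,2) co by simp_all
    then show ?thesis using co by (simp add: pdec.simps[of m])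
  next
    case mi
    then have T: "r \<le> pf x" "\<forall>u<r. \<exists>y. T (ps m) (pp u (ps x)) (Suc y)"
       "r = pf x \<or> T (ps m) (pp r (ps x)) 0"
      using st by (simp_all add: step_def)
    have "\<forall>u<r. run v (pdec (ps m)) (pp u (ps x)) \<noteq> 0"
    proof (intro allI impI)
      fix u assume "u < r"
      then obtain y where "T (ps m) (pp u (ps x)) (Suc y)" using T(2) by blast
      from IH(3)[OF _ this] mi show "run v (pdec (ps m)) (pp u (ps x)) \<noteq> 0" by simp
    qed
    moreover have "r = pf x \<or> run v (pdec (ps m)) (pp r (ps x)) = 0"
      using mi T(3) IH(3)[of "pp r (ps x)" 0] by auto
    ultimately have "r = bm (pf x) (\<lambda>u. run v (pdec (ps m)) (pp u (ps x)) = 0)"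
      using T(1) by (simp add: bm_iff)
    then show ?thesis using mi by (simp add: pdec.simps[of m])
  qed (use st assms(2) in \<open>auto simp: pdec.simps[of m] step_def\<close>)
qed

text \<open>\<open>Q\<close> collects the queries on which \<open>D\<close> depends. Quantifying
  over all \<open>OR\<close> that contain the true answers on \<open>Q\<close> lets one finite
  computation serve for every sufficiently long oracle segment.\<close>

definition comp_set :: "(nat \<Rightarrow> nat) \<Rightarrow> (nat \<times> nat \<times> nat) set \<Rightarrow> nat set \<Rightarrow> bool" where
  "comp_set v D Q \<longleftrightarrow> (\<forall>OR. (\<forall>q\<in>Q. OR q (v q)) \<longrightarrow>
     (\<forall>(m, x, r)\<in>D. step (\<lambda>a b c. (a, b, c) \<in> D) OR m x r))"

lemma comp_set_Union:
  assumes "\<And>i. i \<in> I \<Longrightarrow> comp_set v (D i) (Q i)"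
  shows "comp_set v (\<Union>i\<in>I. D i) (\<Union>i\<in>I. Q i)"
  unfolding comp_set_def
proof (intro allI impI, clarify)
  fix OR i m x r
  assume *: "\<forall>q\<in>\<Union> (Q ` I). OR q (v q)" "i \<in> I" "(m, x, r) \<in> D i"
  then have "step (\<lambda>a b c. (a, b, c) \<in> D i) OR m x r"
    using assms[of i] unfolding comp_set_def by blast
  then show "step (\<lambda>a b c. (a, b, c) \<in> \<Union> (D ` I)) OR m x r"
    by (rule step_mono) (use *(2) in blast)
qed

lemma comp_set_Un:
  "comp_set v D Q \<Longrightarrow> comp_set v D' Q' \<Longrightarrow> comp_set v (D \<union> D') (Q \<union> Q')"
  using comp_set_Union[of UNIV v "\<lambda>b. if b then D else D'" "\<lambda>b. if b then Q else Q'"]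
  by (simp add: UNIV_bool Un_commute)

lemma comp_set_insert:
  assumes "comp_set v D Q"
    "\<And>OR. \<forall>q\<in>Q \<union> Q'. OR q (v q) \<Longrightarrow> step (\<lambda>a b c. (a, b, c) \<in> D) OR m x r"
  shows "comp_set v (insert (m, x, r) D) (Q \<union> Q')"
  unfolding comp_set_def
proof (intro allI impI, clarify)
  fix OR a b c
  assume *: "\<forall>q\<in>Q \<union> Q'. OR q (v q)" "(a, b, c) \<in> insert (m, x, r) D"
  have "step (\<lambda>a b c. (a, b, c) \<in> D) OR a b c"
  proof (cases "(a, b, c) \<in> D")
    case True
    moreover have "\<forall>q\<in>Q. OR q (v q)" using *(1) by blast
    ultimately show ?thesis using assms(1) unfolding comp_set_def by blast
  next
    case False
    then show ?thesis using *(2) assms(2)[of OR] *(1) by simp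
  qed
  then show "step (\<lambda>a b c. (a, b, c) \<in> insert (m, x, r) D) OR a b c"
    by (rule step_mono) blast
qed

lemma comp_set_exists:
  "\<exists>D Q. finite D \<and> finite Q \<and> (m, x, run v (pdec m) x) \<in> D \<and> comp_set v D Q"
proof (induction m arbitrary: x rule: less_induct)
  case (less m)
  note IH = less.IH[OF le_less_trans[OF pf_le ps_less]] less.IH[OF le_less_trans[OF ps_le ps_less]]
    less.IH[OF ps_less]
  have fin: ?case if "finite D" "finite Q" "finite Q'" "comp_set v D Q"
    "\<And>OR. \<forall>q\<in>Q \<union> Q'. OR q (v q) \<Longrightarrow> step (\<lambda>a b c. (a, b, c) \<in> D) OR m x (run v (pdec m) x)"
    for D Q Q'
    using that(1-3) comp_set_insert[OF that(4,5)]
    by (intro exI[of _ "insert (m, x, run v (pdec m) x) D"] exI[of _ "Q \<union> Q'"]) auto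
  consider (pr) "pf m = 1" | (co) "pf m = 2" | (mi) "pf m = 3" | (si) "pf m \<notin> {1, 2, 3}" by blast
  then show ?case
  proof cases
    case pr
    have r: "run v (pdec m) x = pp (run v (pdec (pf (ps m))) x) (run v (pdec (ps (ps m))) x)"
      using pr by (simp add: pdec.simps[of m])
    obtain D1 Q1 D2 Q2 where D: "finite D1" "finite Q1" "(pf (ps m), x, run v (pdec (pf (ps m))) x) \<in> D1" "comp_set v D1 Q1"
      "finite D2" "finite Q2" "(ps (ps m), x, run v (pdec (ps (ps m))) x) \<in> D2" "comp_set v D2 Q2"
      using IH(1)[of x] IH(2)[of x] pr by auto
    show ?thesis
      by (rule fin[OF _ _ finite.emptyI comp_set_Un[OF D(4,8)]]) (use D pr r in \<open>auto simp: step_def\<close>)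
  next
    case co
    define y where "y = run v (pdec (ps (ps m))) x"
    have r: "run v (pdec m) x = run v (pdec (pf (ps m))) y"
      using co by (simp add: pdec.simps[of m] y_def)
    obtain D1 Q1 D2 Q2 where D: "finite D1" "finite Q1" "(pf (ps m), y, run v (pdec (pf (ps m))) y) \<in> D1" "comp_set v D1 Q1"
      "finite D2" "finite Q2" "(ps (ps m), x, y) \<in> D2" "comp_set v D2 Q2"
      unfolding y_def using IH(1)[of "run v (pdec (ps (ps m))) x"] IH(2)[of x] co by auto
    show ?thesis
      by (rule fin[OF _ _ finite.emptyI comp_set_Un[OF D(4,8)]]) (use D co r in \<open>auto simp: step_def\<close>)
  next
    case mi
    have "\<forall>u. \<exists>D Q. finite D \<and> finite Q \<and>
        (ps m, pp u (ps x), run v (pdec (ps m)) (pp u (ps x))) \<in> D \<and> comp_set v D Q"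
      using IH(3) mi by simp
    then obtain D Q where D: "\<And>u. finite (D u)" "\<And>u. finite (Q u)"
        "\<And>u. (ps m, pp u (ps x), run v (pdec (ps m)) (pp u (ps x))) \<in> D u"
        "\<And>u. comp_set v (D u) (Q u)"
      by metis
    define r where "r = run v (pdec m) x"
    have "r = bm (pf x) (\<lambda>u. run v (pdec (ps m)) (pp u (ps x)) = 0)"
      using mi by (simp add: r_def pdec.simps[of m])
    then have r: "r \<le> pf x" "\<forall>u<r. run v (pdec (ps m)) (pp u (ps x)) \<noteq> 0"
      "r = pf x \<or> run v (pdec (ps m)) (pp r (ps x)) = 0"
      by (simp_all add: bm_iff)
    have st: "step (\<lambda>a b c. (a, b, c) \<in> (\<Union>u\<le>r. D u)) OR m x r" for OR
    proof -
      have "\<exists>y. (ps m, pp u (ps x), Suc y) \<in> (\<Union>u\<le>r. D u)" if "u < r" for u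
      proof -
        obtain y where "run v (pdec (ps m)) (pp u (ps x)) = Suc y"
          using not0_implies_Suc[OF r(2)[rule_format, OF \<open>u < r\<close>]] by (elim exE)
        with D(3)[of u] that show ?thesis by (metis UN_I atMost_iff less_imp_le)
      qed
      moreover have "r = pf x \<or> (ps m, pp r (ps x), 0) \<in> (\<Union>u\<le>r. D u)"
        using r(3) D(3)[of r] by (metis UN_I atMost_iff order_refl)
      ultimately show ?thesis using r(1) mi unfolding step_def by blast
    qed
    show ?thesis
    proof (rule fin[where D = "\<Union>u\<le>r. D u" and Q = "\<Union>u\<le>r. Q u" and Q' = "{}"])
      show "comp_set v (\<Union>u\<le>r. D u) (\<Union>u\<le>r. Q u)"
        using D(4) by (rule comp_set_Union)
    qed (use D(1,2) st in \<open>simp_all add: r_def\<close>)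
  next
    case si
    have "comp_set v {} {}" by (simp add: comp_set_def)
    moreover have "step (\<lambda>a b c. (a, b, c) \<in> {}) OR m x (run v (pdec m) x)"
      if "OR x (v x)" for OR
      using si that by (auto simp: step_def pdec.simps[of m])
    ultimately show ?thesis
      by (intro fin[of "{}" "{}" "{x}"]) auto
  qed
qed

section \<open>Coded computations relative to a finite oracle segment\<close>

definition Tab :: "nat \<Rightarrow> nat \<Rightarrow> nat \<Rightarrow> nat \<Rightarrow> nat \<Rightarrow> bool" where
  "Tab t l m x r \<longleftrightarrow> (\<exists>k<l. beta t k = pp m (pp x r))"

text \<open>The flag separates two uses of the segment \<open>s\<close> of length \<open>L\<close>.
  With \<open>fl = 1\<close> the oracle is completed by 0, so evaluation is total and recursive.
  With \<open>fl = 0\<close> queries beyond the segment have no answer, so a recorded computation is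
  correct for every oracle that extends the segment.\<close>

definition ora :: "nat \<Rightarrow> nat \<Rightarrow> nat \<Rightarrow> nat \<Rightarrow> nat \<Rightarrow> bool" where
  "ora fl L s q r \<longleftrightarrow> q < L \<and> r = beta s q \<or> fl = 1 \<and> L \<le> q \<and> r = 0"

definition Ev :: "nat \<Rightarrow> nat \<Rightarrow> nat \<Rightarrow> nat \<Rightarrow> nat \<Rightarrow> nat \<Rightarrow> bool" where
  "Ev fl L s m x r \<longleftrightarrow> (\<exists>t l. (\<forall>k<l. step (Tab t l) (ora fl L s) (pf (beta t k))
     (pf (ps (beta t k))) (ps (ps (beta t k)))) \<and> Tab t l m x r)"

lemma Ev_code:
  assumes "finite D" "comp_set v D Q" "(m, x, r) \<in> D" "\<forall>q\<in>Q. ora fl L s q (v q)"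
  shows "Ev fl L s m x r"
proof -
  obtain n :: nat and f where D: "D = f ` {i. i < n}"
    using finite_imp_nat_seg_image_inj_on[OF assms(1)] by blast
  obtain t where t: "\<forall>k<n. beta t k = (case f k of (a, b, c) \<Rightarrow> pp a (pp b c))"
    using beta_exists[of n "\<lambda>k. case f k of (a, b, c) \<Rightarrow> pp a (pp b c)"] by (elim exE)
  have T: "Tab t n a b c \<longleftrightarrow> (a, b, c) \<in> D" for a b c
  proof
    assume "Tab t n a b c"
    then obtain k where k: "k < n" "beta t k = pp a (pp b c)" by (auto simp: Tab_def)
    obtain a' b' c' where f: "f k = (a', b', c')" by (cases "f k") auto
    have "f k = (a, b, c)" using t k f by simp
    then show "(a, b, c) \<in> D" unfolding D using k(1) by (metis imageI mem_Collect_eq)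
  next
    assume "(a, b, c) \<in> D"
    then obtain k where k: "k < n" "f k = (a, b, c)" unfolding D by auto
    then show "Tab t n a b c" unfolding Tab_def using t by (intro exI[of _ k]) simp
  qed
  then have Teq: "Tab t n = (\<lambda>a b c. (a, b, c) \<in> D)" by (intro ext)
  have "step (Tab t n) (ora fl L s) (pf (beta t k)) (pf (ps (beta t k))) (ps (ps (beta t k)))"
    if "k < n" for k
  proof -
    obtain a b c where abc: "f k = (a, b, c)" by (cases "f k") auto
    then have "(a, b, c) \<in> D" using that D by (metis imageI mem_Collect_eq)
    then have "step (\<lambda>a b c. (a, b, c) \<in> D) (ora fl L s) a b c"
      using assms(2,4) unfolding comp_set_def by blast
    then show ?thesis using t that abc by (simp add: Teq)
  qed
  then show ?thesis unfolding Ev_def using assms(3) T by blast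
qed

lemma Ev_sound:
  assumes "Ev fl L s m x r" "\<And>q r. ora fl L s q r \<Longrightarrow> r = v q"
  shows "r = run v (pdec m) x"
proof -
  obtain t l where tl: "\<forall>k<l. step (Tab t l) (ora fl L s) (pf (beta t k))
     (pf (ps (beta t k))) (ps (ps (beta t k)))" "Tab t l m x r"
    using assms(1) unfolding Ev_def by blast
  show ?thesis
  proof (rule step_sound[of "Tab t l" "ora fl L s"])
    fix a b c assume "Tab t l a b c"
    then obtain k where "k < l" "beta t k = pp a (pp b c)" by (auto simp: Tab_def)
    with tl(1) show "step (Tab t l) (ora fl L s) a b c" by (metis pair_simps(1,2))
  qed (use assms(2) tl(2) in auto)
qed

definition tot :: "nat \<Rightarrow> nat \<Rightarrow> nat \<Rightarrow> nat" where
  "tot L s q = (if q < L then beta s q else 0)"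

lemma Ev_1: "Ev 1 L s m x r \<longleftrightarrow> r = run (tot L s) (pdec m) x"
proof
  show "Ev 1 L s m x r \<Longrightarrow> r = run (tot L s) (pdec m) x"
    by (rule Ev_sound[of 1 L s]) (auto simp: ora_def tot_def)
next
  assume r: "r = run (tot L s) (pdec m) x"
  obtain D Q where "finite D" "(m, x, r) \<in> D" "comp_set (tot L s) D Q"
    unfolding r using comp_set_exists[of m x "tot L s"] by (elim exE conjE)
  then show "Ev 1 L s m x r"
    by (intro Ev_code[of D "tot L s" Q]) (auto simp: ora_def tot_def)
qed

lemma Ev_0_sound: "Ev 0 L s m x r \<Longrightarrow> \<forall>q<L. beta s q = v q \<Longrightarrow> r = run v (pdec m) x"
  by (rule Ev_sound[of 0 L s]) (auto simp: ora_def)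

text \<open>The use principle: a finite computation depends on finitely many queries, and
  \<open>L\<close> is taken larger than their sum.\<close>

lemma Ev_0_complete:
  "\<exists>L. \<forall>s. (\<forall>q<L. beta s q = v q) \<longrightarrow> Ev 0 L s m x (run v (pdec m) x)"
proof -
  obtain D Q where D: "finite D" "finite Q" "(m, x, run v (pdec m) x) \<in> D" "comp_set v D Q"
    using comp_set_exists[of m x v] by (elim exE conjE)
  then have "\<forall>q\<in>Q. q < Suc (\<Sum>Q)"
    by (simp add: less_Suc_eq_le member_le_sum[of _ Q "\<lambda>q. q"])
  with D show ?thesis
    by (intro exI[of _ "Suc (\<Sum>Q)"] allI impI Ev_code[OF D(1,4)]) (auto simp: ora_def)
qed

lemma dec_Tab:
  "cf t \<Longrightarrow> cf l \<Longrightarrow> cf m \<Longrightarrow> cf x \<Longrightarrow> cf r \<Longrightarrow> dec (\<lambda>e. Tab (t e) (l e) (m e) (x e) (r e))"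
  unfolding Tab_def by (intro dec_bex dec_eq cf_beta cf_pp cf_var cf_shift)

lemma SG1_Ev:
  assumes "cf a" "cf b" "cf c" "cf d" "cf x" "cf r"
  shows "SG 1 (\<lambda>e. Ev (a e) (b e) (c e) (d e) (x e) (r e))"
proof -
  have "SG 1 (\<lambda>e. Ev (pf (e 0)) (pf (ps (e 0))) (pf (ps (ps (e 0)))) (pf (ps (ps (ps (e 0)))))
      (pf (ps (ps (ps (ps (e 0)))))) (ps (ps (ps (ps (ps (e 0)))))))"
    unfolding Ev_def step_def ora_def
    by (intro SG1_ex SG_conj SG1_ball SG_disj dec_SG1[OF dec_eq] dec_SG1[OF dec_less]
        dec_SG1[OF dec_le] dec_SG1[OF dec_not] dec_less dec_SG1[OF dec_Tab]
        cf_pf cf_ps cf_beta cf_pp cf_Suc cf_add cf_mult cf_var cf_const)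
  from SG1_subst[where Q = "\<lambda>u e. Ev (pf u) (pf (ps u)) (pf (ps (ps u))) (pf (ps (ps (ps u))))
      (pf (ps (ps (ps (ps u))))) (ps (ps (ps (ps (ps u)))))", OF this
      cf_pp[OF assms(1) cf_pp[OF assms(2) cf_pp[OF assms(3) cf_pp[OF assms(4)
          cf_pp[OF assms(5,6)]]]]]]
  show ?thesis by simp
qed

lemma cf_run:
  assumes "cf a" "cf b" "cf m" "cf x"
  shows "cf (\<lambda>e. run (tot (a e) (b e)) (pdec (m e)) (x e))"
  unfolding cf_def Ev_1[symmetric]
  by (intro SG1_Ev cf_const cf_var assms[THEN cf_shift])

section \<open>Iterated jumps\<close>

text \<open>\<open>V n\<close> is an oracle of degree \<open>0\<^bsup>(n)\<^esup>\<close> that also supplies least witnesses, so that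
  \<open>\<Sigma>\<^sub>n\<close> Skolem functions are computable from it by total programs.\<close>

primrec V :: "nat \<Rightarrow> nat \<Rightarrow> nat" where
  "V 0 = (\<lambda>q. 0)"
| "V (Suc n) = (\<lambda>q. if \<exists>w. run (V n) (pdec (pf q)) (pp w (ps q)) = 0
     then Suc (LEAST w. run (V n) (pdec (pf q)) (pp w (ps q)) = 0) else 0)"

declare V.simps(2) [simp del]

lemma PI_subst:
  assumes "PI n (\<lambda>e. Q (e 0) (\<lambda>i. e (Suc i)))" "df f"
  shows "PI n (\<lambda>e. Q (f e) e)"
proof -
  obtain b where b: "tf b" "\<forall>e. f e \<le> b e" and g: "D0 (\<lambda>e. e 0 = f (\<lambda>i. e (Suc i)))"
    using assms(2) by (auto simp: df_def)
  have "PI n (\<lambda>e. \<not> e 0 = f (\<lambda>i. e (Suc i)) \<or> Q (e 0) (\<lambda>i. e (Suc i)))"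
    by (rule PI_disj[OF D0_PI[OF D0_not[OF g]] assms(1)])
  then have "PI n (\<lambda>e. \<forall>u<Suc (b e). \<not> u = f e \<or> Q u e)"
    by (rule PI_ball[OF df_Suc[OF tf_df[OF b(1)]]])
  moreover have "(\<forall>u<Suc (b e). \<not> u = f e \<or> Q u e) = Q (f e) e" for e
    using b(2) by (auto simp: le_imp_less_Suc)
  ultimately show ?thesis by simp
qed

definition Orc :: "nat \<Rightarrow> nat \<Rightarrow> nat \<Rightarrow> bool" where
  "Orc n L s \<longleftrightarrow> (\<forall>q<L. V n q = beta s q)"

lemma run_V_iff: "run (V n) (pdec m) x = r \<longleftrightarrow> (\<exists>L s. Orc n L s \<and> Ev 0 L s m x r)"
proof
  assume r: "run (V n) (pdec m) x = r"
  obtain L where L: "\<forall>s. (\<forall>q<L. beta s q = V n q) \<longrightarrow> Ev 0 L s m x (run (V n) (pdec m) x)"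
    using Ev_0_complete by blast
  obtain s where "\<forall>q<L. beta s q = V n q" using beta_exists[of L "V n"] by (elim exE)
  with L r show "\<exists>L s. Orc n L s \<and> Ev 0 L s m x r"
    by (intro exI[of _ L] exI[of _ s]) (simp add: Orc_def)
next
  assume "\<exists>L s. Orc n L s \<and> Ev 0 L s m x r"
  then show "run (V n) (pdec m) x = r"
    unfolding Orc_def by (metis Ev_0_sound)
qed

lemma PI_Orc:
  assumes "PI n (\<lambda>e. V n (e 0) = e 1)" "df a" "df b"
  shows "PI n (\<lambda>e. Orc n (a e) (b e))"
proof -
  have "PI n (\<lambda>e. V n (e 0) = beta (b (\<lambda>i. e (Suc i))) (e 0))"
  proof (rule PI_subst[where Q = "\<lambda>u e. V n (e 0) = u"])
    show "PI n (\<lambda>e. V n (e (Suc 0)) = e 0)"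
      using PI_ren[OF assms(1), of "\<lambda>i. 1 - i"] by simp
  qed (intro df_beta df_var df_shift assms)
  then show ?thesis
    unfolding Orc_def by (intro PI_ball assms)
qed

text \<open>A computation from \<open>V n\<close> needs a segment of \<open>V n\<close>, a Pi_n
  condition, and a Sigma_1 evaluation; its graph is Sigma_(n+1), and by totality Delta_(n+1). The
  answer 0 then costs one universal quantifier, while an answer \<open>Suc u\<close> is checked by
  Delta_(n+1) conditions and bounded universal quantification.\<close>

lemma PI_V: "PI n (\<lambda>e. V n (e 0) = e 1)"
proof (induction n)
  case 0
  show ?case by (simp add: PI_0) (intro D0_eq df_var df_const)
next
  case (Suc n)
  have run: "SG (Suc n) (\<lambda>e. run (V n) (pdec (pf (a e))) (pp (b e) (ps (a e))) = c e)"
    if "df a" "df b" "df c" for a b c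
  proof -
    have Ev: "SG (Suc n) (\<lambda>e. Ev 0 (e 0) (e 1) (pf (a (\<lambda>i. e (Suc (Suc i)))))
        (pp (b (\<lambda>i. e (Suc (Suc i)))) (ps (a (\<lambda>i. e (Suc (Suc i)))))) (c (\<lambda>i. e (Suc (Suc i)))))"
      using that
      by (intro SG_mono[of 1 _ "Suc n"] SG1_Ev df_cf df_pp df_pf df_ps df_var df_const
          df_shift[OF df_shift]) simp_all
    have "SG (Suc n) (\<lambda>e. Orc n (e 0) (e 1))"
      by (intro PI_SG PI_Orc Suc.IH df_var)
    from SG_conj[OF this Ev] show ?thesis
      unfolding run_V_iff
      by (intro SG_ex, drule_tac SG_ren[where \<rho> = "\<lambda>i. if i = 0 then 1 else if i = 1 then 0 else i"])
        simp
  qed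
  define R0 where "R0 q w \<longleftrightarrow> run (V n) (pdec (pf q)) (pp w (ps q)) = 0" for q w
  have pos: "PI (Suc n) (\<lambda>e. \<not> R0 (a e) (b e))" if "df a" "df b" for a b
    unfolding R0_def by (intro PI_not run that df_const)
  have neg: "PI (Suc n) (\<lambda>e. R0 (a e) (b e))" if "df a" "df b" for a b
  proof -
    have "SG (Suc n) (\<lambda>e. \<exists>r. \<not> r = 0 \<and>
        run (V n) (pdec (pf (a e))) (pp (b e) (ps (a e))) = r)"
      by (rule SG_ex, rule SG_conj[OF D0_SG[OF D0_not[OF D0_eq[OF df_var df_const]]]
            run[OF df_shift[OF that(1)] df_shift[OF that(2)] df_var]])
    from PI_not[OF this] show ?thesis by (simp add: R0_def)
  qed
  have "V (Suc n) q = r \<longleftrightarrow> (\<not> r = 0 \<or> (\<forall>w. \<not> R0 q w)) \<and>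
      (\<forall>u<r. \<not> r = Suc u \<or> R0 q u \<and> (\<forall>w<u. \<not> R0 q w))" for q r
  proof (cases "\<exists>w. R0 q w")
    case True
    then have V: "V (Suc n) q = Suc (LEAST w. R0 q w)" by (simp add: R0_def V.simps(2))
    have L: "R0 q u \<and> (\<forall>w<u. \<not> R0 q w) \<longleftrightarrow> u = (LEAST w. R0 q w)" for u
      using True by (metis LeastI_ex not_less_Least linorder_neqE_nat)
    show ?thesis unfolding V L using True by (cases r) auto
  next
    case False
    then have V: "V (Suc n) q = 0" by (simp add: R0_def V.simps(2))
    show ?thesis unfolding V using False by (cases r) auto
  qed
  moreover have "PI (Suc n) (\<lambda>e. (\<not> e 1 = 0 \<or> (\<forall>w. \<not> R0 (e 0) w)) \<and>
      (\<forall>u<e 1. \<not> e 1 = Suc u \<or> R0 (e 0) u \<and> (\<forall>w<u. \<not> R0 (e 0) w)))"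
    by (intro PI_conj PI_disj PI_all PI_ball pos neg df_var D0_PI[OF D0_not[OF D0_eq]]
        df_Suc df_const)
  ultimately show ?case by simp
qed

section \<open>Truth and Skolem functions by programs\<close>

definition PF :: "(nat \<Rightarrow> nat) \<Rightarrow> (nat \<Rightarrow> nat) \<Rightarrow> bool" where
  "PF v f \<longleftrightarrow> (\<exists>p. \<forall>x. run v p x = f x)"

definition PB :: "(nat \<Rightarrow> nat) \<Rightarrow> (nat \<Rightarrow> bool) \<Rightarrow> bool" where
  "PB v P \<longleftrightarrow> (\<exists>p. \<forall>x. P x \<longleftrightarrow> run v p x = 0)"

lemma PF_comp: "PF v f \<Longrightarrow> PF v g \<Longrightarrow> PF v (\<lambda>x. f (g x))"
  unfolding PF_def by (elim exE, rule_tac x = "PComp p pa" in exI) simp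

lemma PF_pp: "PF v f \<Longrightarrow> PF v g \<Longrightarrow> PF v (\<lambda>x. pp (f x) (g x))"
  unfolding PF_def by (elim exE, rule_tac x = "PPair p pa" in exI) simp

lemma PF_const: "PF v (\<lambda>x. c)"
  unfolding PF_def by (rule exI[of _ "PConst c"]) simp

lemma PF_id: "PF v (\<lambda>x. x)"
  unfolding PF_def by (rule exI[of _ "PPair PFst PSnd"]) simp

lemma PF_prim:
  assumes "PF v f"
  shows PF_pf: "PF v (\<lambda>x. pf (f x))" and PF_ps: "PF v (\<lambda>x. ps (f x))"
    and PF_orc: "PF v (\<lambda>x. v (f x))"
proof -
  show "PF v (\<lambda>x. pf (f x))"
    by (rule PF_comp[where f = pf, OF _ assms]) (auto simp: PF_def intro: exI[of _ PFst])
  show "PF v (\<lambda>x. ps (f x))"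
    by (rule PF_comp[where f = ps, OF _ assms]) (auto simp: PF_def intro: exI[of _ PSnd])
  show "PF v (\<lambda>x. v (f x))"
    by (rule PF_comp[where f = v, OF _ assms]) (auto simp: PF_def intro: exI[of _ POrc])
qed

lemma PF_add: "PF v f \<Longrightarrow> PF v g \<Longrightarrow> PF v (\<lambda>x. f x + g x)"
  unfolding PF_def by (elim exE, rule_tac x = "PComp PAdd (PPair p pa)" in exI) simp

lemma PF_mult: "PF v f \<Longrightarrow> PF v g \<Longrightarrow> PF v (\<lambda>x. f x * g x)"
  unfolding PF_def by (elim exE, rule_tac x = "PComp PMul (PPair p pa)" in exI) simp

lemma PF_Suc: "PF v f \<Longrightarrow> PF v (\<lambda>x. Suc (f x))"
  using PF_add[OF _ PF_const[of v 1]] by simp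

lemma PF_bm:
  assumes "PF v b" "PB v (\<lambda>z. Q (pf z) (ps z))"
  shows "PF v (\<lambda>x. bm (b x) (\<lambda>u. Q u x))"
proof -
  obtain p q where "\<forall>x. run v p x = b x" "\<forall>z. Q (pf z) (ps z) \<longleftrightarrow> run v q z = 0"
    using assms by (auto simp: PF_def PB_def)
  moreover from this have "run v q (pp u y) = 0 \<longleftrightarrow> Q u y" for u y
    by (metis pair_simps(1,2))
  ultimately show ?thesis
    unfolding PF_def by (intro exI[of _ "PComp (PMin q) (PPair p (PPair PFst PSnd))"]) simp
qed

lemma PB_less: "PF v f \<Longrightarrow> PF v g \<Longrightarrow> PB v (\<lambda>x. f x < g x)"
  unfolding PF_def PB_def
  by (elim exE, rule_tac x = "PComp PLess (PPair p pa)" in exI) simp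

lemma PB_not: "PB v P \<Longrightarrow> PB v (\<lambda>x. \<not> P x)"
  unfolding PB_def
  by (elim exE, rule_tac x = "PComp PLess (PPair (PConst 0) p)" in exI) simp

lemma PB_conj: "PB v P \<Longrightarrow> PB v Q \<Longrightarrow> PB v (\<lambda>x. P x \<and> Q x)"
  unfolding PB_def
  by (elim exE, rule_tac x = "PComp PAdd (PPair p pa)" in exI) simp

lemma PB_disj: "PB v P \<Longrightarrow> PB v Q \<Longrightarrow> PB v (\<lambda>x. P x \<or> Q x)"
  unfolding PB_def
  by (elim exE, rule_tac x = "PComp PMul (PPair p pa)" in exI) simp

lemma PB_imp: "PB v P \<Longrightarrow> PB v Q \<Longrightarrow> PB v (\<lambda>x. P x \<longrightarrow> Q x)"
  unfolding imp_conv_disj by (intro PB_disj PB_not)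

lemma PB_eq: "PF v f \<Longrightarrow> PF v g \<Longrightarrow> PB v (\<lambda>x. f x = g x)"
  unfolding order.eq_iff not_less[symmetric] by (intro PB_conj PB_not PB_less)

lemma PB_bex:
  assumes "PF v b" "PB v (\<lambda>z. Q (pf z) (ps z))"
  shows "PB v (\<lambda>x. \<exists>u<b x. Q u x)"
  unfolding bm_less[symmetric] by (intro PB_less PF_bm assms)

lemma PB_comp: "PB v P \<Longrightarrow> PF v f \<Longrightarrow> PB v (\<lambda>x. P (f x))"
  unfolding PB_def PF_def by (elim exE, rule_tac x = "PComp p pa" in exI) simp

text \<open>Programs act on single numbers, so an assignment is read off one number as an iterated
  pair.\<close>

definition env :: "nat \<Rightarrow> nat \<Rightarrow> nat" where
  "env x i = pf ((ps ^^ i) x)"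

lemma env_pp [simp]: "env (pp u x) = u ## env x"
  by (rule ext, rename_tac i, case_tac i)
    (simp_all add: env_def funpow_Suc_right del: funpow.simps)

lemma env_ps: "env (ps x) = (\<lambda>i. env x (Suc i))"
  by (rule ext) (simp add: env_def funpow_Suc_right del: funpow.simps)

lemma PF_env: "PF v (\<lambda>x. env x i)"
proof -
  have "PF v (\<lambda>x. (ps ^^ i) x)"
    by (induction i) (simp_all add: PF_id PF_ps)
  then show ?thesis unfolding env_def by (rule PF_pf)
qed

lemma PF_tval: "PF v (\<lambda>x. tval (env x) t)"
  by (induction t) (simp_all add: PF_env PF_const PF_add PF_mult)

lemma PB_Delta0: "Delta0 p \<Longrightarrow> PB v (\<lambda>x. natsat (env x) p)"
proof (induction rule: Delta0.induct)
  case (7 p t)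
  have "PB v (\<lambda>x. \<not> (\<exists>u<tval (env x) t. \<not> natsat (env (pp u x)) p))"
    by (intro PB_not PB_bex PF_tval) (simp only: pair_simps(3), rule 7)
  then show ?case by simp
next
  case (8 p t)
  have "PB v (\<lambda>x. \<exists>u<tval (env x) t. natsat (env (pp u x)) p)"
    by (intro PB_bex PF_tval) (simp only: pair_simps(3), rule 8)
  then show ?case by simp
qed (simp_all add: PB_eq PB_less PF_tval PB_not PB_imp PB_conj PB_disj)

section \<open>Unbounded search, truth and Skolem functions through the jump\<close>

lemma PF_jump:
  assumes "PB (V n) (\<lambda>z. Q (pf z) (ps z))"
  shows "PF (V (Suc n)) (\<lambda>x. if \<exists>w. Q w x then Suc (LEAST w. Q w x) else 0)"
proof -
  obtain p where p: "\<forall>z. Q (pf z) (ps z) \<longleftrightarrow> run (V n) p z = 0"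
    using assms by (auto simp: PB_def)
  obtain m where m: "pdec m = p" using pdec_surj by blast
  have "run (V n) p (pp w x) = 0 \<longleftrightarrow> Q w x" for w x
    using p by (metis pair_simps(1,2))
  then have "V (Suc n) (pp m x) = (if \<exists>w. Q w x then Suc (LEAST w. Q w x) else 0)" for x
    by (simp add: m V.simps(2))
  moreover have "PF (V (Suc n)) (\<lambda>x. V (Suc n) (pp m x))"
    by (intro PF_orc PF_pp PF_const PF_id)
  ultimately show ?thesis by simp
qed

lemma PF_witness:
  assumes "PB (V n) (\<lambda>z. Q (pf z) (ps z))"
  shows "\<exists>g. PF (V (Suc n)) g \<and> (\<forall>x w. Q w x \<longrightarrow> Q (g x) x)"
proof -
  define f where "f x = (if \<exists>w. Q w x then Suc (LEAST w. Q w x) else 0)" for x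
  have f: "PF (V (Suc n)) f" unfolding f_def by (rule PF_jump[OF assms])
  \<comment> \<open>Programs have no subtraction; the predecessor of the oracle's answer is found by
    bounded search.\<close>
  have "PF (V (Suc n)) (\<lambda>x. bm (f x) (\<lambda>u. f x = Suc u))"
    by (intro PF_bm f PB_eq PF_Suc PF_comp[OF f] PF_pf PF_ps PF_id)
  moreover have "Q (bm (f x) (\<lambda>u. f x = Suc u)) x" if "Q w x" for x w
  proof -
    have fx: "f x = Suc (LEAST w. Q w x)" using that by (auto simp: f_def)
    have "f x = Suc (bm (f x) (\<lambda>u. f x = Suc u))"
      by (rule bm_sat[of "LEAST w. Q w x"]) (simp_all add: fx)
    with fx have "bm (f x) (\<lambda>u. f x = Suc u) = (LEAST w. Q w x)" by simp
    then show ?thesis using LeastI[of "\<lambda>w. Q w x" w] that by simp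
  qed
  ultimately show ?thesis by blast
qed

lemma PB_jump:
  assumes "PB (V n) (\<lambda>z. Q (pf z) (ps z))"
  shows "PB (V (Suc n)) (\<lambda>x. \<exists>w. Q w x)"
proof -
  have "PB (V (Suc n)) (\<lambda>x. 0 < (if \<exists>w. Q w x then Suc (LEAST w. Q w x) else 0))"
    by (intro PB_less PF_const PF_jump assms)
  then show ?thesis by (simp split: if_split_asm cong: if_cong)
qed

text \<open>Searching for the \<open>u\<close> with \<open>u = f x\<close> makes the next jump
  return the value of \<open>f\<close>.\<close>

lemma PF_V_Suc: "PF (V n) f \<Longrightarrow> PF (V (Suc n)) f"
proof -
  assume f: "PF (V n) f"
  have "PB (V n) (\<lambda>z. pf z = f (ps z))"
    by (intro PB_eq PF_comp[OF f] PF_pf PF_ps PF_id)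
  from PF_witness[OF this] obtain g where "PF (V (Suc n)) g" "\<forall>x. g x = f x"
    by blast
  then show ?thesis by (simp add: PF_def)
qed

lemma PF_V_mono: "m \<le> n \<Longrightarrow> PF (V m) f \<Longrightarrow> PF (V n) f"
  by (induction rule: dec_induct) (simp_all add: PF_V_Suc)

text \<open>The leading existential block collapses to a single witness by pairing. The decidability
  of kernels is a hypothesis because it is the induction hypothesis of \<open>PB_Sig_Pi\<close>,
  which uses this fact.\<close>

lemma Sig_witness:
  assumes "\<And>p. Pi n p \<Longrightarrow> PB (V n) (\<lambda>x. natsat (env x) p)" "Sig (Suc n) p"
  shows "\<exists>Q. PB (V n) (\<lambda>z. Q (pf z) (ps z)) \<and> (\<forall>x. natsat (env x) p \<longleftrightarrow> (\<exists>w. Q w x))"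
  using assms(2)
proof (induction rule: Sig_Suc_induct)
  case (base p)
  have "PB (V n) (\<lambda>z. natsat (env (ps z)) p)"
    by (rule PB_comp[OF assms(1)[OF base]]) (intro PF_ps PF_id)
  then show ?case by (intro exI[of _ "\<lambda>w x. natsat (env x) p"]) simp
next
  case (ex p)
  then obtain Q where Q: "PB (V n) (\<lambda>z. Q (pf z) (ps z))"
      "\<forall>x. natsat (env x) p \<longleftrightarrow> (\<exists>w. Q w x)"
    by blast
  have "PB (V n) (\<lambda>z. Q (pf (pp (pf (pf z)) (pp (ps (pf z)) (ps z)))) (ps (pp (pf (pf z)) (pp (ps (pf z)) (ps z)))))"
    by (rule PB_comp[OF Q(1)]) (intro PF_pf PF_ps PF_pp PF_id)
  moreover have "natsat (env x) (Ex p) \<longleftrightarrow> (\<exists>w. Q (pf w) (pp (ps w) x))" for x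
  proof -
    have "natsat (env x) (Ex p) \<longleftrightarrow> (\<exists>u w. Q w (pp u x))"
      using Q(2)[rule_format, of "pp _ x"] by simp
    then show ?thesis by (metis pair_simps(1,2))
  qed
  ultimately show ?case
    by (intro exI[of _ "\<lambda>w x. Q (pf w) (pp (ps w) x)"]) simp
qed

lemma Pi_witness:
  assumes "\<And>p. Sig n p \<Longrightarrow> PB (V n) (\<lambda>x. natsat (env x) p)" "Pi (Suc n) p"
  shows "\<exists>Q. PB (V n) (\<lambda>z. Q (pf z) (ps z)) \<and> (\<forall>x. \<not> natsat (env x) p \<longleftrightarrow> (\<exists>w. Q w x))"
  using assms(2)
proof (induction rule: Pi_Suc_induct)
  case (base p)
  have "PB (V n) (\<lambda>z. \<not> natsat (env (ps z)) p)"
    by (rule PB_not[OF PB_comp[OF assms(1)[OF base]]]) (intro PF_ps PF_id)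
  then show ?case by (intro exI[of _ "\<lambda>w x. \<not> natsat (env x) p"]) simp
next
  case (all p)
  then obtain Q where Q: "PB (V n) (\<lambda>z. Q (pf z) (ps z))"
      "\<forall>x. \<not> natsat (env x) p \<longleftrightarrow> (\<exists>w. Q w x)"
    by blast
  have "PB (V n) (\<lambda>z. Q (pf (pp (pf (pf z)) (pp (ps (pf z)) (ps z)))) (ps (pp (pf (pf z)) (pp (ps (pf z)) (ps z)))))"
    by (rule PB_comp[OF Q(1)]) (intro PF_pf PF_ps PF_pp PF_id)
  moreover have "\<not> natsat (env x) (All p) \<longleftrightarrow> (\<exists>w. Q (pf w) (pp (ps w) x))" for x
  proof -
    have "\<not> natsat (env x) (All p) \<longleftrightarrow> (\<exists>u w. Q w (pp u x))"
      using Q(2)[rule_format, of "pp _ x"] by simp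
    then show ?thesis by (metis pair_simps(1,2))
  qed
  ultimately show ?case
    by (intro exI[of _ "\<lambda>w x. Q (pf w) (pp (ps w) x)"]) simp
qed

lemma PB_Sig_Pi:
  "(Sig n p \<longrightarrow> PB (V n) (\<lambda>x. natsat (env x) p)) \<and> (Pi n p \<longrightarrow> PB (V n) (\<lambda>x. natsat (env x) p))"
proof (induction n arbitrary: p)
  case 0
  then show ?case by (auto intro: PB_Delta0 elim: Sig.cases Pi.cases)
next
  case (Suc n)
  have "PB (V (Suc n)) (\<lambda>x. natsat (env x) p)" if "Sig (Suc n) p"
    using Sig_witness[OF _ that] Suc.IH PB_jump by fastforce
  moreover have "PB (V (Suc n)) (\<lambda>x. natsat (env x) p)" if pi: "Pi (Suc n) p"
  proof -
    obtain Q where Q: "PB (V n) (\<lambda>z. Q (pf z) (ps z))" "\<forall>x. \<not> natsat (env x) p \<longleftrightarrow> (\<exists>w. Q w x)"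
      using Pi_witness[OF _ pi] Suc.IH by blast
    from PB_not[OF PB_jump[OF Q(1)]] show ?thesis
      by (simp add: Q(2)[rule_format, symmetric])
  qed
  ultimately show ?case by blast
qed

lemma skolem_Sig:
  assumes "Sig (Suc n) p"
  shows "\<exists>g. PF (V (Suc n)) g \<and> (\<forall>x u. natsat (u ## env x) p \<longrightarrow> natsat (g x ## env x) p)"
proof -
  obtain Q where Q: "PB (V n) (\<lambda>z. Q (pf z) (ps z))" "\<forall>x. natsat (env x) p \<longleftrightarrow> (\<exists>w. Q w x)"
    using Sig_witness[OF _ assms] PB_Sig_Pi by blast
  have "PB (V n) (\<lambda>z. Q (pf (pp (pf (pf z)) (pp (ps (pf z)) (ps z)))) (ps (pp (pf (pf z)) (pp (ps (pf z)) (ps z)))))"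
    by (rule PB_comp[OF Q(1)]) (intro PF_pf PF_ps PF_pp PF_id)
  then obtain g where g: "PF (V (Suc n)) g"
      "\<forall>x w. Q (pf w) (pp (ps w) x) \<longrightarrow> Q (pf (g x)) (pp (ps (g x)) x)"
    using PF_witness[of n "\<lambda>w x. Q (pf w) (pp (ps w) x)"] by auto
  \<comment> \<open>The searched number pairs a witness for the block inside \<open>p\<close> with a
    value for its variable 0; \<open>ps\<close> extracts the latter.\<close>
  have "natsat (ps (g x) ## env x) p" if nt: "natsat (u ## env x) p" for u x
  proof -
    obtain w where "Q w (pp u x)" using Q(2)[rule_format, of "pp u x"] nt by auto
    then have "Q (pf (g x)) (pp (ps (g x)) x)"
      using g(2)[rule_format, of "pp w u" x] by simp
    then show ?thesis using Q(2)[rule_format, of "pp (ps (g x)) x"] by auto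
  qed
  then show ?thesis using PF_ps[OF g(1)] by blast
qed

lemma skolem_Pi:
  assumes "Pi (Suc n) p"
  shows "\<exists>g. PF (V (Suc n)) g \<and> (\<forall>x u. \<not> natsat (u ## env x) p \<longrightarrow> \<not> natsat (g x ## env x) p)"
proof -
  obtain Q where Q: "PB (V n) (\<lambda>z. Q (pf z) (ps z))" "\<forall>x. \<not> natsat (env x) p \<longleftrightarrow> (\<exists>w. Q w x)"
    using Pi_witness[OF _ assms] PB_Sig_Pi by blast
  have "PB (V n) (\<lambda>z. Q (pf (pp (pf (pf z)) (pp (ps (pf z)) (ps z)))) (ps (pp (pf (pf z)) (pp (ps (pf z)) (ps z)))))"
    by (rule PB_comp[OF Q(1)]) (intro PF_pf PF_ps PF_pp PF_id)
  then obtain g where g: "PF (V (Suc n)) g"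
      "\<forall>x w. Q (pf w) (pp (ps w) x) \<longrightarrow> Q (pf (g x)) (pp (ps (g x)) x)"
    using PF_witness[of n "\<lambda>w x. Q (pf w) (pp (ps w) x)"] by auto
  have "\<not> natsat (ps (g x) ## env x) p" if nt: "\<not> natsat (u ## env x) p" for u x
  proof -
    obtain w where "Q w (pp u x)" using Q(2)[rule_format, of "pp u x"] nt by auto
    then have "Q (pf (g x)) (pp (ps (g x)) x)"
      using g(2)[rule_format, of "pp w u" x] by simp
    then show ?thesis using Q(2)[rule_format, of "pp (ps (g x)) x"] by auto
  qed
  then show ?thesis using PF_ps[OF g(1)] by blast
qed

section \<open>The states\<close>

lemma D0_comp2:
  assumes "D0 (\<lambda>e. R (e 0) (e 1))" "df f" "df g"
  shows "D0 (\<lambda>e. R (f e) (g e))"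
proof -
  have "D0 (\<lambda>e. R (f (\<lambda>i. e (Suc i))) (e 0))"
    by (rule df_subst[where Q = "\<lambda>u e. R u (e 0)", OF _ df_shift[OF assms(2)]])
      (use assms(1) in simp)
  then show ?thesis
    by (rule df_subst[where Q = "\<lambda>u e. R (f e) u", OF _ assms(3)])
qed

text \<open>A Sigma_1 graph is the projection of a Delta_0 relation. Pairing the value with its
  least witness removes the unbounded quantifier, since minimality is a bounded condition.\<close>

lemma cf_D0_graph:
  assumes "cf (\<lambda>e. G (e 0))"
  shows "\<exists>H. (\<forall>u. pf (H u) = G u) \<and> D0 (\<lambda>e. e 0 = H (e 1))"
proof -
  obtain Q where Q: "D0 Q" "\<And>e. e 0 = G (e 1) \<longleftrightarrow> (\<exists>w. Q (w ## e))"
    using SG1_normal_form[of "\<lambda>e. e 0 = G (e 1)"] assms by (auto simp: cf_def)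
  define Q' where "Q' w z u \<longleftrightarrow> Q (w ## z ## u ## (\<lambda>_. 0))" for w z u
  have ex: "z = G u \<longleftrightarrow> (\<exists>w. Q' w z u)" for z u
    using Q(2)[of "z ## u ## (\<lambda>_. 0)"] by (simp add: Q'_def)
  define H where "H u = pp (G u) (LEAST w. Q' w (G u) u)" for u
  have "z = H u \<longleftrightarrow> Q' (ps z) (pf z) u \<and> (\<forall>w<ps z. \<not> Q' w (pf z) u)" for z u
  proof
    assume z: "z = H u"
    define l where "l = (LEAST w. Q' w (G u) u)"
    have zl: "pf z = G u" "ps z = l" by (simp_all add: z H_def l_def)
    have "\<exists>w. Q' w (G u) u" using ex[of "G u" u] by simp
    then have "Q' l (G u) u" unfolding l_def by (rule LeastI_ex)
    moreover have "\<not> Q' w (G u) u" if "w < l" for w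
      using that unfolding l_def by (rule not_less_Least)
    ultimately show "Q' (ps z) (pf z) u \<and> (\<forall>w<ps z. \<not> Q' w (pf z) u)"
      unfolding zl by blast
  next
    assume *: "Q' (ps z) (pf z) u \<and> (\<forall>w<ps z. \<not> Q' w (pf z) u)"
    then have z: "pf z = G u" using ex[of "pf z" u] by auto
    have "(LEAST w. Q' w (G u) u) = ps z"
      by (rule Least_equality) (use * z in \<open>auto simp: not_less[symmetric]\<close>)
    then show "z = H u" using z pair_simps(3)[of z] by (simp add: H_def)
  qed
  moreover have "D0 (\<lambda>e. Q' (ps (e 0)) (pf (e 0)) (e 1) \<and> (\<forall>w<ps (e 0). \<not> Q' w (pf (e 0)) (e 1)))"
  proof -
    have *: "D0 (\<lambda>e. Q' (f e) (g e) (h e))" if "df f" "df g" "df h" for f g h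
    proof -
      \<comment> \<open>The predicate \<open>Q\<close> may mention any variable: all those from
        index 3 on are identified and then replaced by the constant 0, which leaves a relation in
        three arguments.\<close>
      have "(\<lambda>i. e (min i 3)) = e 0 ## e 1 ## e 2 ## (\<lambda>_. e 3)" for e :: "nat \<Rightarrow> nat"
        by (rule ext) (simp add: push_if min_def, simp add: numeral_eq_Suc less_Suc_eq_le le_Suc_eq)
      then have "D0 (\<lambda>e. Q (e 0 ## e 1 ## e 2 ## (\<lambda>_. e 3)))"
        using D0_ren[OF Q(1), of "\<lambda>i. min i 3"] by simp
      then have "D0 (\<lambda>e. Q (e 0 ## e 1 ## e 2 ## (\<lambda>_. 0)))"
        using df_subst[where Q = "\<lambda>u e. Q (e 0 ## e 1 ## e 2 ## (\<lambda>_. u))" and f = "\<lambda>e. 0", OF _ df_const]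
          D0_ren[of "\<lambda>e. Q (e 0 ## e 1 ## e 2 ## (\<lambda>_. e 3))" "\<lambda>i. if i < 3 then Suc i else 0"]
        by (simp add: numeral_3_eq_3 numeral_2_eq_2)
      then have 3: "D0 (\<lambda>e. Q' (e 0) (e 1) (e 2))" by (simp add: Q'_def)
      have "D0 (\<lambda>e. Q' (e 0) (e 1) (h (\<lambda>i. e (Suc (Suc i)))))"
        by (rule df_subst[where Q = "\<lambda>u e. Q' (e 0) (e 1) u", OF _ df_shift[OF df_shift[OF that(3)]]])
          (use D0_ren[OF 3, of "\<lambda>i. if i = 2 then 0 else Suc i"] in \<open>simp add: numeral_2_eq_2\<close>)
      then have "D0 (\<lambda>e. Q' (e 1) (e 0) (h (\<lambda>i. e (Suc (Suc i)))))"
        using D0_ren[of "\<lambda>e. Q' (e 0) (e 1) (h (\<lambda>i. e (Suc (Suc i))))"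
            "\<lambda>i. if i < 2 then 1 - i else i"] by simp
      then have "D0 (\<lambda>e. Q' (e 0) (g (\<lambda>i. e (Suc i))) (h (\<lambda>i. e (Suc i))))"
        by (intro df_subst[where Q = "\<lambda>u e. Q' (e 0) u (h (\<lambda>i. e (Suc i)))", OF _ df_shift[OF that(2)]]) simp
      then show ?thesis
        by (rule df_subst[where Q = "\<lambda>u e. Q' u (g e) (h e)", OF _ that(1)])
    qed
    show ?thesis
      by (intro D0_conj D0_ball D0_not * df_pf df_ps df_var)
  qed
  ultimately have "D0 (\<lambda>e. e 0 = H (e 1))" by simp
  then show ?thesis by (intro exI[of _ H]) (simp add: H_def)
qed

lemma pp_mono: "x \<le> x' \<Longrightarrow> y \<le> y' \<Longrightarrow> pp x y \<le> pp x' y'"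
proof -
  assume *: "x \<le> x'" "y \<le> y'"
  have "triangle m \<le> triangle n" if "m \<le> n" for m n
    by (rule lift_Suc_mono_le[of triangle, OF _ that]) simp
  from this[OF add_mono[OF *]] *(1) show "pp x y \<le> pp x' y'"
    unfolding pp_def prod_encode_def split_conv by (rule add_mono)
qed

text \<open>A state is \<open>pp (pp i j) (pp s (pp (pp \<alpha> (pp S t)) w))\<close>: \<open>i\<close> is the stage, \<open>j\<close> the input,
  \<open>s\<close> codes an initial segment of the oracle, \<open>\<alpha>\<close> codes the set of surviving generator tuples,
  \<open>S\<close> is the value guessed at the previous stage and \<open>t\<close> codes the sequence of earlier states.\<close>

definition hi :: "nat \<Rightarrow> nat" where "hi h = pf (pf h)"
definition hj :: "nat \<Rightarrow> nat" where "hj h = ps (pf h)"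
definition ho :: "nat \<Rightarrow> nat" where "ho h = pf (ps h)"
definition ha :: "nat \<Rightarrow> nat" where "ha h = pf (pf (ps (ps h)))"
definition hS :: "nat \<Rightarrow> nat" where "hS h = pf (ps (pf (ps (ps h))))"
definition ht :: "nat \<Rightarrow> nat" where "ht h = ps (ps (pf (ps (ps h))))"

text \<open>With s for the state, at most s^4 digits are bad, the guesses lose at most (2j+1)^j
  \<le> s^s, and the union over j digits adds a factor j+1 \<le> s. The product s^(s+5) is at most
  2^(s (s+5)).\<close>

definition rng :: "nat \<Rightarrow> nat" where "rng h = 2 ^ (h * (h + 5))"

definition cand :: "nat \<Rightarrow> nat set" where
  "cand h = {x. pf x \<in> set_decode (ha h) \<and> pf (ps x) = h \<and> ps (ps x) < rng h}"

text \<open>The stage number is read as \<open>pp (pp m d) l\<close>: run the program with code m on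
  the tuple cut down to its first l entries. The component d is padding, so each pair m, l recurs at
  arbitrarily late stages, where the oracle truncated at \<open>h\<close> is already long enough.
  Values from 2j on are merged into one, leaving 2j+1 classes.\<close>

definition val :: "nat \<Rightarrow> nat \<Rightarrow> nat \<Rightarrow> nat" where
  "val s h x = min (run (tot h s) (pdec (pf (pf (hi h)))) ((pf ^^ (Suc (hi h) - ps (hi h))) x)) (2 * hj h)"

definition popular :: "nat \<Rightarrow> nat \<Rightarrow> nat" where
  "popular s h = (LEAST c. card (cand h) \<le> card {x \<in> cand h. val s h x = c} * Suc (2 * hj h))"

definition survivors :: "nat \<Rightarrow> nat \<Rightarrow> nat set" where
  "survivors s h = {x \<in> cand h. val s h x = popular s h}"

text \<open>Appends \<open>h\<close> to the sequence stored in it. Every state thereby carries its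
  whole past, and the certificates for the injection become elements of \<open>K\<close>.\<close>

definition seqcode :: "nat \<Rightarrow> nat" where
  "seqcode h = (LEAST t. (\<forall>l<hi h. beta t l = beta (ht h) l) \<and> beta t (hi h) = h)"

lemma cand_bound: "x \<in> cand h \<Longrightarrow> x < Suc (pp (ha h) (pp h (rng h)))"
proof -
  assume "x \<in> cand h"
  then have "pf x \<le> ha h" "pf (ps x) \<le> h" "ps (ps x) \<le> rng h"
    by (auto simp: cand_def dest: set_decode_less)
  then have "pp (pf x) (pp (pf (ps x)) (ps (ps x))) \<le> pp (ha h) (pp h (rng h))"
    by (intro pp_mono)
  then show ?thesis by simp
qed

lemma finite_cand: "finite (cand h)"
  by (rule finite_subset[of _ "{..<Suc (pp (ha h) (pp h (rng h)))}"]) (use cand_bound in auto)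

text \<open>Pigeonhole: the 2j+1 classes exhaust the candidates, so they cannot all be smaller than
  average.\<close>

lemma popular_exists: "\<exists>c. card (cand h) \<le> card {x \<in> cand h. val s h x = c} * Suc (2 * hj h)"
proof (rule ccontr)
  let ?M = "Suc (2 * hj h)"
  assume "\<nexists>c. card (cand h) \<le> card {x \<in> cand h. val s h x = c} * ?M"
  then have less: "card {x \<in> cand h. val s h x = c} * ?M < card (cand h)" for c
    by (simp add: not_le)
  have "cand h = (\<Union>c<?M. {x \<in> cand h. val s h x = c})"
    by (auto simp: val_def)
  then have "card (cand h) \<le> (\<Sum>c<?M. card {x \<in> cand h. val s h x = c})"
    by (metis card_UN_le finite_lessThan)
  then have "card (cand h) * ?M \<le> (\<Sum>c<?M. card {x \<in> cand h. val s h x = c} * ?M)"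
    unfolding sum_distrib_right[symmetric] by (rule mult_le_mono1)
  also have "\<dots> < (\<Sum>c<?M. card (cand h))"
    by (rule sum_strict_mono) (use less in auto)
  finally show False by simp
qed

lemma card_survivors: "card (cand h) \<le> card (survivors s h) * Suc (2 * hj h)"
  unfolding survivors_def popular_def by (rule LeastI_ex[OF popular_exists])

lemma seqcode_props:
  "(\<forall>l<hi h. beta (seqcode h) l = beta (ht h) l) \<and> beta (seqcode h) (hi h) = h"
proof -
  obtain t where "\<forall>l<Suc (hi h). beta t l = (if l = hi h then h else beta (ht h) l)"
    using beta_exists[of "Suc (hi h)" "\<lambda>l. if l = hi h then h else beta (ht h) l"] by (elim exE)
  then have "(\<forall>l<hi h. beta t l = beta (ht h) l) \<and> beta t (hi h) = h" by simp
  then show ?thesis unfolding seqcode_def by (rule LeastI)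
qed

lemma cf_h: "cf f \<Longrightarrow> cf (\<lambda>e. hi (f e))" "cf f \<Longrightarrow> cf (\<lambda>e. hj (f e))" "cf f \<Longrightarrow> cf (\<lambda>e. ha (f e))"
  "cf f \<Longrightarrow> cf (\<lambda>e. ht (f e))"
  unfolding hi_def hj_def ha_def ht_def by (intro cf_pf cf_ps, assumption)+

lemma cf_rng: "cf f \<Longrightarrow> cf (\<lambda>e. rng (f e))"
  unfolding rng_def by (intro cf_pow2 cf_mult cf_add cf_const)

text \<open>The part of the next state that is recursive in the state \<open>pf u\<close> and the
  oracle segment \<open>ps u\<close>; all dependence on \<open>V n\<close> is confined to the
  segment.\<close>

definition stuff :: "nat \<Rightarrow> nat" where
  "stuff u = pp (set_encode (survivors (ps u) (pf u))) (pp (popular (ps u) (pf u)) (seqcode (pf u)))"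

lemma cf_stuff: "cf (\<lambda>e. stuff (e 0))"
proof -
  have cand: "cf (\<lambda>e. set_encode (cand (pf (e k))))" for k
  proof -
    have d: "dec (\<lambda>e. pf (e 0) \<in> set_decode (ha (pf (e (Suc k)))) \<and> pf (ps (e 0)) = pf (e (Suc k)) \<and>
        ps (ps (e 0)) < rng (pf (e (Suc k))))"
      by (intro dec_conj dec_mem dec_eq dec_less cf_h cf_rng cf_pf cf_ps cf_var)
    have b: "cf (\<lambda>e. Suc (pp (ha (pf (e k))) (pp (pf (e k)) (rng (pf (e k))))))"
      by (intro cf_Suc cf_pp cf_h cf_rng cf_pf cf_ps cf_var)
    show ?thesis
      unfolding cand_def by (rule cf_set_encode[OF b d]) (rule cand_bound, simp add: cand_def)
  qed
  have val: "cf (\<lambda>e. val (ps (e k)) (pf (e k)) (e l))" for k l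
    unfolding val_def
    by (intro cf_min cf_run cf_pf cf_ps cf_h cf_var cf_pf_funpow cf_diff cf_Suc cf_mult cf_const)
  have pop: "cf (\<lambda>e. popular (ps (e k)) (pf (e k)))" for k
  proof -
    have card: "card {x \<in> cand h. Q x} = card {x \<in> set_decode (set_encode (cand h)). Q x}" for h Q
      by (simp add: set_encode_inverse finite_cand)
    have card': "card (cand h) = card {x \<in> set_decode (set_encode (cand h)). True}" for h
      by (simp add: set_encode_inverse finite_cand)
    have "dec (\<lambda>e. card (cand (pf (e (Suc k)))) \<le>
        card {x \<in> cand (pf (e (Suc k))). val (ps (e (Suc k))) (pf (e (Suc k))) x = e 0}
          * Suc (2 * hj (pf (e (Suc k)))))"
      unfolding card card'
      by (intro dec_le cf_mult cf_card cand dec_const dec_eq val cf_var cf_Suc cf_const cf_h cf_pf)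
    then show ?thesis
      unfolding popular_def by (intro cf_Least popular_exists)
  qed
  have sur: "cf (\<lambda>e. set_encode (survivors (ps (e 0)) (pf (e 0))))"
  proof -
    have "dec (\<lambda>e. e 0 \<in> set_decode (set_encode (cand (pf (e (Suc 0))))) \<and>
        val (ps (e (Suc 0))) (pf (e (Suc 0))) (e 0) = popular (ps (e (Suc 0))) (pf (e (Suc 0))))"
      by (intro dec_conj dec_mem dec_eq val pop cand cf_var)
    then have d: "dec (\<lambda>e. e 0 \<in> cand (pf (e (Suc 0))) \<and>
        val (ps (e (Suc 0))) (pf (e (Suc 0))) (e 0) = popular (ps (e (Suc 0))) (pf (e (Suc 0))))"
      by (simp add: set_encode_inverse finite_cand)
    have b: "cf (\<lambda>e. Suc (pp (ha (pf (e 0))) (pp (pf (e 0)) (rng (pf (e 0))))))"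
      by (intro cf_Suc cf_pp cf_h cf_rng cf_pf cf_ps cf_var)
    show ?thesis
      unfolding survivors_def by (rule cf_set_encode[OF b d]) (use cand_bound in auto)
  qed
  have seq: "cf (\<lambda>e. seqcode (pf (e 0)))"
    unfolding seqcode_def
  proof (rule cf_Least)
    show "\<exists>t. (\<forall>l<hi (pf (e 0)). beta t l = beta (ht (pf (e 0))) l) \<and>
        beta t (hi (pf (e 0))) = pf (e 0)" for e :: "nat \<Rightarrow> nat"
      using seqcode_props by blast
  qed (intro dec_conj dec_ball dec_eq cf_beta cf_h cf_pf cf_var)
  show ?thesis
    unfolding stuff_def by (intro cf_pp sur pop seq)
qed

text \<open>The second component of \<open>wit u\<close> certifies the computation of \<open>stuff u\<close>; it makes the graph
  \<open>\<Delta>\<^sub>0\<close>.\<close>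

definition wit :: "nat \<Rightarrow> nat" where
  "wit = (SOME H. (\<forall>u. pf (H u) = stuff u) \<and> D0 (\<lambda>e. e 0 = H (e 1)))"

lemma wit: "pf (wit u) = stuff u" "D0 (\<lambda>e. e 0 = wit (e 1))"
  using someI_ex[OF cf_D0_graph[OF cf_stuff]] by (simp_all add: wit_def)

section \<open>The transition between states and its complexity\<close>

definition osc :: "nat \<Rightarrow> nat \<Rightarrow> nat" where
  "osc n h = (LEAST s. \<forall>q<h. V n q = beta s q)"

lemma osc: "q < h \<Longrightarrow> beta (osc n h) q = V n q"
proof -
  obtain s where "\<forall>q<h. beta s q = V n q" using beta_exists[of h "V n"] by (elim exE)
  then have "\<forall>q<h. V n q = beta s q" by simp
  then have "\<forall>q<h. V n q = beta (osc n h) q" unfolding osc_def by (rule LeastI)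
  then show "q < h \<Longrightarrow> beta (osc n h) q = V n q" by simp
qed

text \<open>The 1 codes the set containing only 0, the empty tuple. The entry j + 20 sits in the
  oracle slot merely to make all states at least 2j + 20, as the estimates need.\<close>

definition init :: "nat \<Rightarrow> nat" where
  "init j = pp (pp 0 j) (pp (j + 20) (pp (pp 1 (pp 0 0)) 0))"

definition nxt :: "nat \<Rightarrow> nat \<Rightarrow> nat" where
  "nxt n h = pp (pp (Suc (hi h)) (hj h)) (pp (osc n h) (wit (pp h (osc n h))))"

text \<open>Minimality of the segment is expressed by comparing it with smaller codes, without
  mention of \<open>V n\<close>, so it is Delta_0. The oracle occurs in one bounded universal clause
  only, which keeps the graph Pi_n.\<close>

lemma nxt_iff: "h' = nxt n h \<longleftrightarrow> pf h' = pp (Suc (hi h)) (hj h) \<and> ps (ps h') = wit (pp h (ho h')) \<and>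
   (\<forall>s<ho h'. \<exists>q<h. \<not> beta s q = beta (ho h') q) \<and> (\<forall>q<h. V n q = beta (ho h') q)"
  (is "_ \<longleftrightarrow> ?R")
proof
  assume h': "h' = nxt n h"
  have "\<exists>q<h. beta s q \<noteq> beta (osc n h) q" if "s < osc n h" for s
    using not_less_Least[OF that[unfolded osc_def]] osc by metis
  then show ?R by (auto simp: h' nxt_def ho_def osc)
next
  assume R: ?R
  have "osc n h = ho h'"
    unfolding osc_def
  proof (rule Least_equality)
    fix s assume "\<forall>q<h. V n q = beta s q"
    then show "ho h' \<le> s" using R by (metis not_less)
  qed (use R in simp)
  then show "h' = nxt n h"
    using R pair_simps(3)[of h'] pair_simps(3)[of "ps h'"] by (simp add: nxt_def ho_def)
qed

lemma PI_nxt: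
  assumes "df f" "df g"
  shows "PI n (\<lambda>e. g e = nxt n (f e))"
proof -
  have w: "D0 (\<lambda>e. a e = wit (b e))" if "df a" "df b" for a b
    by (rule D0_comp2[OF wit(2) that])
  have V: "PI n (\<lambda>e. \<forall>q<f e. V n q = beta (pf (ps (g e))) q)"
    using PI_Orc[OF PI_V assms(1) df_pf[OF df_ps[OF assms(2)]], of n] by (simp add: Orc_def)
  have "D0 (\<lambda>e. \<forall>s<pf (ps (g e)). \<exists>q<f e. \<not> beta s q = beta (pf (ps (g e))) q)"
    by (intro D0_ball D0_bex D0_not D0_eq df_beta df_pf df_ps df_var assms
        df_shift[OF assms(1)] df_shift[OF df_shift[OF assms(2)]])
  then show ?thesis
    unfolding nxt_iff ho_def hi_def hj_def
    by (intro PI_conj V D0_PI[OF D0_eq] D0_PI[OF w] df_pp df_pf df_ps df_Suc assms) (rule D0_PI)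
qed

primrec st :: "nat \<Rightarrow> nat \<Rightarrow> nat \<Rightarrow> nat" where
  "st n j 0 = init j"
| "st n j (Suc i) = nxt n (st n j i)"

definition guess :: "nat \<Rightarrow> nat \<Rightarrow> nat \<Rightarrow> nat" where
  "guess n j i = hS (st n j (Suc i))"

lemma st_hi [simp]: "hi (st n j i) = i" and st_hj [simp]: "hj (st n j i) = j"
  by (induction i) (simp_all add: init_def nxt_def hi_def hj_def)

lemma st_Suc:
  "ha (st n j (Suc i)) = set_encode (survivors (osc n (st n j i)) (st n j i))"
  "guess n j i = popular (osc n (st n j i)) (st n j i)"
  "ht (st n j (Suc i)) = seqcode (st n j i)"
  "ho (st n j (Suc i)) = osc n (st n j i)"
  by (simp_all add: nxt_def ha_def guess_def hS_def ht_def ho_def wit stuff_def)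

lemma beta_ht: "l \<le> i \<Longrightarrow> beta (ht (st n j (Suc i))) l = st n j l"
proof (induction i)
  case 0
  show ?case using seqcode_props[of "st n j 0"] 0 by (simp only: st_Suc st_hi) simp
next
  case (Suc i)
  then show ?case
    using seqcode_props[of "st n j (Suc i)"] unfolding st_Suc(3)[of n j "Suc i"] st_hi
    by (metis le_Suc_eq less_Suc_eq_le)
qed

text \<open>Variables 0 to 3 are the sequence of states, the number x, the stage y and the index j.
  Quantifying variable 0 away leaves the graph of the map from x to the least stage guessing x, with
  j as parameter and the argument order of \<open>wphp\<close>.\<close>

definition history :: "nat \<Rightarrow> (nat \<Rightarrow> nat) \<Rightarrow> bool" where
  "history n e \<longleftrightarrow> beta (e 0) 0 = init (e 3) \<and>
     (\<forall>l<Suc (e 2). beta (e 0) (Suc l) = nxt n (beta (e 0) l)) \<and>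
     hS (beta (e 0) (Suc (e 2))) = e 1 \<and> (\<forall>l<e 2. \<not> hS (beta (e 0) (Suc l)) = e 1)"

lemma PI_history: "PI n (history n)"
proof -
  have "PI n (\<lambda>e. history n e)"
    unfolding history_def init_def hS_def
    by (intro PI_conj PI_ball PI_nxt D0_PI[OF D0_eq] D0_PI[OF D0_not[OF D0_eq]]
        df_beta df_pp df_pf df_ps df_add df_Suc df_var df_const)
  then show ?thesis by simp
qed

lemma history_guess:
  assumes "history n e"
  shows "guess n (e 3) (e 2) = e 1" "l < e 2 \<Longrightarrow> guess n (e 3) l \<noteq> e 1"
proof -
  have st: "l \<le> Suc (e 2) \<Longrightarrow> beta (e 0) l = st n (e 3) l" for l
    by (induction l) (use assms in \<open>auto simp: history_def\<close>)
  show "guess n (e 3) (e 2) = e 1" "l < e 2 \<Longrightarrow> guess n (e 3) l \<noteq> e 1"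
    using assms st[of "Suc (e 2)"] st[of "Suc l"] by (auto simp: history_def guess_def simp del: st.simps)
qed

text \<open>The guess of stage y is recorded in state y + 1, so the sequence must reach that state,
  and it is state y + 2 that stores it.\<close>

lemma history_exists:
  assumes "guess n j y = x" "\<And>l. l < y \<Longrightarrow> guess n j l \<noteq> x"
  shows "history n (ht (st n j (Suc (Suc y))) ## x ## y ## j ## e)"
proof -
  have "beta (ht (st n j (Suc (Suc y)))) l = st n j l" if "l \<le> Suc y" for l
    using that by (rule beta_ht)
  then show ?thesis
    using assms by (simp add: history_def guess_def numeral_2_eq_2 numeral_3_eq_3)
qed

section \<open>Counting generator tuples\<close>

abbreviation live :: "nat \<Rightarrow> nat \<Rightarrow> nat \<Rightarrow> nat set" where
  "live n j i \<equiv> set_decode (ha (st n j i))"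

definition extend :: "nat set \<Rightarrow> nat \<Rightarrow> nat set \<Rightarrow> nat set" where
  "extend X h Y = {x. pf x \<in> X \<and> pf (ps x) = h \<and> ps (ps x) \<in> Y}"

lemma extend_image: "extend X h Y = (\<lambda>(g, y). pp g (pp h y)) ` (X \<times> Y)"
proof
  show "extend X h Y \<subseteq> (\<lambda>(g, y). pp g (pp h y)) ` (X \<times> Y)"
  proof
    fix x assume "x \<in> extend X h Y"
    then have "(pf x, ps (ps x)) \<in> X \<times> Y" "x = (case (pf x, ps (ps x)) of (g, y) \<Rightarrow> pp g (pp h y))"
      by (auto simp: extend_def)
    then show "x \<in> (\<lambda>(g, y). pp g (pp h y)) ` (X \<times> Y)" by (rule rev_image_eqI)
  qed
qed (auto simp: extend_def)

lemma card_extend: "card (extend X h Y) = card X * card Y"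
proof -
  have "inj_on (\<lambda>(g, y). pp g (pp h y)) (X \<times> Y)" by (auto simp: inj_on_def)
  then show ?thesis by (simp add: extend_image card_image card_cartesian_product)
qed

lemma finite_extend: "finite X \<Longrightarrow> finite Y \<Longrightarrow> finite (extend X h Y)"
  by (simp add: extend_image)

lemma cand_extend: "cand h = extend (set_decode (ha h)) h {..<rng h}"
  by (simp add: cand_def extend_def)

lemma live_0: "live n j 0 = {0}"
proof -
  have "set_decode (set_encode {0}) = {0}" by (rule set_encode_inverse) simp
  then show ?thesis by (simp add: ha_def init_def set_encode_def)
qed

lemma live_Suc: "live n j (Suc i) = survivors (osc n (st n j i)) (st n j i)"
  unfolding st_Suc(1) by (rule set_encode_inverse) (simp add: survivors_def finite_cand)

lemma live_cand: "live n j (Suc i) \<subseteq> cand (st n j i)"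
  unfolding live_Suc by (auto simp: survivors_def)

lemma finite_live: "finite (live n j i)"
  by (rule finite_subset[of _ "{..<ha (st n j i)}"]) (auto dest: set_decode_less)

lemma card_live:
  "card (live n j i) * rng (st n j i) \<le> card (live n j (Suc i)) * Suc (2 * j)"
  using card_survivors[of "st n j i" "osc n (st n j i)"]
  by (simp only: live_Suc cand_extend card_extend card_lessThan st_hj)

lemma rng_pos: "0 < rng h"
  by (simp add: rng_def)

lemma live_nonempty: "live n j i \<noteq> {}"
proof (induction i)
  case 0
  show ?case by (simp only: live_0) simp
next
  case (Suc i)
  then have "0 < card (live n j i) * rng (st n j i)"
    using finite_live by (simp add: card_gt_0_iff rng_pos)
  with card_live[of n j i] have "card (live n j (Suc i)) \<noteq> 0" by (intro notI) simp
  then show ?case by (metis card.empty)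
qed

subsection \<open>Growth of the states\<close>

lemma ha_le: "ha h \<le> ps h" and ho_le: "ho h \<le> ps h" and ht_le: "ht h \<le> ps h"
  unfolding ha_def ho_def ht_def
  by (meson order_trans pf_le ps_le)+

lemma live_less: "x \<in> live n j i \<Longrightarrow> x < st n j i"
  using set_decode_less ha_le ps_le by (meson order_trans order_less_le_trans)

lemma ps_st_less: "ps (st n j (Suc i)) < st n j (Suc i)"
proof (rule ps_less)
  have "Suc i \<le> pf (st n j (Suc i))" using pf_le[of "pf (st n j (Suc i))"] st_hi[of n j "Suc i"]
    by (simp add: hi_def del: st.simps)
  then show "pf (st n j (Suc i)) \<noteq> 0" by (simp del: st.simps)
qed

text \<open>A survivor has the old state as a component, so it is no smaller than that state, and
  the code of the survivor set inside the new state contains 2 to its power.\<close>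

lemma st_exp: "2 ^ st n j i < st n j (Suc i)"
proof -
  obtain x where x: "x \<in> live n j (Suc i)" using live_nonempty by blast
  then have "st n j i \<le> x"
    using live_cand[of n j i] pf_le[of "ps x"] ps_le[of x] by (auto simp: cand_def)
  then have "(2::nat) ^ st n j i \<le> 2 ^ x" by simp
  also have "\<dots> \<le> set_encode (live n j (Suc i))"
    unfolding set_encode_def using member_le_sum[OF x, of "\<lambda>x. 2 ^ x :: nat"] finite_live by simp
  also have "\<dots> \<le> ps (st n j (Suc i))"
    using ha_le by (simp only: set_decode_inverse)
  finally show ?thesis using ps_st_less le_less_trans by blast
qed

lemma st_less_Suc: "st n j i < st n j (Suc i)"
  using st_exp[of n j i] less_exp[of "st n j i"] by linarith

lemma st_mono: "i \<le> k \<Longrightarrow> st n j i \<le> st n j k"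
  by (rule lift_Suc_mono_le) (use st_less_Suc less_imp_le in blast)

lemma st_ge: "2 * j + 20 \<le> st n j i"
proof -
  have "2 * j + 20 \<le> init j"
    unfolding init_def
    using add_le_pp[of "pp 0 j" "pp (j + 20) (pp (pp 1 (pp 0 0)) 0)"] le_pp(2)[where x = 0 and y = j]
      le_pp(1)[of "j + 20" "pp (pp 1 (pp 0 0)) 0"] by linarith
  then show ?thesis using st_mono[of 0 i n j] by simp
qed

lemma le_st: "i \<le> st n j i"
  by (induction i) (simp, metis Suc_leI le_less_trans st_less_Suc)

text \<open>The answers below a state are beta values of a code stored in the next state, hence
  below that state.\<close>

lemma V_less: "q < st n j i \<Longrightarrow> V n q < st n j (Suc i)"
proof -
  assume "q < st n j i"
  then have "V n q = beta (ho (st n j (Suc i))) q"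
    unfolding st_Suc(4) by (simp only: osc)
  also have "\<dots> \<le> ps (st n j (Suc i))"
    using beta_le ho_le order_trans by blast
  finally show ?thesis using ps_st_less le_less_trans by blast
qed

text \<open>The left side is the bound from \<open>pp_less\<close> for two arguments below s, so
  pairing climbs at most one state.\<close>

lemma square_le_exp: "20 \<le> s \<Longrightarrow> 8 * s * s \<le> 2 ^ s"
proof (induction s rule: dec_induct)
  case (step s)
  have "8 * Suc s * Suc s = 8 * s * s + (16 * s + 8)" by (simp add: algebra_simps)
  also have "\<dots> \<le> 8 * s * s + 8 * s * s" 
  proof -
    have "20 * s \<le> s * s" using step(1) by (rule mult_le_mono1)
    then have "16 * s + 8 \<le> 8 * (s * s)" using step(1) by linarith
    then show ?thesis by (simp add: mult.assoc)
  qed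
  also have "\<dots> \<le> 2 ^ Suc s" using step by simp
  finally show ?case .
qed simp

lemma pp_st_less: "x < st n j i \<Longrightarrow> y < st n j i \<Longrightarrow> pp x y < st n j (Suc i)"
proof -
  assume "x < st n j i" "y < st n j i"
  then have "pp x y < 2 * (2 * st n j i) * (2 * st n j i)" by (intro pp_less) simp
  also have "\<dots> = 8 * st n j i * st n j i" by simp
  also have "\<dots> \<le> 2 ^ st n j i" by (rule square_le_exp) (use st_ge[of j n i] in simp)
  finally show ?thesis using st_exp[of n j i] by simp
qed

lemma mult_st_less: "x < st n j i \<Longrightarrow> y < st n j i \<Longrightarrow> x * y < st n j (Suc i)"
proof -
  assume "x < st n j i" "y < st n j i"
  then have "x * y \<le> st n j i * st n j i" by (intro mult_le_mono) simp_all
  also have "\<dots> \<le> 8 * st n j i * st n j i" by simp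
  also have "\<dots> \<le> 2 ^ st n j i" by (rule square_le_exp) (use st_ge[of j n i] in simp)
  finally show ?thesis using st_exp[of n j i] by simp
qed

text \<open>Both claims are proved together: intermediate values stay below states a bounded number
  of steps later, and therefore every query falls into the segment used at later stages. The shift
  depends on the program alone, uniformly in j.\<close>

lemma run_bound:
  "\<exists>c. \<forall>j a x. x < st n j a \<longrightarrow> run (V n) p x < st n j (a + c) \<and>
     (\<forall>i\<ge>a + c. run (tot (st n j i) (osc n (st n j i))) p x = run (V n) p x)"
  (is "\<exists>c. ?P c p")
proof (induction p)
  case (PConst k)
  have "k < st n j (a + Suc k)" for j a
    using le_st[of "a + k" n j] st_less_Suc[of n j "a + k"] by simp
  then show ?case by (intro exI[of _ "Suc k"]) (simp del: st.simps)
next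
  case (PPair p q)
  then obtain c d where c: "?P c p" and d: "?P d q" by blast
  have "?P (c + d + 1) (PPair p q)"
  proof (intro allI impI conjI)
    fix j a x assume x: "x < st n j a"
    have "run (V n) p x < st n j (a + (c + d))" "run (V n) q x < st n j (a + (c + d))"
      using c[rule_format, OF x] d[rule_format, OF x] st_mono[of "a + c" "a + (c + d)" n j]
        st_mono[of "a + d" "a + (c + d)" n j] by auto
    then show "run (V n) (PPair p q) x < st n j (a + (c + d + 1))"
      using pp_st_less by simp
    fix i assume "a + (c + d + 1) \<le> i"
    then show "run (tot (st n j i) (osc n (st n j i))) (PPair p q) x = run (V n) (PPair p q) x"
      using c[rule_format, OF x] d[rule_format, OF x] by simp
  qed
  then show ?case by (rule exI[of _ "c + d + 1"])
next
  case (PComp p q)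
  then obtain c d where c: "?P c p" and d: "?P d q" by blast
  have "?P (d + c) (PComp p q)"
  proof (intro allI impI)
    fix j a x assume x: "x < st n j a"
    note y = d[rule_format, OF x]
    show "run (V n) (PComp p q) x < st n j (a + (d + c)) \<and>
      (\<forall>i\<ge>a + (d + c). run (tot (st n j i) (osc n (st n j i))) (PComp p q) x = run (V n) (PComp p q) x)"
      using c[rule_format, OF conjunct1[OF y]] conjunct2[OF y] by (simp add: add.assoc)
  qed
  then show ?case by (rule exI[of _ "d + c"])
next
  case (PMin p)
  then obtain c where c: "?P c p" by blast
  have "?P (Suc c) (PMin p)"
  proof (intro allI impI conjI)
    fix j a x assume x: "x < st n j a"
    have "run (V n) (PMin p) x \<le> x" 
      unfolding run.simps by (rule order_trans[OF bm_le pf_le])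
    then show "run (V n) (PMin p) x < st n j (a + Suc c)"
      using x st_mono[of a "a + Suc c" n j] by linarith
    fix i assume i: "a + Suc c \<le> i"
    have "run (tot (st n j i) (osc n (st n j i))) p (pp u (ps x)) = run (V n) p (pp u (ps x))"
      if "u < pf x" for u
    proof -
      \<comment> \<open>The search feeds pairs to the inner program, which may lie one state higher;
        this is the extra 1 in \<open>Suc c\<close>.\<close>
      have "pp u (ps x) < st n j (Suc a)"
        using that x pf_le[of x] ps_le[of x] by (intro pp_st_less) linarith+
      from c[rule_format, OF this] i show ?thesis by simp
    qed
    then show "run (tot (st n j i) (osc n (st n j i))) (PMin p) x = run (V n) (PMin p) x"
      by (auto intro!: bm_cong)
  qed
  then show ?case by (rule exI[of _ "Suc c"])
next
  case PFst
  show ?case by (rule exI[of _ 0]) (auto intro: le_less_trans[OF pf_le])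
next
  case PSnd
  show ?case by (rule exI[of _ 0]) (auto intro: le_less_trans[OF ps_le])
next
  case PAdd
  have "pf x + ps x \<le> x" for x using add_le_pp[of "pf x" "ps x"] by simp
  then show ?case by (intro exI[of _ 0]) (auto intro: le_less_trans)
next
  case PMul
  have "pf x * ps x < st n j (Suc a)" if "x < st n j a" for j a x
    using that pf_le[of x] ps_le[of x] by (intro mult_st_less) linarith+
  then show ?case by (intro exI[of _ 1]) auto
next
  case PLess
  have "1 < st n j a" for j a using st_ge[of j n a] by simp
  then show ?case by (intro exI[of _ 0]) (auto intro: less_trans[OF zero_less_one])
next
  case POrc
  have "tot (st n j i) (osc n (st n j i)) x = V n x" if "x < st n j a" "a \<le> i" for j i a x
    using that st_mono[OF that(2), of n j] by (simp add: tot_def osc)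
  then show ?case by (intro exI[of _ 1]) (auto intro: V_less simp del: st.simps(2))
qed

subsection \<open>Generic tuples\<close>

text \<open>The tuples before any guess is imposed. Their digits are independent, so densities can
  be computed here and then compared with that of the live tuples.\<close>

primrec full :: "nat \<Rightarrow> nat \<Rightarrow> nat \<Rightarrow> nat set" where
  "full n j 0 = {0}"
| "full n j (Suc i) = extend (full n j i) (st n j i) {..<rng (st n j i)}"

lemma finite_full: "finite (full n j i)"
  by (induction i) (simp_all add: finite_extend)

lemma live_full: "live n j i \<subseteq> full n j i"
proof (induction i)
  case 0
  show ?case by (simp only: live_0 full.simps order_refl)
next
  case (Suc i)
  have "extend (live n j i) (st n j i) {..<rng (st n j i)} \<subseteq> full n j (Suc i)"
    using Suc by (auto simp: extend_def)
  then show ?case using live_cand[of n j i] unfolding cand_extend by blast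
qed

lemma card_full_le: "card (full n j i) \<le> card (live n j i) * Suc (2 * j) ^ i"
proof (induction i)
  case 0
  show ?case using live_0[of n j] by simp
next
  case (Suc i)
  have "card (full n j (Suc i)) = card (full n j i) * rng (st n j i)"
    by (simp add: card_extend)
  also have "\<dots> \<le> card (live n j i) * rng (st n j i) * Suc (2 * j) ^ i"
    using mult_le_mono1[OF Suc, of "rng (st n j i)"] by (simp only: mult_ac)
  also have "\<dots> \<le> card (live n j (Suc i)) * Suc (2 * j) * Suc (2 * j) ^ i"
    by (rule mult_le_mono1[OF card_live])
  finally show ?case by (simp only: power_Suc mult_ac)
qed

definition digit :: "nat \<Rightarrow> nat \<Rightarrow> nat \<Rightarrow> nat" where
  "digit k i g = ps (ps ((pf ^^ (k - Suc i)) g))"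

text \<open>When digit i is added, \<open>b\<close> leaves at most \<open>card b\<close> of the
  \<open>rng\<close> choices; each later digit multiplies both sides by the same factor.\<close>

lemma card_digit:
  assumes "finite b" "i < k"
  shows "card {g \<in> full n j k. digit k i g \<in> b} * rng (st n j i) \<le> card b * card (full n j k)"
proof -
  have "Suc i \<le> k" using assms(2) by simp
  then show ?thesis
  proof (induction k rule: dec_induct)
    case base
    have "{g \<in> full n j (Suc i). digit (Suc i) i g \<in> b} \<subseteq> extend (full n j i) (st n j i) b"
      by (auto simp: extend_def digit_def)
    then have "card {g \<in> full n j (Suc i). digit (Suc i) i g \<in> b} \<le> card (full n j i) * card b"
      using card_mono[OF finite_extend[OF finite_full assms(1)]] by (simp only: card_extend)
    then have "card {g \<in> full n j (Suc i). digit (Suc i) i g \<in> b} * rng (st n j i)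
        \<le> card (full n j i) * card b * rng (st n j i)" by (rule mult_le_mono1)
    also have "\<dots> = card b * card (full n j (Suc i))" by (simp add: card_extend)
    finally show ?case .
  next
    case (step k)
    have "k - i = Suc (k - Suc i)" using step(1) by simp
    then have "digit (Suc k) i g = digit k i (pf g)" for g
      by (simp add: digit_def funpow_Suc_right del: funpow.simps)
    then have "{g \<in> full n j (Suc k). digit (Suc k) i g \<in> b} =
        extend {g \<in> full n j k. digit k i g \<in> b} (st n j k) {..<rng (st n j k)}"
      by (auto simp: extend_def)
    then show ?case
      using mult_le_mono1[OF step(3), of "rng (st n j k)"] by (simp add: card_extend mult_ac)
  qed
qed

text \<open>A union bound: each of the k bad events has density at most 1/((k+1) (2j+1)^k) among all
  tuples, while the live tuples have density at least 1/(2j+1)^k.\<close>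

lemma generic_exists:
  assumes fin: "\<And>i. i < k \<Longrightarrow> finite (b i)"
    and big: "\<And>i. i < k \<Longrightarrow> card (b i) * (Suc (2 * j) ^ k * Suc k) \<le> rng (st n j i)"
  shows "\<exists>g\<in>live n j k. \<forall>i<k. digit k i g \<notin> b i"
proof (rule ccontr)
  assume no: "\<not> (\<exists>g\<in>live n j k. \<forall>i<k. digit k i g \<notin> b i)"
  let ?M = "Suc (2 * j) ^ k * Suc k"
  define E where "E i = {g \<in> full n j k. digit k i g \<in> b i}" for i
  have E: "card (E i) * ?M \<le> card (full n j k)" if i: "i < k" for i
  proof (cases "card (b i) = 0")
    case True
    then show ?thesis using fin[OF i] by (simp add: E_def)
  next
    case False
    have "card (b i) * (card (E i) * ?M) \<le> card (E i) * rng (st n j i)"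
      using mult_le_mono2[OF big[OF i], of "card (E i)"] by (simp only: mult_ac)
    also have "\<dots> \<le> card (b i) * card (full n j k)"
      unfolding E_def by (rule card_digit[OF fin[OF i] i])
    finally show ?thesis using False by simp
  qed
  have "live n j k \<subseteq> (\<Union>i<k. E i)"
    using no live_full[of n j k] by (auto simp: E_def)
  then have "card (live n j k) \<le> card (\<Union>i<k. E i)"
    by (rule card_mono[rotated]) (simp add: E_def finite_full)
  also have "\<dots> \<le> (\<Sum>i<k. card (E i))" by (rule card_UN_le) simp
  finally have "card (live n j k) * ?M \<le> (\<Sum>i<k. card (E i) * ?M)"
    unfolding sum_distrib_right[symmetric] by (rule mult_le_mono1)
  also have "\<dots> \<le> (\<Sum>i<k. card (full n j k))" by (rule sum_mono) (use E in simp)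
  also have "\<dots> = k * card (full n j k)" by simp
  finally have "card (live n j k) * ?M \<le> k * card (full n j k)" .
  moreover have "Suc k * card (full n j k) \<le> card (live n j k) * ?M"
    using mult_le_mono2[OF card_full_le, of "Suc k" n j k] by (simp only: mult_ac)
  moreover have "0 < card (full n j k)"
    using live_full[of n j k] live_nonempty[of n j k] finite_full by (auto simp: card_gt_0_iff)
  ultimately show False by simp
qed

text \<open>The arguments are a bound from some state m, an image z and a parameter u. Program codes
  and state indices below j include any fixed standard ones as soon as j is large, while z and u
  range only below the state to which the digit belongs.\<close>

definition bad :: "nat \<Rightarrow> nat \<Rightarrow> nat \<Rightarrow> nat set" where
  "bad n j i = (\<lambda>(q, m, z, u). run (V n) (pdec q) (pp (st n j m) (pp z u))) `
     ({..<j} \<times> {..<j} \<times> {..<st n j i} \<times> {..<st n j i})"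

lemma finite_bad: "finite (bad n j i)"
  by (simp add: bad_def)

lemma bad_small: "card (bad n j i) * (Suc (2 * j) ^ j * Suc j) \<le> rng (st n j i)"
proof -
  define s where "s = st n j i"
  have s: "Suc (2 * j) \<le> s" "Suc j \<le> s" "j \<le> s" "1 \<le> s"
    using st_ge[of j n i] by (simp_all add: s_def)
  have "card (bad n j i) \<le> j * (j * (s * s))"
    unfolding bad_def s_def by (rule order_trans[OF card_image_le]) simp_all
  also have "\<dots> \<le> s * (s * (s * s))" using s by (intro mult_le_mono) auto
  finally have b: "card (bad n j i) \<le> s * (s * (s * s))" .
  have "Suc (2 * j) ^ j \<le> s ^ j" using s(1) by (rule power_mono) simp
  also have "\<dots> \<le> s ^ s" using s(3,4) by (rule power_increasing)
  finally have "card (bad n j i) * (Suc (2 * j) ^ j * Suc j) \<le> s * (s * (s * s)) * (s ^ s * s)"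
    by (intro mult_le_mono b s(2))
  also have "\<dots> = s ^ (s + 5)" by (simp add: power_add eval_nat_numeral)
  also have "\<dots> \<le> (2 ^ s) ^ (s + 5)" by (rule power_mono) (simp_all add: less_imp_le)
  also have "\<dots> = rng s" by (simp add: rng_def power_mult)
  finally show ?thesis by (simp add: s_def)
qed

definition gen :: "nat \<Rightarrow> nat \<Rightarrow> nat" where
  "gen n j = (SOME g. g \<in> live n j j \<and> (\<forall>i<j. digit j i g \<notin> bad n j i))"

lemma gen: "gen n j \<in> live n j j" "i < j \<Longrightarrow> digit j i (gen n j) \<notin> bad n j i"
proof -
  have "\<exists>g. g \<in> live n j j \<and> (\<forall>i<j. digit j i g \<notin> bad n j i)"
    using generic_exists[of j "bad n j" j n] finite_bad bad_small by blast
  then have "gen n j \<in> live n j j \<and> (\<forall>i<j. digit j i (gen n j) \<notin> bad n j i)"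
    unfolding gen_def by (rule someI_ex)
  then show "gen n j \<in> live n j j" "i < j \<Longrightarrow> digit j i (gen n j) \<notin> bad n j i" by auto
qed

text \<open>For \<open>l > j\<close> the value is irrelevant; it is chosen so that \<open>tup_pf\<close> holds for all \<open>j\<close>.\<close>

primrec tup :: "nat \<Rightarrow> nat \<Rightarrow> nat \<Rightarrow> nat" where
  "tup n 0 j = 0"
| "tup n (Suc l) j = pp (tup n l j) (pp (st n j l) (digit j l (gen n j)))"

lemma live_pf: "k \<le> i \<Longrightarrow> g \<in> live n j i \<Longrightarrow> (pf ^^ (i - k)) g \<in> live n j k"
proof (induction i arbitrary: g)
  case (Suc i)
  show ?case
  proof (cases "k = Suc i")
    case False
    have "pf g \<in> live n j i" using live_cand[of n j i] Suc.prems(2) by (auto simp: cand_def)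
    with Suc False show ?thesis by (simp add: Suc_diff_le funpow_Suc_right del: funpow.simps st.simps)
  qed (use Suc.prems in simp)
qed simp

lemma tup_eq: "l \<le> j \<Longrightarrow> tup n l j = (pf ^^ (j - l)) (gen n j)"
proof (induction l)
  case 0
  have "(pf ^^ (j - 0)) (gen n j) \<in> live n j 0"
    using gen(1) by (rule live_pf[OF le0])
  then show ?case by (simp only: live_0) simp
next
  case (Suc l)
  have eq: "pf ((pf ^^ (j - Suc l)) (gen n j)) = (pf ^^ (j - l)) (gen n j)"
    using Suc.prems by (metis Suc_diff_le diff_Suc_Suc comp_apply funpow.simps(2))
  have "(pf ^^ (j - Suc l)) (gen n j) \<in> live n j (Suc l)"
    using gen(1) by (rule live_pf[OF Suc.prems])
  then have "pf (ps ((pf ^^ (j - Suc l)) (gen n j))) = st n j l"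
    using live_cand[of n j l] by (auto simp: cand_def)
  then have "(pf ^^ (j - Suc l)) (gen n j) = pp (tup n l j) (pp (st n j l) (digit j l (gen n j)))"
    unfolding digit_def using Suc eq by (metis Suc_leD pair_simps(3))
  then show ?case by simp
qed

lemma tup_live: "l \<le> j \<Longrightarrow> tup n l j \<in> live n j l"
  using live_pf[OF _ gen(1)] tup_eq by metis

lemma tup_less: "l \<le> j \<Longrightarrow> tup n l j < st n j l"
  using tup_live live_less by blast

text \<open>The truncation of the chosen tuple to depth i + 1 survived stage i, whose test looks at
  the further truncation to depth l.\<close>

lemma tup_guess:
  assumes "i < j" "i = pp (pp m d) l"
  shows "min (run (tot (st n j i) (osc n (st n j i))) (pdec m) (tup n l j)) (2 * j) = guess n j i"
proof -
  have "tup n (Suc i) j \<in> live n j (Suc i)" using assms(1) by (intro tup_live) simp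
  then have "val (osc n (st n j i)) (st n j i) (tup n (Suc i) j) = guess n j i"
    unfolding live_Suc by (simp add: survivors_def st_Suc)
  moreover have "(pf ^^ (Suc i - l)) (tup n (Suc i) j) = tup n l j"
  proof -
    have "(pf ^^ d) (tup n (l + d) j) = tup n l j" for d
      by (induction d) (simp_all add: funpow_Suc_right del: funpow.simps)
    from this[of "Suc i - l"] show ?thesis using le_pp(2)[of l "pp m d"] assms(2) by simp
  qed
  ultimately show ?thesis using assms(2) by (simp add: val_def)
qed

section \<open>The ultrapower and its substructure\<close>

text \<open>Zorn's lemma for the reversed order of proper filters finer than
  \<open>sequentially\<close>; the infimum of a chain remains proper. A minimal filter decides
  \<open>P\<close>, since intersecting it with the set of \<open>P\<close> either gives the trivial
  filter or changes nothing.\<close>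

lemma ultrafilter_exists:
  "\<exists>U :: nat filter. U \<le> sequentially \<and> U \<noteq> bot \<and>
     (\<forall>P. eventually P U \<or> eventually (\<lambda>j. \<not> P j) U)"
proof -
  let ?A = "{F :: nat filter. F \<le> sequentially \<and> F \<noteq> bot}"
  let ?R = "\<lambda>F G :: nat filter. G \<le> F"
  have "\<exists>U\<in>?A. \<forall>F\<in>?A. ?R U F \<longrightarrow> F = U"
  proof (rule predicate_Zorn)
    show "partial_order_on ?A (relation_of ?R ?A)"
      by (rule partial_order_on_relation_ofI) auto
  next
    fix C assume "C \<in> Chains (relation_of ?R ?A)"
    then have C: "C \<subseteq> ?A" "\<And>F G. F \<in> C \<Longrightarrow> G \<in> C \<Longrightarrow> F \<le> G \<or> G \<le> F"
      by (auto simp: Chains_def relation_of_def)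
    show "\<exists>u\<in>?A. \<forall>a\<in>C. ?R a u"
    proof (cases "C = {}")
      case False
      have "eventually (\<lambda>_. False) (Inf C) \<longleftrightarrow> (\<exists>F\<in>C. eventually (\<lambda>_. False) F)"
        by (rule eventually_Inf_base[OF False]) (use C(2) in \<open>metis inf.absorb1 inf.absorb2 order_refl\<close>)
      then have "Inf C \<noteq> bot"
        using C(1) by (auto simp: trivial_limit_def)
      moreover obtain F where "F \<in> C" using False by blast
      then have "Inf C \<le> sequentially"
        using Inf_lower[of F C] C(1) order_trans[of "Inf C" F sequentially] by blast
      ultimately have "Inf C \<in> ?A" by simp
      then show ?thesis by (rule rev_bexI) (simp add: Inf_lower)
    qed (auto intro!: bexI[of _ sequentially])
  qed
  then obtain U where U: "U \<le> sequentially" "U \<noteq> bot" "\<And>F. F \<le> U \<Longrightarrow> F \<noteq> bot \<Longrightarrow> F = U"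
    by (auto intro: order_trans)
  have "eventually P U" if "\<not> eventually (\<lambda>j. \<not> P j) U" for P
  proof -
    have "inf U (principal {j. P j}) = U"
      using that by (intro U(3)) (auto simp: trivial_limit_def eventually_inf_principal)
    moreover have "eventually P (inf U (principal {j. P j}))"
      by (simp add: eventually_inf_principal)
    ultimately show ?thesis by simp
  qed
  with U show ?thesis by blast
qed

definition ult :: "nat filter" where
  "ult = (SOME U. U \<le> sequentially \<and> U \<noteq> bot \<and>
     (\<forall>P. eventually P U \<or> eventually (\<lambda>j. \<not> P j) U))"

lemma ult: "ult \<le> sequentially" "ult \<noteq> bot" "eventually P ult \<or> eventually (\<lambda>j. \<not> P j) ult"
  using someI_ex[OF ultrafilter_exists] by (simp_all add: ult_def)

lemma ult_not: "eventually (\<lambda>j. \<not> P j) ult \<longleftrightarrow> \<not> eventually P ult"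
proof
  assume neg: "eventually (\<lambda>j. \<not> P j) ult"
  show "\<not> eventually P ult"
  proof
    assume "eventually P ult"
    with neg have "eventually (\<lambda>j. False) ult" by (rule eventually_elim2) simp
    with ult(2) show False by (simp add: trivial_limit_def)
  qed
qed (use ult(3) in blast)

lemma ult_disj: "eventually (\<lambda>j. P j \<or> Q j) ult \<longleftrightarrow> eventually P ult \<or> eventually Q ult"
  using ult_not[of "\<lambda>j. P j \<or> Q j"] by (auto simp: eventually_conj_iff ult_not)

lemma ult_imp: "eventually (\<lambda>j. P j \<longrightarrow> Q j) ult \<longleftrightarrow> (eventually P ult \<longrightarrow> eventually Q ult)"
  by (simp only: imp_conv_disj ult_disj ult_not)

lemma ult_large: "eventually (\<lambda>j. c < j) ult"
  using ult(1) eventually_gt_at_top[of c] by (auto simp: le_filter_def)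

text \<open>The values up to i split the indices into finitely many parts, one of which is
  large.\<close>

lemma ult_bounded:
  assumes "eventually (\<lambda>j. f j \<le> (i::nat)) ult"
  shows "\<exists>y\<le>i. eventually (\<lambda>j. f j = y) ult"
proof (rule ccontr)
  assume "\<not> (\<exists>y\<le>i. eventually (\<lambda>j. f j = y) ult)"
  then have "\<forall>y\<in>{..i}. eventually (\<lambda>j. f j \<noteq> y) ult" by (simp add: ult_not)
  then have "eventually (\<lambda>j. \<forall>y\<in>{..i}. f j \<noteq> y) ult" by (intro eventually_ball_finite) simp_all
  with assms have "eventually (\<lambda>j. False) ult" by (rule eventually_elim2) auto
  with ult(2) show False by (simp add: trivial_limit_def)
qed

section \<open>Ultrapower relations and the structure \<open>K\<close>\<close>

abbreviation eqU :: "(nat \<Rightarrow> nat) \<Rightarrow> (nat \<Rightarrow> nat) \<Rightarrow> bool" where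
  "eqU x y \<equiv> eventually (\<lambda>j. x j = y j) ult"

abbreviation ltU :: "(nat \<Rightarrow> nat) \<Rightarrow> (nat \<Rightarrow> nat) \<Rightarrow> bool" where
  "ltU x y \<equiv> eventually (\<lambda>j. x j < y j) ult"

definition K :: "nat \<Rightarrow> (nat \<Rightarrow> nat) set" where
  "K n = {\<lambda>j. f (tup n l j) | f l. PF (V n) f}"

text \<open>An assignment coded by one element of \<open>K\<close> can be handed to the programs
  that decide truth or compute Skolem functions.\<close>

definition kenv :: "(nat \<Rightarrow> nat) \<Rightarrow> nat \<Rightarrow> nat \<Rightarrow> nat" where
  "kenv x = (\<lambda>i j. env (x j) i)"

abbreviation ksat :: "nat \<Rightarrow> (nat \<Rightarrow> nat \<Rightarrow> nat) \<Rightarrow> fm \<Rightarrow> bool" where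
  "ksat n \<equiv> sat (K n) eqU ltU"

lemma K_PF: "x \<in> K n \<Longrightarrow> PF (V n) f \<Longrightarrow> (\<lambda>j. f (x j)) \<in> K n"
  unfolding K_def by (auto intro: PF_comp)

lemma K_tup: "(\<lambda>j. tup n l j) \<in> K n"
  unfolding K_def using PF_id by fastforce

lemma K_const: "(\<lambda>j. c) \<in> K n"
  using K_PF[OF K_tup[of n 0] PF_const] .

lemma tup_pf: "(pf ^^ d) (tup n (l + d) j) = tup n l j"
  by (induction d) (simp_all add: funpow_Suc_right del: funpow.simps)

lemma K_pp:
  assumes "x \<in> K n" "y \<in> K n"
  shows "(\<lambda>j. pp (x j) (y j)) \<in> K n"
proof -
  have pow: "PF (V n) (pf ^^ d)" for d
  proof (induction d)
    case 0
    show ?case using PF_id by (simp add: id_def)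
  next
    case (Suc d)
    then show ?case using PF_pf by (simp add: comp_def)
  qed
  obtain f l g k where x: "x = (\<lambda>j. f (tup n l j))" "PF (V n) f"
    and y: "y = (\<lambda>j. g (tup n k j))" "PF (V n) g"
    using assms by (auto simp: K_def)
  \<comment> \<open>The tuple of depth l + k truncates to those of depth l and k, so one generator
    tuple serves both elements.\<close>
  have "(\<lambda>j. (\<lambda>z. pp (f ((pf ^^ k) z)) (g ((pf ^^ l) z))) (tup n (l + k) j)) \<in> K n"
    by (rule K_PF[OF K_tup]) (intro PF_pp PF_comp[OF x(2) pow] PF_comp[OF y(2) pow])
  then show ?thesis
    using tup_pf[of k n l] tup_pf[of l n k] by (simp add: x y add.commute)
qed

lemma K_PF2:
  assumes "x \<in> K n" "y \<in> K n" "PF (V n) (\<lambda>z. f (pf z) (ps z))"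
  shows "(\<lambda>j. f (x j) (y j)) \<in> K n"
  using K_PF[OF K_pp[OF assms(1,2)] assms(3)] by simp

lemma K_st: "(\<lambda>j. st n j l) \<in> K n"
  using K_PF[OF K_tup[of n "Suc l"], of "\<lambda>z. pf (ps z)"] by (simp add: PF_pf PF_ps PF_id)

lemma K_ident: "(\<lambda>j. j) \<in> K n"
proof -
  have "(\<lambda>j. ps (pf (st n j 0))) \<in> K n"
    by (rule K_PF[OF K_st]) (intro PF_pf PF_ps PF_id)
  then show ?thesis by (simp add: init_def)
qed

lemma K_bound: "x \<in> K n \<Longrightarrow> \<exists>c. eventually (\<lambda>j. x j < st n j c) ult"
proof -
  assume "x \<in> K n"
  then obtain p l where x: "x = (\<lambda>j. run (V n) p (tup n l j))"
    by (auto simp: K_def PF_def) metis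
  obtain c where "\<forall>j a x. x < st n j a \<longrightarrow> run (V n) p x < st n j (a + c) \<and>
     (\<forall>i\<ge>a + c. run (tot (st n j i) (osc n (st n j i))) p x = run (V n) p x)"
    using run_bound[of n p] by (elim exE)
  then have "run (V n) p (tup n l j) < st n j (l + c)" if "l < j" for j
    using tup_less[of l j n] that by (meson less_imp_le)
  then have "eventually (\<lambda>j. x j < st n j (l + c)) ult"
    unfolding x by (intro eventually_mono[OF ult_large[of l]])
  then show ?thesis ..
qed

lemma K_bound2: "x \<in> K n \<Longrightarrow> y \<in> K n \<Longrightarrow>
    \<exists>c. eventually (\<lambda>j. x j < st n j c) ult \<and> eventually (\<lambda>j. y j < st n j c) ult"
proof -
  assume "x \<in> K n" "y \<in> K n"
  then obtain c d where cd: "eventually (\<lambda>j. x j < st n j c) ult" "eventually (\<lambda>j. y j < st n j d) ult"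
    using K_bound by blast
  have "eventually (\<lambda>j. x j < st n j (c + d)) ult"
    using cd(1) by (rule eventually_mono) (erule less_le_trans, simp add: st_mono)
  moreover have "eventually (\<lambda>j. y j < st n j (c + d)) ult"
    using cd(2) by (rule eventually_mono) (erule less_le_trans, simp add: st_mono)
  ultimately show ?thesis by blast
qed

lemma tval_kenv: "tval (kenv x) t = (\<lambda>j. tval (env (x j)) t)"
  by (induction t) (auto simp: kenv_def)

lemma push_kenv: "u ## kenv x = kenv (\<lambda>j. pp (u j) (x j))"
  by (rule ext, rename_tac i, case_tac i) (simp_all add: kenv_def)

lemma kenv_tail: "(\<lambda>i. kenv x (Suc i)) = kenv (\<lambda>j. ps (x j))"
  by (intro ext) (simp add: kenv_def env_ps)

interpretation K: fo_structure "K n" eqU ltU "{kenv x | x. x \<in> K n}" for n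
proof
  show "eqU x y \<Longrightarrow> eqU x z \<Longrightarrow> eqU y z" for x y z
    by (drule (1) eventually_conj, erule eventually_mono) simp
  show "eqU x y \<Longrightarrow> eqU x' y' \<Longrightarrow> eqU (x + x') (y + y')" for x y x' y'
    by (drule (1) eventually_conj, erule eventually_mono) simp
  show "eqU x y \<Longrightarrow> eqU x' y' \<Longrightarrow> eqU (x * x') (y * y')" for x y x' y'
    by (drule (1) eventually_conj, erule eventually_mono) simp
  show "eqU x y \<Longrightarrow> eqU x' y' \<Longrightarrow> ltU x x' \<Longrightarrow> ltU y y'" for x y x' y'
    by (drule (1) eventually_conj, drule (1) eventually_conj, erule eventually_mono) simp
  show "e \<in> {kenv x | x. x \<in> K n} \<Longrightarrow> tval e t \<in> K n" for e t
    using K_PF[OF _ PF_tval] by (auto simp: tval_kenv)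
  show "e \<in> {kenv x | x. x \<in> K n} \<Longrightarrow> u \<in> K n \<Longrightarrow> u ## e \<in> {kenv x | x. x \<in> K n}" for e u
    using K_pp by (auto simp: push_kenv)
  show "e \<in> {kenv x | x. x \<in> K n} \<Longrightarrow> (\<lambda>i. e (Suc i)) \<in> {kenv x | x. x \<in> K n}" for e
    using K_PF[OF _ PF_ps[OF PF_id]] by (auto simp: kenv_tail)
qed simp

lemma K_valid: "K.valid n p \<longleftrightarrow> (\<forall>x\<in>K n. ksat n (kenv x) p)"
  by (auto simp: K.valid_def)

section \<open>Los's theorem for \<open>K\<close> up to level n\<close>

definition elementary :: "nat \<Rightarrow> fm \<Rightarrow> bool" where
  "elementary n p \<longleftrightarrow> (\<forall>x\<in>K n. ksat n (kenv x) p \<longleftrightarrow> eventually (\<lambda>j. natsat (env (x j)) p) ult)"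

lemma elementary_valid: "elementary n p \<Longrightarrow> N.valid p \<Longrightarrow> K.valid n p"
  by (simp add: elementary_def K_valid N.valid_def)

lemma elementary_push:
  "elementary n p \<Longrightarrow> u \<in> K n \<Longrightarrow> x \<in> K n \<Longrightarrow>
    ksat n (u ## kenv x) p \<longleftrightarrow> eventually (\<lambda>j. natsat (u j ## env (x j)) p) ult"
  using K_pp[of u n x] by (simp add: elementary_def push_kenv)

text \<open>The usual argument of Los, except that the coordinatewise choice of witnesses must be
  made by a program for the witness to lie in \<open>K\<close>.\<close>

lemma elementary_Ex:
  assumes "elementary n p" "PF (V n) g" "\<And>x u. natsat (u ## env x) p \<Longrightarrow> natsat (g x ## env x) p"
  shows "elementary n (Ex p)"
  unfolding elementary_def
proof
  fix x assume x: "x \<in> K n"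
  have g: "(\<lambda>j. g (x j)) \<in> K n" by (rule K_PF[OF x assms(2)])
  have "ksat n (kenv x) (Ex p) \<longleftrightarrow> (\<exists>u\<in>K n. eventually (\<lambda>j. natsat (u j ## env (x j)) p) ult)"
    using elementary_push[OF assms(1) _ x] by simp
  also have "\<dots> \<longleftrightarrow> eventually (\<lambda>j. natsat (env (x j)) (Ex p)) ult"
  proof
    assume "eventually (\<lambda>j. natsat (env (x j)) (Ex p)) ult"
    then have "eventually (\<lambda>j. natsat (g (x j) ## env (x j)) p) ult"
      by (rule eventually_mono) (use assms(3) in auto)
    then show "\<exists>u\<in>K n. eventually (\<lambda>j. natsat (u j ## env (x j)) p) ult"
      by (intro bexI[OF _ g])
  qed (auto elim!: eventually_mono)
  finally show "ksat n (kenv x) (Ex p) \<longleftrightarrow> eventually (\<lambda>j. natsat (env (x j)) (Ex p)) ult" .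
qed

lemma elementary_Neg: "elementary n p \<Longrightarrow> elementary n (Neg p)"
  by (simp add: elementary_def ult_not)

lemma elementary_Imp: "elementary n p \<Longrightarrow> elementary n q \<Longrightarrow> elementary n (Imp p q)"
  by (simp add: elementary_def ult_imp)

lemma elementary_Conj: "elementary n p \<Longrightarrow> elementary n q \<Longrightarrow> elementary n (Conj p q)"
  by (simp add: elementary_def eventually_conj_iff)

lemma elementary_Lt: "elementary n (Lt s t)"
  by (simp add: elementary_def tval_kenv)

lemma elementary_All:
  assumes "elementary n p" "PF (V n) g" "\<And>x u. \<not> natsat (u ## env x) p \<Longrightarrow> \<not> natsat (g x ## env x) p"
  shows "elementary n (All p)"
proof -
  have "elementary n (Neg (Ex (Neg p)))"
    by (rule elementary_Neg, rule elementary_Ex[OF elementary_Neg[OF assms(1)] assms(2)]) (use assms(3) in auto)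
  then show ?thesis by (simp add: elementary_def)
qed

lemma elementary_Delta0: "Delta0 p \<Longrightarrow> elementary n p"
proof (induction rule: Delta0.induct)
  case (6 p q)
  then show ?case by (simp add: elementary_def ult_disj)
next
  case (7 p t)
  have "PB (V n) (\<lambda>z. \<not> natsat (env (pp (pf z) (ps z))) p)"
    unfolding pair_simps by (rule PB_not[OF PB_Delta0[OF 7(1)]])
  then have g: "PF (V n) (\<lambda>x. bm (tval (env x) t) (\<lambda>u. \<not> natsat (env (pp u x)) p))"
    by (intro PF_bm PF_tval)
  have "elementary n (Imp (Lt (Var 0) (lift_tm t)) p)"
    by (intro elementary_Imp elementary_Lt 7(2))
  then show ?case
  proof (rule elementary_All[OF _ g])
    fix x u
    assume "\<not> natsat (u ## env x) (Imp (Lt (Var 0) (lift_tm t)) p)"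
    then have u: "u < tval (env x) t" "\<not> natsat (env (pp u x)) p" by auto
    then have "\<exists>u<tval (env x) t. \<not> natsat (env (pp u x)) p" by blast
    with bm_sat[of u "tval (env x) t" "\<lambda>u. \<not> natsat (env (pp u x)) p", OF u]
      bm_less[of "tval (env x) t" "\<lambda>u. \<not> natsat (env (pp u x)) p"]
    show "\<not> natsat (bm (tval (env x) t) (\<lambda>u. \<not> natsat (env (pp u x)) p) ## env x)
        (Imp (Lt (Var 0) (lift_tm t)) p)"
      by simp
  qed
next
  case (8 p t)
  have "PB (V n) (\<lambda>z. natsat (env (pp (pf z) (ps z))) p)"
    unfolding pair_simps by (rule PB_Delta0[OF 8(1)])
  then have g: "PF (V n) (\<lambda>x. bm (tval (env x) t) (\<lambda>u. natsat (env (pp u x)) p))"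
    by (intro PF_bm PF_tval)
  have "elementary n (Conj (Lt (Var 0) (lift_tm t)) p)"
    by (intro elementary_Conj elementary_Lt 8(2))
  then show ?case
  proof (rule elementary_Ex[OF _ g])
    fix x u
    assume "natsat (u ## env x) (Conj (Lt (Var 0) (lift_tm t)) p)"
    then have u: "u < tval (env x) t" "natsat (env (pp u x)) p" by auto
    then have "\<exists>u<tval (env x) t. natsat (env (pp u x)) p" by blast
    with bm_sat[of u "tval (env x) t" "\<lambda>u. natsat (env (pp u x)) p", OF u]
      bm_less[of "tval (env x) t" "\<lambda>u. natsat (env (pp u x)) p"]
    show "natsat (bm (tval (env x) t) (\<lambda>u. natsat (env (pp u x)) p) ## env x)
        (Conj (Lt (Var 0) (lift_tm t)) p)"
      by simp
  qed
qed (simp_all add: elementary_Lt elementary_Imp elementary_Conj elementary_Neg, simp add: elementary_def tval_kenv)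

text \<open>Skolem functions for level k are programs over \<open>V k\<close>, and
  \<open>V n\<close> computes them exactly when k stays within the range treated here.\<close>

lemma elementary_Sig_Pi: "k \<le> n \<Longrightarrow> (Sig k p \<longrightarrow> elementary n p) \<and> (Pi k p \<longrightarrow> elementary n p)"
proof (induction k arbitrary: p)
  case 0
  then show ?case by (auto intro: elementary_Delta0 elim: Sig.cases Pi.cases)
next
  case (Suc k)
  have "elementary n p" if "Sig (Suc k) p"
    using that
  proof (induction rule: Sig_Suc_induct)
    case (base p)
    then show ?case using Suc by simp
  next
    case (ex p)
    then obtain g where "PF (V (Suc k)) g" "\<forall>x u. natsat (u ## env x) p \<longrightarrow> natsat (g x ## env x) p"
      using skolem_Sig by blast
    then show ?case using elementary_Ex[OF ex(2)] PF_V_mono[OF Suc.prems] by blast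
  qed
  moreover have "elementary n p" if "Pi (Suc k) p"
    using that
  proof (induction rule: Pi_Suc_induct)
    case (base p)
    then show ?case using Suc by simp
  next
    case (all p)
    then obtain g where "PF (V (Suc k)) g"
        "\<forall>x u. \<not> natsat (u ## env x) p \<longrightarrow> \<not> natsat (g x ## env x) p"
      using skolem_Pi by blast
    then show ?case using elementary_All[OF all(2)] PF_V_mono[OF Suc.prems] by blast
  qed
  ultimately show ?case by blast
qed

section \<open>The axioms hold in \<open>K\<close>\<close>

lemma K_PAminus: "p \<in> PAminus \<Longrightarrow> K.valid n p"
proof -
  \<comment> \<open>Subtraction is the one axiom with an unbounded quantifier; its witness is at
    most the larger number and is found by bounded search.\<close>
  have minus: "elementary n (Ex (Eq (Plus (Var 1) (Var 0)) (Var 2)))"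
  proof (rule elementary_Ex)
    show "elementary n (Eq (Plus (Var 1) (Var 0)) (Var 2))" by (intro elementary_Delta0 Delta0.intros)
    show "PF (V n) (\<lambda>x. bm (Suc (env x 1)) (\<lambda>u. env x 0 + u = env x 1))"
      by (intro PF_bm PB_eq PF_add PF_Suc PF_env PF_comp[OF PF_env] PF_pf PF_ps PF_id)
    show "natsat (bm (Suc (env x 1)) (\<lambda>u. env x 0 + u = env x 1) ## env x) (Eq (Plus (Var 1) (Var 0)) (Var 2))"
      if "natsat (u ## env x) (Eq (Plus (Var 1) (Var 0)) (Var 2))" for x u
      using bm_sat[of u "Suc (env x 1)" "\<lambda>u. env x 0 + u = env x 1"] that by simp
  qed
  assume p: "p \<in> PAminus"
  then have "p \<in> ucl ` {q. elementary n q}"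
    unfolding PAminus_def
  proof (rule rev_subsetD[OF _ image_mono], unfold insert_subset mem_Collect_eq, intro conjI)
    show "elementary n (Imp (Lt (Var 0) (Var 1)) (Ex (Eq (Plus (Var 1) (Var 0)) (Var 2))))"
      by (intro elementary_Imp elementary_Lt minus)
  qed ((rule elementary_Delta0, blast intro: Delta0.intros)+, rule empty_subsetI)
  then obtain q where q: "p = ucl q" "elementary n q" by blast
  have "N.valid q" using nat_PAminus[OF p] by (simp add: q N.valid_ucl)
  then show "K.valid n p" using elementary_valid[OF q(2)] by (simp add: q K.valid_ucl)
qed

text \<open>Where induction fails below b there is, in almost every coordinate, a first v < b at
  which the formula holds and fails at v + 1. Bounded search over a condition decidable from
  \<open>V n\<close> finds it, so these v form an element of \<open>K\<close>.\<close>

lemma K_ind: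
  assumes "Sig n p" shows "K.valid n (ind p)"
  unfolding ind_def K.valid_ucl unfolding K_valid
proof (intro ballI, simp only: sat.simps sat_inst1 tval.simps, intro impI ballI, elim conjE)
  fix x b
  assume x: "x \<in> K n" and b: "b \<in> K n"
    and zero: "ksat n (0 ## (\<lambda>i. kenv x (i + 0))) p"
    and step: "\<forall>u\<in>K n. ksat n ((u ## kenv x) 0 ## (\<lambda>i. (u ## kenv x) (i + 1))) p \<longrightarrow>
        ksat n (((u ## kenv x) 0 + 1) ## (\<lambda>i. (u ## kenv x) (i + 1))) p"
  have el: "elementary n p" using elementary_Sig_Pi[of n n p] assms by simp
  have PB: "PB (V n) (\<lambda>x. natsat (env x) p)" using PB_Sig_Pi assms by blast
  let ?Q = "\<lambda>v x. natsat (v ## env x) p \<and> \<not> natsat (Suc v ## env x) p"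
  have ksat: "ksat n (u ## kenv x) p \<longleftrightarrow> eventually (\<lambda>j. natsat (u j ## env (x j)) p) ult"
    if "u \<in> K n" for u
    using elementary_push[OF el that x] .
  show "ksat n ((b ## kenv x) 0 ## (\<lambda>i. (b ## kenv x) (i + 1))) p"
  proof (rule ccontr)
    assume "\<not> ?thesis"
    then have nb: "eventually (\<lambda>j. \<not> natsat (b j ## env (x j)) p) ult"
      using ksat[OF b] by (simp add: ult_not)
    have "PB (V n) (\<lambda>z. natsat (env (pp (pf z) (ps (ps z)))) p \<and> \<not> natsat (env (pp (Suc (pf z)) (ps (ps z)))) p)"
      by (intro PB_conj PB_not PB_comp[OF PB] PF_pp PF_Suc PF_pf PF_ps PF_id)
    then have "PF (V n) (\<lambda>z. bm (pf z) (\<lambda>v. ?Q v (ps z)))"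
      by (intro PF_bm PF_pf PF_id) simp
    then have z: "(\<lambda>j. bm (b j) (\<lambda>v. ?Q v (x j))) \<in> K n"
      by (rule K_PF2[OF b x])
    have z1: "(\<lambda>j. bm (b j) (\<lambda>v. ?Q v (x j))) + 1 \<in> K n"
      using K_PF[OF z PF_Suc[OF PF_id]] by (simp add: plus_fun_def one_fun_def)
    have zero': "eventually (\<lambda>j. natsat (0 ## env (x j)) p) ult"
      using zero ksat[of 0] K_const[of 0 n] by (simp add: zero_fun_def)
    from zero' nb have "eventually (\<lambda>j. ?Q (bm (b j) (\<lambda>v. ?Q v (x j))) (x j)) ult"
    proof (rule eventually_elim2)
      fix j assume 0: "natsat (0 ## env (x j)) p" and nb: "\<not> natsat (b j ## env (x j)) p"
      have "\<exists>v<b j. ?Q v (x j)"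
      proof (rule ccontr)
        assume "\<not> ?thesis"
        then have "v \<le> b j \<Longrightarrow> natsat (v ## env (x j)) p" for v
          by (induction v) (use 0 in auto)
        with nb show False by blast
      qed
      then obtain v where "v < b j" "?Q v (x j)" by blast
      then show "?Q (bm (b j) (\<lambda>v. ?Q v (x j))) (x j)" by (rule bm_sat)
    qed
    then have "ksat n ((\<lambda>j. bm (b j) (\<lambda>v. ?Q v (x j))) ## kenv x) p"
      "\<not> ksat n (((\<lambda>j. bm (b j) (\<lambda>v. ?Q v (x j))) + 1) ## kenv x) p"
      unfolding ksat[OF z] ksat[OF z1] by (simp_all add: eventually_conj_iff ult_not)
    with step[rule_format, OF z] show False by simp
  qed
qed

text \<open>If u lies below a state, its power of two lies below the next one, which belongs to
  \<open>K\<close> and bounds a search through the Delta_0 graph.\<close>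

lemma K_exp:
  assumes "exp_graph E" shows "K.valid n (exp_ax E)"
  unfolding exp_ax_def K_valid
proof (intro ballI, simp only: sat.simps sat_inst2 tval.simps, intro ballI)
  fix x u assume x: "x \<in> K n" and u: "u \<in> K n"
  have D: "Delta0 E" using assms by (simp add: exp_graph_def)
  obtain c where c: "eventually (\<lambda>j. u j < st n j c) ult" using K_bound[OF u] by blast
  define g where "g z = bm (pf z) (\<lambda>v. natsat (env (pp (pf (ps z)) (pp v (ps (ps z))))) E)" for z
  have "PF (V n) g"
    unfolding g_def by (intro PF_bm PF_pf PF_id PB_comp[OF PB_Delta0[OF D]] PF_pp PF_ps)
  then have y: "(\<lambda>j. g (pp (st n j (Suc c)) (pp (u j) (x j)))) \<in> K n" (is "?y \<in> _")
    by (rule K_PF[OF K_pp[OF K_st K_pp[OF u x]]])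
  have "eventually (\<lambda>j. natsat (u j ## ?y j ## env (x j)) E) ult"
    using c
  proof (rule eventually_mono)
    fix j assume "u j < st n j c"
    then have "(2::nat) ^ u j \<le> 2 ^ st n j c" by simp
    then have "2 ^ u j < st n j (Suc c)" using st_exp[of n j c] by linarith
    then have "natsat (env (pp (u j) (pp (?y j) (x j)))) E"
      unfolding g_def pair_simps by (rule bm_sat) (simp add: exp_graph_nat[OF assms])
    then show "natsat (u j ## ?y j ## env (x j)) E" by simp
  qed
  then have "ksat n (u ## ?y ## kenv x) E"
    using elementary_push[OF elementary_Delta0[OF D] u K_pp[OF y x]] by (simp add: push_kenv)
  then show "\<exists>y\<in>K n. ksat n ((y ## u ## kenv x) 1 ## (y ## u ## kenv x) 0 ##
      (\<lambda>i. (y ## u ## kenv x) (i + 2))) E"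
    using y by (intro bexI[OF _ y]) (simp add: numeral_2_eq_2)
qed

text \<open>At level n + 1 transfer is no longer available: truth in \<open>K\<close> means that a
  witness exists within \<open>K\<close>, for a matrix decidable from \<open>V n\<close>.\<close>

lemma K_Sig_Suc:
  assumes "Sig (Suc n) p"
  shows "\<exists>Q. PB (V n) (\<lambda>z. Q (pf z) (ps z)) \<and>
    (\<forall>x\<in>K n. ksat n (kenv x) p \<longleftrightarrow> (\<exists>w\<in>K n. eventually (\<lambda>j. Q (w j) (x j)) ult))"
  using assms
proof (induction rule: Sig_Suc_induct)
  case (base p)
  have "PB (V n) (\<lambda>z. natsat (env (ps z)) p)"
    using PB_comp[of "V n" "\<lambda>x. natsat (env x) p", OF _ PF_ps[OF PF_id]] PB_Sig_Pi base by blast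
  moreover have "elementary n p" using elementary_Sig_Pi[of n n p] base by simp
  ultimately show ?case
    using K_const by (intro exI[of _ "\<lambda>w x. natsat (env x) p"]) (auto simp: elementary_def)
next
  case (ex p)
  then obtain Q where Q: "PB (V n) (\<lambda>z. Q (pf z) (ps z))"
      "\<forall>x\<in>K n. ksat n (kenv x) p \<longleftrightarrow> (\<exists>w\<in>K n. eventually (\<lambda>j. Q (w j) (x j)) ult)"
    by blast
  have "PB (V n) (\<lambda>z. Q (pf (pp (pf (pf z)) (pp (ps (pf z)) (ps z)))) (ps (pp (pf (pf z)) (pp (ps (pf z)) (ps z)))))"
    by (rule PB_comp[OF Q(1)]) (intro PF_pf PF_ps PF_pp PF_id)
  moreover have "ksat n (kenv x) (Ex p) \<longleftrightarrow>
      (\<exists>w\<in>K n. eventually (\<lambda>j. Q (pf (w j)) (pp (ps (w j)) (x j))) ult)" if x: "x \<in> K n" for x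
  proof -
    have "ksat n (kenv x) (Ex p) \<longleftrightarrow>
        (\<exists>u\<in>K n. \<exists>w\<in>K n. eventually (\<lambda>j. Q (w j) (pp (u j) (x j))) ult)"
      using Q(2) K_pp[OF _ x] by (simp add: push_kenv)
    also have "\<dots> \<longleftrightarrow> (\<exists>w\<in>K n. eventually (\<lambda>j. Q (pf (w j)) (pp (ps (w j)) (x j))) ult)"
    proof
      assume "\<exists>u\<in>K n. \<exists>w\<in>K n. eventually (\<lambda>j. Q (w j) (pp (u j) (x j))) ult"
      then obtain u w where "u \<in> K n" "w \<in> K n" "eventually (\<lambda>j. Q (w j) (pp (u j) (x j))) ult"
        by blast
      then show "\<exists>w\<in>K n. eventually (\<lambda>j. Q (pf (w j)) (pp (ps (w j)) (x j))) ult"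
        by (intro bexI[of _ "\<lambda>j. pp (w j) (u j)"] K_pp) simp_all
    next
      assume "\<exists>w\<in>K n. eventually (\<lambda>j. Q (pf (w j)) (pp (ps (w j)) (x j))) ult"
      then obtain w where w: "w \<in> K n" "eventually (\<lambda>j. Q (pf (w j)) (pp (ps (w j)) (x j))) ult"
        by blast
      have "(\<lambda>j. ps (w j)) \<in> K n" "(\<lambda>j. pf (w j)) \<in> K n"
        by (rule K_PF[OF w(1)], intro PF_ps PF_pf PF_id)+
      with w(2) show "\<exists>u\<in>K n. \<exists>w\<in>K n. eventually (\<lambda>j. Q (w j) (pp (u j) (x j))) ult"
        by (intro bexI[of _ "\<lambda>j. ps (w j)"] bexI[of _ "\<lambda>j. pf (w j)"])
    qed
    finally show ?thesis .
  qed
  ultimately show ?case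
    by (intro exI[of _ "\<lambda>w x. Q (pf w) (pp (ps w) x)"]) simp
qed

lemma push_drop [simp]:
  "(\<lambda>i. (a ## b ## e) (i + 2)) = e" "(\<lambda>i. (a ## b ## c ## e) (i + 3)) = e"
  "(\<lambda>i. (a ## b ## c ## d ## e) (i + 4)) = e"
  by (simp_all add: eval_nat_numeral)

text \<open>If a \<open>\<Sigma>\<^sub>n\<^sub>+\<^sub>1\<close> injection of \<open>K\<close> had its range below \<open>b\<close>, then each element of \<open>K\<close> could be
  computed from its image and a bound for a witness, contradicting the choice of a digit
  avoiding \<open>bad\<close>.\<close>

lemma K_injection_unbounded:
  assumes p: "Sig (Suc n) p" and x: "x \<in> K n" and b: "b \<in> K n"
    and total: "\<And>u. u \<in> K n \<Longrightarrow> \<exists>z\<in>K n. ksat n (u ## z ## kenv x) p"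
    and inj: "\<And>u u' z. u \<in> K n \<Longrightarrow> u' \<in> K n \<Longrightarrow> z \<in> K n \<Longrightarrow> ksat n (u ## z ## kenv x) p \<Longrightarrow>
      ksat n (u' ## z ## kenv x) p \<Longrightarrow> eqU u u'"
  shows "\<exists>u\<in>K n. \<exists>z\<in>K n. ksat n (u ## z ## kenv x) p \<and> ltU b z"
proof (rule ccontr)
  assume no: "\<not> ?thesis"
  obtain Q where Q: "PB (V n) (\<lambda>z. Q (pf z) (ps z))"
      "\<And>x. x \<in> K n \<Longrightarrow> ksat n (kenv x) p \<longleftrightarrow> (\<exists>w\<in>K n. eventually (\<lambda>j. Q (w j) (x j)) ult)"
    using K_Sig_Suc[OF p] by blast
  have ksat: "ksat n (u ## z ## kenv x) p \<longleftrightarrow>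
      (\<exists>w\<in>K n. eventually (\<lambda>j. Q (w j) (pp (u j) (pp (z j) (x j)))) ult)"
    if "u \<in> K n" "z \<in> K n" for u z
    using Q(2)[OF K_pp[OF that(1) K_pp[OF that(2) x]]] by (simp add: push_kenv)
  \<comment> \<open>With b and x below state i, the image of digit i and the parameter both fall in
    the range covered by \<open>bad n j i\<close>.\<close>
  obtain i where i: "eventually (\<lambda>j. b j < st n j i) ult" "eventually (\<lambda>j. x j < st n j i) ult"
    using K_bound2[OF b x] by blast
  have y: "(\<lambda>j. digit j i (gen n j)) \<in> K n" (is "?y \<in> _")
    using K_PF[OF K_tup[of n "Suc i"], of "\<lambda>z. ps (ps z)"] by (simp add: PF_ps PF_id)
  obtain z where z: "z \<in> K n" "ksat n (?y ## z ## kenv x) p" using total[OF y] by blast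
  have "\<not> ltU b z" using no y z by blast
  then have "eventually (\<lambda>j. z j \<le> b j) ult" by (simp add: ult_not[symmetric] not_less)
  with i(1) have zi: "eventually (\<lambda>j. z j < st n j i) ult" by (rule eventually_elim2) simp
  obtain w where w: "w \<in> K n" "eventually (\<lambda>j. Q (w j) (pp (?y j) (pp (z j) (x j)))) ult"
    using z ksat[OF y z(1)] by blast
  obtain m where m: "eventually (\<lambda>j. pp (w j) (?y j) < st n j m) ult"
    using K_bound[OF K_pp[OF w(1) y]] by blast
  \<comment> \<open>\<open>a\<close> carries a search bound, an image and the parameters; the search
    looks for a pair of a witness and a preimage. The preimage found need not be the digit itself,
    but injectivity identifies the two.\<close>
  define g where "g a = bm (pf a) (\<lambda>v. Q (pf v) (pp (ps v) (ps a)))" for a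
  have "PB (V n) (\<lambda>a. (\<lambda>c. Q (pf c) (ps c)) (pp (pf (pf a)) (pp (ps (pf a)) (ps (ps a)))))"
    by (rule PB_comp[OF Q(1)]) (intro PF_pf PF_ps PF_pp PF_id)
  then have g: "PF (V n) g"
    unfolding g_def by (intro PF_bm PF_pf PF_id) simp
  obtain r where r: "\<forall>a. run (V n) r a = ps (g a)"
    using PF_ps[OF g] by (auto simp: PF_def)
  obtain q where q: "pdec q = r" using pdec_surj by blast
  let ?a = "\<lambda>j. pp (st n j m) (pp (z j) (x j))"
  have a: "?a \<in> K n" by (intro K_pp K_st z(1) x)
  have y': "(\<lambda>j. ps (g (?a j))) \<in> K n" and w': "(\<lambda>j. pf (g (?a j))) \<in> K n"
    by (rule K_PF[OF a], intro PF_ps PF_pf g)+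
  from w(2) m have "eventually (\<lambda>j. Q (pf (g (?a j))) (pp (ps (g (?a j))) (pp (z j) (x j)))) ult"
  proof (rule eventually_elim2)
    fix j assume *: "Q (w j) (pp (?y j) (pp (z j) (x j)))" "pp (w j) (?y j) < st n j m"
    show "Q (pf (g (?a j))) (pp (ps (g (?a j))) (pp (z j) (x j)))"
      using bm_sat[of "pp (w j) (?y j)" "st n j m" "\<lambda>v. Q (pf v) (pp (ps v) (pp (z j) (x j)))"] *
      by (simp add: g_def)
  qed
  then have "ksat n ((\<lambda>j. ps (g (?a j))) ## z ## kenv x) p"
    unfolding ksat[OF y' z(1)] using w' by (intro bexI[of _ "\<lambda>j. pf (g (?a j))"])
  then have "eqU ?y (\<lambda>j. ps (g (?a j)))"
    by (rule inj[OF y y' z])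
  moreover have "eventually (\<lambda>j. z j < st n j i \<and> x j < st n j i \<and> q + m + i < j) ult"
    using zi i(2) ult_large by (intro eventually_conj)
  ultimately have "eventually (\<lambda>j. False) ult"
  proof (rule eventually_elim2)
    fix j assume eq: "?y j = ps (g (?a j))" and *: "z j < st n j i \<and> x j < st n j i \<and> q + m + i < j"
    have "ps (g (?a j)) = run (V n) (pdec q) (pp (st n j m) (pp (z j) (x j)))"
      by (simp add: q r)
    also have "\<dots> \<in> bad n j i"
      unfolding bad_def using * by (intro image_eqI[of _ _ "(q, m, z j, x j)"]) auto
    finally show False using gen(2)[of i j n] eq * by simp
  qed
  with ult(2) show False by (simp add: trivial_limit_def)
qed

lemma K_card_ax:
  assumes "Sig (Suc n) p" shows "K.valid n (card_ax p)"
  unfolding card_ax_def K.valid_ucl unfolding K_valid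
proof
  fix x assume x: "x \<in> K n"
  show "ksat n (kenv x) (Imp
     (Conj (All (Ex (inst2 2 (Var 1) (Var 0) p)))
     (Conj (All (All (All (Imp (Conj (inst2 3 (Var 2) (Var 1) p) (inst2 3 (Var 2) (Var 0) p))
                               (Eq (Var 1) (Var 0))))))
           (All (All (All (Imp (Conj (inst2 3 (Var 2) (Var 0) p) (inst2 3 (Var 1) (Var 0) p))
                               (Eq (Var 2) (Var 1))))))))
     (All (Ex (Ex (Conj (inst2 3 (Var 1) (Var 0) p) (Lt (Var 2) (Var 0)))))))"
  proof (simp add: sat_inst2, intro impI ballI, elim conjE)
    fix b assume b: "b \<in> K n"
      and total: "\<forall>u\<in>K n. \<exists>z\<in>K n. ksat n (u ## z ## kenv x) p"
      and inj: "\<forall>u\<in>K n. \<forall>u'\<in>K n. (\<exists>z\<in>K n. ksat n (u ## z ## kenv x) p \<and>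
        ksat n (u' ## z ## kenv x) p) \<longrightarrow> eqU u u'"
    show "\<exists>u\<in>K n. \<exists>z\<in>K n. ksat n (u ## z ## kenv x) p \<and> ltU b z"
      by (rule K_injection_unbounded[OF assms x b]) (use total inj in blast)+
  qed
qed

section \<open>Failure of the weak pigeonhole principle\<close>

lemma K_small:
  assumes "x \<in> K n" "eventually (\<lambda>j. x j < 2 * j) ult"
  shows "\<exists>i. eventually (\<lambda>j. guess n j i = x j) ult"
proof -
  obtain p l where x: "x = (\<lambda>j. run (V n) p (tup n l j))"
    using assms(1) by (auto simp: K_def PF_def) metis
  obtain c where c: "\<forall>j a x. x < st n j a \<longrightarrow> run (V n) p x < st n j (a + c) \<and>
     (\<forall>i\<ge>a + c. run (tot (st n j i) (osc n (st n j i))) p x = run (V n) p x)"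
    using run_bound[of n p] by (elim exE)
  obtain m where m: "pdec m = p" using pdec_surj by blast
  \<comment> \<open>The padding \<open>l + c\<close> pushes the stage past the point from which the
    truncated oracle computes the true value.\<close>
  define i where "i = pp (pp m (l + c)) l"
  have i: "l + c \<le> i"
    unfolding i_def using le_pp(2)[of "l + c" m] le_pp(1)[of "pp m (l + c)" l] by linarith
  from assms(2) ult_large[of i] have "eventually (\<lambda>j. guess n j i = x j) ult"
  proof (rule eventually_elim2)
    fix j assume j: "x j < 2 * j" "i < j"
    have "tup n l j < st n j l" using i j by (intro tup_less) simp
    then have "run (tot (st n j i) (osc n (st n j i))) p (tup n l j) = run (V n) p (tup n l j)"
      using c i by blast
    then have "run (tot (st n j i) (osc n (st n j i))) (pdec m) (tup n l j) = x j"
      unfolding m x .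
    with tup_guess[OF j(2) i_def, of n] have "min (x j) (2 * j) = guess n j i" by (simp only:)
    with j(1) show "guess n j i = x j" by simp
  qed
  then show ?thesis ..
qed

lemma sat_ExI: "sat D eq lt (u ## e) p \<Longrightarrow> u \<in> D \<Longrightarrow> sat D eq lt e (Ex p)"
  by auto

theorem theorem5p2:
  fixes n :: nat and E :: fm
  assumes "exp_graph E"
  shows "\<exists>p. Sig (Suc n) p \<and> \<not> prv (ISig n \<union> {exp_ax E} \<union> CSig (Suc n)) (wphp p)"
proof -
  obtain \<rho> where \<rho>: "Pi n \<rho>" "\<And>e. natsat e \<rho> = history n e"
    using PI_history[of n] by (auto simp: PI_def)
  define p where "p = Ex \<rho>"
  have "\<not> K.valid n (wphp p)"
  proof
    \<comment> \<open>\<open>?x0\<close> codes the assignment giving variable 0 the identity and all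
      others 0; it supplies the parameter j of \<open>p\<close>.\<close>
    let ?a = "\<lambda>j::nat. j" and ?x0 = "\<lambda>j. pp j 0"
    have a: "?a \<in> K n" and x0: "?x0 \<in> K n"
      by (intro K_ident K_pp K_const)+
    define P where "P x y \<longleftrightarrow> ksat n (x ## y ## kenv ?x0) p" for x y
    have P: "P x y \<longleftrightarrow> (\<exists>t\<in>K n. eventually (\<lambda>j. history n (t j ## x j ## y j ## env (pp j 0))) ult)"
      if "x \<in> K n" "y \<in> K n" for x y
    proof -
      have "elementary n \<rho>" using elementary_Sig_Pi[of n n \<rho>] \<rho>(1) by simp
      then have "ksat n (t ## x ## y ## kenv ?x0) \<rho> \<longleftrightarrow>
          eventually (\<lambda>j. history n (t j ## x j ## y j ## env (pp j 0))) ult" if "t \<in> K n" for t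
        using elementary_push[of n \<rho> t, OF _ \<open>t \<in> K n\<close> K_pp[OF \<open>x \<in> K n\<close> K_pp[OF \<open>y \<in> K n\<close> x0]]]
        by (simp add: push_kenv \<rho>(2))
      then show ?thesis by (simp add: P_def p_def)
    qed
    have least: "eventually (\<lambda>j. guess n j (y j) = x j \<and> (\<forall>l<y j. guess n j l \<noteq> x j)) ult"
      if xy: "x \<in> K n" "y \<in> K n" "P x y" for x y
    proof -
      obtain t where "eventually (\<lambda>j. history n (t j ## x j ## y j ## env (pp j 0))) ult"
        using xy(3) P[OF xy(1,2)] by blast
      then show ?thesis
        by (rule eventually_mono) (use history_guess in force)
    qed
    have total: "\<exists>y\<in>K n. ltU y ?a \<and> P x y" if x: "x \<in> K n" "ltU x (?a + ?a)" for x
    proof -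
      have "eventually (\<lambda>j. x j < 2 * j) ult" using x(2) by (simp add: mult_2)
      then obtain i where i: "eventually (\<lambda>j. guess n j i = x j) ult"
        using K_small[OF x(1)] by blast
      \<comment> \<open>The least stage guessing x varies with j but stays below a standard stage,
        so it is almost everywhere one standard y. Hence it lies below a, and its history is an
        element of \<open>K\<close>.\<close>
      then have "eventually (\<lambda>j. (LEAST y. guess n j y = x j) \<le> i) ult"
        by (rule eventually_mono) (rule Least_le)
      then obtain y where y: "eventually (\<lambda>j. (LEAST y. guess n j y = x j) = y) ult"
        using ult_bounded[of "\<lambda>j. LEAST y. guess n j y = x j" i] by blast
      have "(\<lambda>j. ht (st n j (Suc (Suc y)))) \<in> K n"
        unfolding ht_def by (rule K_PF[OF K_st]) (intro PF_pf PF_ps PF_id)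
      moreover from i y have "eventually (\<lambda>j. history n (ht (st n j (Suc (Suc y))) ## x j ## y ## env (pp j 0))) ult"
      proof (rule eventually_elim2)
        fix j assume *: "guess n j i = x j" "(LEAST y. guess n j y = x j) = y"
        have "guess n j y = x j" using LeastI[of "\<lambda>y. guess n j y = x j", OF *(1)] *(2) by simp
        moreover have "guess n j l \<noteq> x j" if "l < y" for l
          using not_less_Least[of l "\<lambda>y. guess n j y = x j"] that *(2) by simp
        ultimately show "history n (ht (st n j (Suc (Suc y))) ## x j ## y ## env (pp j 0))"
          unfolding env_pp by (rule history_exists)
      qed
      ultimately have "P x (\<lambda>j. y)"
        unfolding P[OF x(1) K_const] by (intro bexI[of _ "\<lambda>j. ht (st n j (Suc (Suc y)))"])
      then show ?thesis using ult_large[of y] by (intro bexI[OF _ K_const] conjI)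
    qed
    have funct: "eqU y y'" if "x \<in> K n" "y \<in> K n" "y' \<in> K n" "P x y" "P x y'" for x y y'
      using least[OF that(1,2,4)] least[OF that(1,3,5)]
      by (rule eventually_elim2) (metis linorder_neqE_nat)
    have inj: "eqU x x'" if "x \<in> K n" "x' \<in> K n" "y \<in> K n" "P x y" "P x' y" for x x' y
      using least[OF that(1,3,4)] least[OF that(2,3,5)]
      by (rule eventually_elim2) simp
    let ?B = "Conj (Lt Zero (Var 0))
     (Conj
       (All (Imp (Lt (Var 0) (Plus (Var 1) (Var 1)))
                 (Ex (Conj (Lt (Var 0) (Var 2)) (inst2 3 (Var 1) (Var 0) p)))))
     (Conj
       (All (All (All (Imp
          (Conj (Lt (Var 2) (Plus (Var 3) (Var 3))) (Conj (Lt (Var 1) (Var 3))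
          (Conj (Lt (Var 0) (Var 3))
          (Conj (inst2 4 (Var 2) (Var 1) p) (inst2 4 (Var 2) (Var 0) p)))))
          (Eq (Var 1) (Var 0))))))
       (All (All (All (Imp
          (Conj (Lt (Var 2) (Plus (Var 3) (Var 3))) (Conj (Lt (Var 1) (Plus (Var 3) (Var 3)))
          (Conj (Lt (Var 0) (Var 3))
          (Conj (inst2 4 (Var 2) (Var 0) p) (inst2 4 (Var 1) (Var 0) p)))))
          (Eq (Var 2) (Var 1))))))))"
    assume "K.valid n (wphp p)"
    then have neg: "\<not> ksat n (kenv ?x0) (Ex ?B)"
      unfolding wphp_def K.valid_ucl unfolding K_valid sat.simps(3) by (rule bspec[OF _ x0])
    have B: "ksat n (?a ## kenv ?x0) ?B"
      unfolding sat.simps(5)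
    proof (intro conjI)
      show "ksat n (?a ## kenv ?x0) (Lt Zero (Var 0))"
        using ult_large[of 0] by simp
    next
      show "ksat n (?a ## kenv ?x0) (All (Imp (Lt (Var 0) (Plus (Var 1) (Var 1)))
          (Ex (Conj (Lt (Var 0) (Var 2)) (inst2 3 (Var 1) (Var 0) p)))))"
        using total by (simp add: sat_inst2 P_def[symmetric])
    qed (use funct inj in \<open>auto simp: sat_inst2 P_def[symmetric]\<close>)
    show False
      using neg sat_ExI[OF B a] by (rule notE)
  qed
  moreover have "K.valid n q" if "q \<in> ISig n \<union> {exp_ax E} \<union> CSig (Suc n)" for q
    using that K_PAminus K_ind K_card_ax K_exp[OF assms] by (auto simp: ISig_def CSig_def)
  ultimately have "\<not> prv (ISig n \<union> {exp_ax E} \<union> CSig (Suc n)) (wphp p)"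
    using K.soundness by blast
  moreover have "Sig (Suc n) p"
    unfolding p_def using \<rho>(1) by (intro Sig_Pi.intros)
  ultimately show ?thesis by blast
qed

end
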